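(* Consider $\dot x=f(x)=Ax+F_n(x)$ on $\mathbb{R}^n$, with hyperbolic equilibrium at the origin and with principal Koopman eigenfunctions well defined. Let the origin be asymptotically stable with domain of attraction $\mathcal D$. Let the nonlinear term satisfy $F_n(x)=O(\|x\|^\ell)$ (as $x\to0$) with $\ell\ge2$. If the eigenvalue $\lambda$ of the linearization $A$ satisfies $$-\mathrm{Re}(\lambda)+\ell\,\mathrm{Re}(\lambda_{\max})<0,$$ where $\lambda_{\max}$ is the eigenvalue of $A$ with maximum real part, then the principal eigenfunction corresponding to $\lambda$ is given by $$\phi_\lambda(x)=w_\lambda^\top x+\int_0^\infty e^{-\lambda t}\,w_\lambda^\top F_n(s_t(x))\,dt\qquad\text{for all }x\in\mathcal D,$$ i.e. this formula defines a principal eigenfunction with eigenvalue $\lambda$ on $\mathcal D$.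
   Context: $f:\mathbb{R}^n\to\mathbb{R}^n$ is smooth with $f(0)=0$; $A=\frac{\partial f}{\partial x}(0)$ and $F_n(x)=f(x)-Ax$ is the purely nonlinear part; $s_t(x)$ is the solution of $\dot x=f(x)$ at time $t$ starting from $x$. $w_\lambda$ is a left eigenvector of $A$: $w_\lambda^\top A=\lambda w_\lambda^\top$. A (principal) Koopman eigenfunction $\phi_\lambda$ with eigenvalue $\lambda$ is a $C^1$ function with $\frac{\partial\phi_\lambda}{\partial x}(x)f(x)=\lambda\phi_\lambda(x)$, where $\lambda$ is an eigenvalue of $A$; it decomposes as $\phi_\lambda(x)=w_\lambda^\top x+h_\lambda(x)$ with $h_\lambda$ purely nonlinear, $\frac{\partial h_\lambda}{\partial x}(0)=0$. Equivalently, $h_\lambda$ satisfies the linear PDE $\frac{\partial h_\lambda}{\partial x}f(x)-\lambda h_\lambda(x)+w_\lambda^\top F_n(x)=0$. Standing assumption on the system: the origin is a hyperbolic equilibrium and there is a vector $\Phi:\mathbb{R}^n\to\mathbb{R}^n$ of principal eigenfunctions, well defined on $\mathbb{R}^n$, with $\frac{\partial\Phi}{\partial x}f(x)=\Lambda\Phi(x)$, $\Lambda$ (real Jordan form) having the eigenvalues of $A$. *)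

theory Defs
  imports "HOL-Analysis.Analysis" "HOL-Library.Landau_Symbols"
begin

(* Intended for open S. Continuity of the derivative is expressed through the directional
   derivatives, which on a Euclidean space is equivalent to continuity in operator norm. *)
primrec Ck_on :: "nat \<Rightarrow> 'a::euclidean_space set \<Rightarrow> ('a \<Rightarrow> 'b::real_normed_vector) \<Rightarrow> bool" where
  "Ck_on 0 S f \<longleftrightarrow> continuous_on S f"
| "Ck_on (Suc k) S f \<longleftrightarrow> (\<forall>x\<in>S. f differentiable (at x)) \<and>
     (\<forall>v. Ck_on k S (\<lambda>x. frechet_derivative f (at x) v))"

definition smooth_on :: "'a::euclidean_space set \<Rightarrow> ('a \<Rightarrow> 'b::real_normed_vector) \<Rightarrow> bool" where
  "smooth_on S f \<longleftrightarrow> (\<forall>k. Ck_on k S f)"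

definition linearization :: "(real^'n \<Rightarrow> real^'n) \<Rightarrow> real^'n^'n" where
  "linearization f = jacobian f (at 0)"

definition nonlinear_part :: "(real^'n \<Rightarrow> real^'n) \<Rightarrow> real^'n \<Rightarrow> real^'n" where
  "nonlinear_part f x = f x - linearization f *v x"

definition purely_nonlinear :: "(real^'n \<Rightarrow> 'b::real_normed_vector) \<Rightarrow> bool" where
  "purely_nonlinear h \<longleftrightarrow> h 0 = 0 \<and> (h has_derivative (\<lambda>_. 0)) (at 0)"


definition eigenvalue_of :: "real^'n^'n \<Rightarrow> complex \<Rightarrow> bool" where
  "eigenvalue_of A \<mu> \<longleftrightarrow> (\<exists>v. v \<noteq> 0 \<and> map_matrix complex_of_real A *v v = \<mu> *s v)"

definition left_eigenvector_of :: "real^'n^'n \<Rightarrow> complex \<Rightarrow> complex^'n \<Rightarrow> bool" where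
  "left_eigenvector_of A \<mu> w \<longleftrightarrow> w \<noteq> 0 \<and> w v* map_matrix complex_of_real A = \<mu> *s w"

(* The bilinear expression (transpose of w) times x; w is not conjugated. *)
definition linear_form :: "complex^'n \<Rightarrow> real^'n \<Rightarrow> complex" where
  "linear_form w x = (\<Sum>i\<in>UNIV. w $ i * complex_of_real (x $ i))"

(* Equality of characteristic polynomials: algebraic multiplicities are counted. *)
definition same_eigenvalues :: "real^'n^'n \<Rightarrow> real^'n^'n \<Rightarrow> bool" where
  "same_eigenvalues A B \<longleftrightarrow>
     (\<forall>z::complex. det (mat z - map_matrix complex_of_real A) = det (mat z - map_matrix complex_of_real B))"


(* A real Jordan block is coded by (k, \<mu>) with k > 0. If \<mu> is real, it is the ordinary k x k block.
   Otherwise it is the 2k x 2k block with diagonal cells [[a, b], [-b, a]], where \<mu> = a + b i,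
   and 2 x 2 identity cells on the block superdiagonal. *)
definition rj_size :: "nat \<times> complex \<Rightarrow> nat" where
  "rj_size B = (if Im (snd B) = 0 then fst B else 2 * fst B)"

definition rj_entry :: "nat \<times> complex \<Rightarrow> nat \<Rightarrow> nat \<Rightarrow> real" where
  "rj_entry B i j =
     (let a = Re (snd B); b = Im (snd B) in
      if b = 0 then (if j = i then a else if j = Suc i then 1 else 0)
      else if j = i then a
      else if even i \<and> j = Suc i then b
      else if odd i \<and> i = Suc j then - b
      else if j = i + 2 then 1
      else 0)"

fun rj_block_diag :: "(nat \<times> complex) list \<Rightarrow> nat \<Rightarrow> nat \<Rightarrow> real" where
  "rj_block_diag [] i j = 0"
| "rj_block_diag (B # Bs) i j =
     (let m = rj_size B in
      if i < m \<and> j < m then rj_entry B i j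
      else if m \<le> i \<and> m \<le> j then rj_block_diag Bs (i - m) (j - m)
      else 0)"

(* A finite index type carries no order, so an enumeration e of the coordinates is chosen. *)
definition real_jordan_form :: "real^'n^'n \<Rightarrow> bool" where
  "real_jordan_form J \<longleftrightarrow>
     (\<exists>Bs e. (\<forall>B\<in>set Bs. fst B > 0) \<and> sum_list (map rj_size Bs) = CARD('n) \<and>
        bij_betw e (UNIV::'n set) {..<CARD('n)} \<and>
        (\<forall>i j. J $ i $ j = rj_block_diag Bs (e i) (e j)))"


definition solves_from ::
    "(real^'n \<Rightarrow> real^'n) \<Rightarrow> real^'n \<Rightarrow> (real \<Rightarrow> real^'n) \<Rightarrow> real set \<Rightarrow> bool" where
  "solves_from f x u I \<longleftrightarrow>
     u 0 = x \<and> (\<forall>t\<in>I. (u has_vector_derivative f (u t)) (at t within I))"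

(* For t \<ge> 0 only; unspecified if the solution does not exist on {0..t}. For locally Lipschitz f
   solutions are unique, so the description is proper whenever a solution exists on {0..t}. *)
definition flow :: "(real^'n \<Rightarrow> real^'n) \<Rightarrow> real \<Rightarrow> real^'n \<Rightarrow> real^'n" where
  "flow f t x = (THE y. \<exists>u. solves_from f x u {0..t} \<and> u t = y)"

definition domain_of_attraction :: "(real^'n \<Rightarrow> real^'n) \<Rightarrow> (real^'n) set" where
  "domain_of_attraction f = {x. \<exists>u. solves_from f x u {0..} \<and> (u \<longlongrightarrow> 0) at_top}"

definition lyapunov_stable :: "(real^'n \<Rightarrow> real^'n) \<Rightarrow> bool" where
  "lyapunov_stable f \<longleftrightarrow>
     (\<forall>\<epsilon>>0. \<exists>\<delta>>0. \<forall>x. norm x < \<delta> \<longrightarrow>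
        (\<exists>u. solves_from f x u {0..} \<and> (\<forall>t\<ge>0. norm (u t) < \<epsilon>)))"

definition asymptotically_stable :: "(real^'n \<Rightarrow> real^'n) \<Rightarrow> bool" where
  "asymptotically_stable f \<longleftrightarrow>
     lyapunov_stable f \<and> (\<exists>\<delta>>0. ball 0 \<delta> \<subseteq> domain_of_attraction f)"

definition hyperbolic_equilibrium :: "(real^'n \<Rightarrow> real^'n) \<Rightarrow> bool" where
  "hyperbolic_equilibrium f \<longleftrightarrow>
     f 0 = 0 \<and> (\<forall>\<mu>. eigenvalue_of (linearization f) \<mu> \<longrightarrow> Re \<mu> \<noteq> 0)"


definition principal_eigenfunction_on ::
    "(real^'n) set \<Rightarrow> (real^'n \<Rightarrow> real^'n) \<Rightarrow> complex \<Rightarrow> complex^'n \<Rightarrow> (real^'n \<Rightarrow> complex) \<Rightarrow> bool" where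
  "principal_eigenfunction_on S f \<mu> w \<phi> \<longleftrightarrow>
     eigenvalue_of (linearization f) \<mu> \<and>
     left_eigenvector_of (linearization f) \<mu> w \<and>
     Ck_on 1 S \<phi> \<and>
     (\<forall>x\<in>S. frechet_derivative \<phi> (at x) (f x) = \<mu> * \<phi> x) \<and>
     (\<exists>h. purely_nonlinear h \<and> (\<forall>x\<in>S. \<phi> x = linear_form w x + h x))"

(* Real vector form: L groups conjugate pairs into real 2 x 2 cells, and W holds the corresponding
   (generalized) left eigenvectors as rows. *)
definition principal_eigenfunction_vector ::
    "(real^'n \<Rightarrow> real^'n) \<Rightarrow> real^'n^'n \<Rightarrow> (real^'n \<Rightarrow> real^'n) \<Rightarrow> bool" where
  "principal_eigenfunction_vector f L \<Phi> \<longleftrightarrow>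
     real_jordan_form L \<and> same_eigenvalues L (linearization f) \<and>
     Ck_on 1 UNIV \<Phi> \<and>
     (\<forall>x. frechet_derivative \<Phi> (at x) (f x) = L *v \<Phi> x) \<and>
     (\<exists>W H. W ** linearization f = L ** W \<and> (\<forall>i. row i W \<noteq> 0) \<and>
        purely_nonlinear H \<and> (\<forall>x. \<Phi> x = W *v x + H x))"

end

theory Submission
  imports Defs "HOL-Computational_Algebra.Fundamental_Theorem_Algebra" "HOL-Real_Asymp.Real_Asymp"
begin

text \<open>
  Write A for the linearization and F for the nonlinear part, so that a solution satisfies
  x' = A x + F(x). Since w is a left eigenvector, the derivative of exp(-\<mu> t) w(x(t)) is
  exp(-\<mu> t) w(F(x(t))). Integrating from 0 to T shows that the function of the theorem is
  \<phi>(x) = lim exp(-\<mu> t) w(s_t(x)) as t tends to infinity, once the integral converges. The limit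
  makes \<phi>(s_t(x)) = exp(\<mu> t) \<phi>(x) evident, and differentiating this at t = 0 gives the eigenfunction
  equation. What remains is the convergence of the integral and the C1 regularity of \<phi>.

  Convergence. As \<mu> is itself an eigenvalue, Re \<mu> is at most Re \<mu>max, so the gap condition yields
  (l - 1) Re \<mu>max < 0: all eigenvalues lie in the open left half plane. It also leaves room for a rate
  \<beta> with 0 < \<beta> < - Re \<mu>max and Re \<mu> + l \<beta> > 0. Attracted trajectories decay like exp(-\<beta> t), which is
  read off from a quadratic form adapted to A (lyapunov_form_exists). Hence F(s_t(x)) is
  O(exp(-l \<beta> t)), and the integrand decays exponentially.

  Regularity. Instead of differentiating the flow through the variational equation, the argument uses
  that a locally Lipschitz function whose second differences
  g(y + a + b) - g(y + a) - g(y + b) + g(y) are bounded by a multiple of |a| |b| is C1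
  (bounded_second_differences_imp_C1). Such bounds pass through integrals, and for the flow they are
  an energy estimate: the corresponding combination of four solutions satisfies a differential
  inequality with a quadratic forcing term (flow_estimates_near_attracted_point). In order to keep the
  rate l \<beta> for F(s_t(x)) as well, the order of vanishing of F has to be inherited by its first and
  second differences. This holds because F is smooth: Taylor expansion shows that a directional
  derivative of a smooth function of order O(|x|^p) has order O(|x|^(p-1))
  (vanishes_to_order_directional_derivative).

  Solutions near a given attracted one exist on a finite time interval by a Picard iteration for a
  cut-off vector field; after that time they are close to the origin, where Lyapunov stability provides
  them for all times.
\<close>

section \<open>Bounded second differences imply continuous differentiability\<close>

text \<open>The defect D(s) = L(s v) - s L(v) is additive in s and vanishes at the integers, so it equals its value
  at the fractional part of s and is bounded. An additive function that is bounded vanishes.\<close>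
lemma additive_bounded_imp_bounded_linear:
  fixes L :: "'a::real_normed_vector \<Rightarrow> 'b::real_normed_vector"
  assumes add: "\<And>a b. L (a + b) = L a + L b" and bd: "\<And>v. norm (L v) \<le> C * norm v"
  shows "bounded_linear L"
proof (rule bounded_linear_intro[where K = C])
  fix c :: real and v
  define D where "D s = L (s *\<^sub>R v) - s *\<^sub>R L v" for s :: real
  have L0: "L 0 = 0" using add[of 0 0] by simp
  have D_add: "D (s + t) = D s + D t" for s t
    by (simp add: D_def add algebra_simps)
  have D0: "D 0 = 0" and D1: "D 1 = 0" by (simp_all add: D_def L0)
  have D_minus: "D (- s) = - D s" for s
    using D_add[of s "- s"] D0 by (simp add: minus_equation_iff add_eq_0_iff)
  have D_nat: "D (real n * s) = real n *\<^sub>R D s" for n s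
    by (induction n) (auto simp: D0 D_add algebra_simps)
  have D_int: "D (of_int k) = 0" for k
  proof (cases k)
    case (nonneg n) then show ?thesis using D_nat[of n 1] D1 by simp
  next
    case (neg n) then show ?thesis using D_nat[of "Suc n" 1] D1 D_minus[of "real (Suc n)"] by simp
  qed
  have bound: "norm (D s) \<le> 2 * (C * norm v)" for s
  proof -
    have Cv: "0 \<le> C * norm v" using bd[of v] norm_ge_zero order_trans by blast
    have "D s = D (frac s)" using D_add[of "frac s" "of_int \<lfloor>s\<rfloor>"] D_int by (simp add: frac_def)
    also have "norm \<dots> \<le> norm (L (frac s *\<^sub>R v)) + norm (frac s *\<^sub>R L v)"
      unfolding D_def by (rule norm_triangle_ineq4)
    also have "norm (L (frac s *\<^sub>R v)) \<le> frac s * (C * norm v)"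
      using bd[of "frac s *\<^sub>R v"] by (simp add: frac_ge_0 mult_ac)
    also have "norm (frac s *\<^sub>R L v) \<le> frac s * (C * norm v)"
      using bd[of v] by (simp add: frac_ge_0 mult_left_mono)
    also have "frac s * (C * norm v) \<le> 1 * (C * norm v)"
      using Cv frac_lt_1[of s] by (intro mult_right_mono) auto
    finally show ?thesis by linarith
  qed
  have "D c = 0"
  proof (rule ccontr)
    assume "D c \<noteq> 0"
    then obtain n :: nat where "2 * (C * norm v) < real n * norm (D c)"
      using reals_Archimedean3[of "norm (D c)"] by auto
    moreover have "norm (D (real n * c)) = real n * norm (D c)" by (simp add: D_nat)
    ultimately show False using bound[of "real n * c"] by simp
  qed
  then show "L (c *\<^sub>R v) = c *\<^sub>R L v" by (simp add: D_def)
next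
  show "norm (L v) \<le> norm v * C" for v using bd[of v] by (simp add: mult.commute)
qed (rule add)

text \<open>The candidate for the derivative at x is the limit of the dyadic difference quotients
  2^n (\<phi>(x + v / 2^n) - \<phi>(x)). Consecutive quotients differ by a second difference with a = b, so they form
  a geometric series, whose sum is the quadratic remainder; the second differences in general position
  show that the limit is additive in v.\<close>
lemma second_difference_bound_imp_expansion:
  fixes \<phi> :: "'a::real_normed_vector \<Rightarrow> 'b::banach"
  assumes r: "0 < r" and C: "0 \<le> C"
    and lip: "\<And>v. norm v < r \<Longrightarrow> norm (\<phi> (x + v) - \<phi> x) \<le> K * norm v"
    and sd: "\<And>a b. norm a < r \<Longrightarrow> norm b < r \<Longrightarrow> norm (a + b) < r \<Longrightarrow>
       norm (\<phi> (x + a + b) - \<phi> (x + a) - \<phi> (x + b) + \<phi> x) \<le> C * norm a * norm b"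
  obtains L where "bounded_linear L"
    "\<And>v. norm v < r \<Longrightarrow> norm (\<phi> (x + v) - \<phi> x - L v) \<le> C * (norm v)\<^sup>2"
proof -
  define q where "q v n = 2 ^ n *\<^sub>R (\<phi> (x + (1 / 2 ^ n) *\<^sub>R v) - \<phi> x)" for v n
  have small: "eventually (\<lambda>n. norm ((1 / 2 ^ n) *\<^sub>R v) < r) sequentially" for v :: 'a
  proof -
    have "(\<lambda>n. (1 / 2) ^ n * norm v) \<longlonglongrightarrow> 0 * norm v"
      by (intro tendsto_mult LIMSEQ_power_zero tendsto_const) auto
    then have "eventually (\<lambda>n. (1 / 2) ^ n * norm v < r) sequentially"
      using r by (auto dest: order_tendstoD(2))
    then show ?thesis by (simp add: power_divide)
  qed
  have half: "norm ((1 / 2 ^ n) *\<^sub>R v) < r" if "norm v < r" for v :: 'a and n :: nat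
  proof -
    have "norm v * 1 \<le> norm v * 2 ^ n" by (intro mult_left_mono) auto
    then have "norm v / 2 ^ n \<le> norm v" by (simp add: divide_le_eq)
    then show ?thesis using that by simp
  qed
  have step: "norm (q v (Suc n) - q v n) \<le> C * (norm v)\<^sup>2 / 4 * (1 / 2) ^ n" if "norm v < r" for v n
  proof -
    define a where "a = (1 / 2 ^ Suc n) *\<^sub>R v"
    have aa: "a + a = (1 / 2 ^ n) *\<^sub>R v" by (simp add: a_def flip: scaleR_add_left)
    have na: "norm a = norm v / 2 ^ Suc n" by (simp add: a_def)
    have "q v (Suc n) = 2 ^ n *\<^sub>R (2 *\<^sub>R (\<phi> (x + a) - \<phi> x))"
      by (simp add: q_def a_def mult.commute)
    moreover have "q v n = 2 ^ n *\<^sub>R (\<phi> (x + a + a) - \<phi> x)"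
      by (simp add: q_def aa[symmetric] add.assoc)
    ultimately have "q v (Suc n) - q v n
        = 2 ^ n *\<^sub>R (- (\<phi> (x + a + a) - \<phi> (x + a) - \<phi> (x + a) + \<phi> x))"
      by (simp only: scaleR_diff_right[symmetric]) (simp add: scaleR_2 algebra_simps)
    then have "norm (q v (Suc n) - q v n)
        = 2 ^ n * norm (\<phi> (x + a + a) - \<phi> (x + a) - \<phi> (x + a) + \<phi> x)"
      by (simp only: norm_scaleR norm_minus_cancel) simp
    also have "\<dots> \<le> 2 ^ n * (C * norm a * norm a)"
    proof -
      have "norm a < r" unfolding a_def by (rule half[OF that])
      moreover have "norm (a + a) < r" unfolding aa by (rule half[OF that])
      ultimately show ?thesis by (intro mult_left_mono sd) auto
    qed
    also have "\<dots> = C * (norm v)\<^sup>2 / 4 * (1 / 2) ^ n"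
      by (simp add: na power2_eq_square power_divide field_simps)
    finally show ?thesis .
  qed
  have lim_small: "\<exists>l. q v \<longlonglongrightarrow> l \<and> norm (l - q v 0) \<le> C * (norm v)\<^sup>2" if "norm v < r" for v
  proof -
    define d where "d n = q v (Suc n) - q v n" for n
    have geo: "(\<lambda>n. C * (norm v)\<^sup>2 / 4 * (1 / 2) ^ n) sums (C * (norm v)\<^sup>2 / 4 * (1 / (1 - 1 / 2)))"
      by (intro sums_mult geometric_sums) auto
    have dn: "norm (d n) \<le> C * (norm v)\<^sup>2 / 4 * (1 / 2) ^ n" for n
      unfolding d_def by (rule step[OF that])
    have sn: "summable (\<lambda>n. norm (d n))"
      by (rule summable_comparison_test'[OF sums_summable[OF geo], of 0]) (use dn in auto)
    then have sd: "summable d" by (rule summable_norm_cancel)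
    have "(\<lambda>n. \<Sum>i<n. d i) \<longlonglongrightarrow> suminf d" by (rule summable_LIMSEQ[OF sd])
    then have "(\<lambda>n. (\<Sum>i<n. d i) + q v 0) \<longlonglongrightarrow> suminf d + q v 0" by (intro tendsto_intros)
    moreover have "(\<Sum>i<n. d i) + q v 0 = q v n" for n
      unfolding d_def by (subst sum_lessThan_telescope) simp
    ultimately have 1: "q v \<longlonglongrightarrow> suminf d + q v 0" by simp
    have "norm (suminf d) \<le> (\<Sum>n. norm (d n))" by (rule summable_norm[OF sn])
    also have "\<dots> \<le> (\<Sum>n. C * (norm v)\<^sup>2 / 4 * (1 / 2) ^ n)"
      by (rule suminf_le[OF dn sn sums_summable[OF geo]])
    also have "\<dots> = C * (norm v)\<^sup>2 / 2" using sums_unique[OF geo] by simp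
    also have "\<dots> \<le> C * (norm v)\<^sup>2" using C by simp
    finally show ?thesis using 1 by (intro exI[of _ "suminf d + q v 0"]) simp
  qed
  have conv: "convergent (q v)" for v
  proof -
    obtain k where k: "norm ((1 / 2 ^ k) *\<^sub>R v) < r"
      using small[of v] by (auto simp: eventually_sequentially)
    obtain l where "q ((1 / 2 ^ k) *\<^sub>R v) \<longlonglongrightarrow> l" using lim_small[OF k] by blast
    then have "(\<lambda>n. 2 ^ k *\<^sub>R q ((1 / 2 ^ k) *\<^sub>R v) n) \<longlonglongrightarrow> 2 ^ k *\<^sub>R l" by (intro tendsto_intros)
    moreover have "2 ^ k *\<^sub>R q ((1 / 2 ^ k) *\<^sub>R v) n = q v (n + k)" for n
      by (simp add: q_def power_add mult.commute)
    ultimately have "(\<lambda>n. q v (n + k)) \<longlonglongrightarrow> 2 ^ k *\<^sub>R l" by simp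
    then show ?thesis using LIMSEQ_offset convergent_def by blast
  qed
  define L where "L v = lim (q v)" for v
  have qL: "q v \<longlonglongrightarrow> L v" for v
    using conv[of v] by (simp add: L_def convergent_LIMSEQ_iff)
  have "L (a + b) = L a + L b" for a b
  proof -
    have "(\<lambda>n. q (a + b) n - q a n - q b n) \<longlonglongrightarrow> L (a + b) - L a - L b"
      by (intro tendsto_intros qL)
    moreover have "(\<lambda>n. q (a + b) n - q a n - q b n) \<longlonglongrightarrow> 0"
    proof (rule Lim_null_comparison)
      show "(\<lambda>n. C * norm a * norm b * (1 / 2) ^ n) \<longlonglongrightarrow> 0"
        using tendsto_mult_right_zero[OF LIMSEQ_power_zero[of "1 / 2 :: real"]] by auto
      show "\<forall>\<^sub>F n in sequentially.
          norm (q (a + b) n - q a n - q b n) \<le> C * norm a * norm b * (1 / 2) ^ n"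
        using small[of a] small[of b] small[of "a + b"]
      proof eventually_elim
        case (elim n)
        define a' b' where "a' = (1 / 2 ^ n) *\<^sub>R a" and "b' = (1 / 2 ^ n) *\<^sub>R b"
        have ab: "a' + b' = (1 / 2 ^ n) *\<^sub>R (a + b)" by (simp add: a'_def b'_def scaleR_add_right)
        have "q (a + b) n - q a n - q b n
          = 2 ^ n *\<^sub>R (\<phi> (x + a' + b') - \<phi> (x + a') - \<phi> (x + b') + \<phi> x)"
          unfolding q_def ab[symmetric] a'_def[symmetric] b'_def[symmetric]
          by (simp add: algebra_simps)
        then have "norm (q (a + b) n - q a n - q b n)
          = 2 ^ n * norm (\<phi> (x + a' + b') - \<phi> (x + a') - \<phi> (x + b') + \<phi> x)" by simp
        also have "\<dots> \<le> 2 ^ n * (C * norm a' * norm b')"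
          using elim by (intro mult_left_mono sd) (auto simp: a'_def b'_def scaleR_add_right)
        also have "\<dots> = C * norm a * norm b * (1 / 2) ^ n"
          by (simp add: a'_def b'_def power_divide field_simps)
        finally show ?case .
      qed
    qed
    ultimately have "L (a + b) - L a - L b = 0" using LIMSEQ_unique by blast
    then show ?thesis by (simp add: algebra_simps)
  qed
  moreover have "norm (L v) \<le> K * norm v" for v
  proof (rule tendsto_upperbound[OF tendsto_norm[OF qL]])
    show "\<forall>\<^sub>F n in sequentially. norm (q v n) \<le> K * norm v"
      using small[of v]
    proof eventually_elim
      case (elim n)
      have "norm (q v n) = 2 ^ n * norm (\<phi> (x + (1 / 2 ^ n) *\<^sub>R v) - \<phi> x)" by (simp add: q_def)
      also have "\<dots> \<le> 2 ^ n * (K * norm ((1 / 2 ^ n) *\<^sub>R v))"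
        using elim by (intro mult_left_mono lip) auto
      finally show ?case by simp
    qed
  qed simp
  ultimately have "bounded_linear L" by (rule additive_bounded_imp_bounded_linear)
  moreover have "norm (\<phi> (x + v) - \<phi> x - L v) \<le> C * (norm v)\<^sup>2" if v: "norm v < r" for v
  proof -
    obtain l where l: "q v \<longlonglongrightarrow> l" "norm (l - q v 0) \<le> C * (norm v)\<^sup>2" using lim_small[OF v] by blast
    have "l = L v" using l(1) qL LIMSEQ_unique by blast
    then show ?thesis using l(2) by (simp add: q_def norm_minus_commute)
  qed
  ultimately show thesis by (rule that)
qed

lemma quadratic_remainder_imp_has_derivative:
  fixes \<phi> :: "'a::real_normed_vector \<Rightarrow> 'b::real_normed_vector"
  assumes r: "0 < r" and L: "bounded_linear L"
    and rem: "\<And>v. norm v < r \<Longrightarrow> norm (\<phi> (x + v) - \<phi> x - L v) \<le> C * (norm v)\<^sup>2"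
  shows "(\<phi> has_derivative L) (at x)"
  unfolding has_derivative_at
proof (intro conjI L)
  show "(\<lambda>h. norm (\<phi> (x + h) - \<phi> x - L h) / norm h) \<midarrow>0\<rightarrow> 0"
  proof (rule Lim_null_comparison)
    have "(\<lambda>h::'a. C * norm h) \<midarrow>0\<rightarrow> C * norm (0::'a)" by (intro tendsto_intros)
    then show "(\<lambda>h::'a. C * norm h) \<midarrow>0\<rightarrow> 0" by simp
    show "\<forall>\<^sub>F h in at 0. norm (norm (\<phi> (x + h) - \<phi> x - L h) / norm h) \<le> C * norm h"
      unfolding eventually_at using r rem
      by (intro exI[of _ r]) (auto simp: divide_le_eq power2_eq_square mult_ac)
  qed
qed

text \<open>The remainder in the previous expansion is uniform in the base point. Expanding around two base points
  x and y then shows that the derivative itself depends on the base point in a Lipschitz way.\<close>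
lemma bounded_second_differences_imp_C1:
  fixes \<phi> :: "'a::euclidean_space \<Rightarrow> 'b::banach"
  assumes loc: "\<And>x. x \<in> S \<Longrightarrow> \<exists>r>0. \<exists>C\<ge>0. 
     (\<forall>y\<in>ball x r. \<forall>z\<in>ball x r. norm (\<phi> y - \<phi> z) \<le> C * norm (y - z)) \<and>
     (\<forall>y a b. y \<in> ball x r \<longrightarrow> y + a \<in> ball x r \<longrightarrow> y + b \<in> ball x r \<longrightarrow> y + a + b \<in> ball x r \<longrightarrow>
         norm (\<phi> (y + a + b) - \<phi> (y + a) - \<phi> (y + b) + \<phi> y) \<le> C * norm a * norm b)"
  shows "Ck_on 1 S \<phi>"
proof -
  have main: "\<phi> differentiable (at x) \<and> 
     isCont (\<lambda>x. frechet_derivative \<phi> (at x) v) x" if xS: "x \<in> S" for x v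
  proof -
    obtain r C where r: "0 < r" and C: "0 \<le> C"
      and lip: "\<And>y z. y \<in> ball x r \<Longrightarrow> z \<in> ball x r \<Longrightarrow> norm (\<phi> y - \<phi> z) \<le> C * norm (y - z)"
      and sd: "\<And>y a b. y \<in> ball x r \<Longrightarrow> y + a \<in> ball x r \<Longrightarrow> y + b \<in> ball x r \<Longrightarrow> y + a + b \<in> ball x r \<Longrightarrow>
         norm (\<phi> (y + a + b) - \<phi> (y + a) - \<phi> (y + b) + \<phi> y) \<le> C * norm a * norm b"
      using loc[OF xS] by blast
    define D where "D y = frechet_derivative \<phi> (at y)" for y
    have D: "(\<phi> has_derivative D y) (at y) \<and>
      (\<forall>v. norm v < r / 2 \<longrightarrow> norm (\<phi> (y + v) - \<phi> y - D y v) \<le> C * (norm v)\<^sup>2)"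
      if y: "dist x y < r / 2" for y
    proof -
      have inb: "y + v \<in> ball x r" if "norm v < r / 2" for v
        using y that dist_triangle[of x "y + v" y] by (simp add: dist_norm)
      have inb0: "y \<in> ball x r" using y r by simp
      obtain L where L: "bounded_linear L" 
        "\<And>v. norm v < r / 2 \<Longrightarrow> norm (\<phi> (y + v) - \<phi> y - L v) \<le> C * (norm v)\<^sup>2"
      proof (rule second_difference_bound_imp_expansion[of "r / 2" C \<phi> y C])
        show "norm (\<phi> (y + v) - \<phi> y) \<le> C * norm v" if "norm v < r / 2" for v
          using lip[OF inb[OF that] inb0] by simp
        show "norm (\<phi> (y + a + b) - \<phi> (y + a) - \<phi> (y + b) + \<phi> y) \<le> C * norm a * norm b"
          if "norm a < r / 2" "norm b < r / 2" "norm (a + b) < r / 2" for a b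
          using sd[OF inb0 inb[OF that(1)] inb[OF that(2)]] inb[OF that(3)] by (simp add: add.assoc)
      qed (use r C in auto)
      have hd: "(\<phi> has_derivative L) (at y)"
        by (rule quadratic_remainder_imp_has_derivative[OF _ L, of "r / 2"]) (use r in auto)
      then have "L = D y" unfolding D_def by (rule frechet_derivative_at)
      then show ?thesis using hd L(2) by simp
    qed
    \<comment> \<open>Compare the expansions of \<phi> (y + v') from y and from x, where v' is the multiple of v of the
        same length as y - x.\<close>
    have lipD: "norm (D y v - D x v) \<le> 6 * C * norm v * norm (y - x)"
      if y: "norm (y - x) < r / 4" for y v
    proof (cases "v = 0 \<or> y = x")
      case True
      have "linear (D y)" "linear (D x)"
        using D[of y] D[of x] y r has_derivative_linear by (fastforce simp: dist_norm norm_minus_commute)+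
      then show ?thesis using True by (auto simp: linear_0)
    next
      case False
      define d where "d = norm (y - x)"
      define v' where "v' = (d / norm v) *\<^sub>R v"
      have d: "0 < d" "d < r / 4" using False y by (auto simp: d_def)
      have nv': "norm v' = d" using False d by (simp add: v'_def)
      have dxy: "dist x y < r / 2" "dist x x < r / 2" 
        using y r by (auto simp: dist_norm norm_minus_commute)
      have lin: "linear (D y)" "linear (D x)"
        using D[OF dxy(1)] D[OF dxy(2)] has_derivative_linear by auto
      define e1 e2 e3 where "e1 = \<phi> (x + (y - x + v')) - \<phi> x - D x (y - x + v')"
        and "e2 = \<phi> (y + v') - \<phi> y - D y v'" and "e3 = \<phi> (x + (y - x)) - \<phi> x - D x (y - x)"
      have n1: "norm (y - x + v') \<le> 2 * d"
        using norm_triangle_ineq[of "y - x" v'] nv' by (simp add: d_def)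
      have "norm e1 \<le> C * (norm (y - x + v'))\<^sup>2"
        unfolding e1_def using n1 d by (intro D[OF dxy(2), THEN conjunct2, rule_format]) auto
      also have "\<dots> \<le> C * (2 * d)\<^sup>2" using n1 C by (intro mult_left_mono power_mono) auto
      finally have "norm e1 \<le> 4 * C * d\<^sup>2" by (simp add: power_mult_distrib)
      moreover have "norm e2 \<le> C * d\<^sup>2" 
        unfolding e2_def using D[OF dxy(1), THEN conjunct2, rule_format, of v'] nv' d by simp
      moreover have "norm e3 \<le> C * d\<^sup>2"
      proof -
        have "norm (y - x) < r / 2" using d unfolding d_def by linarith
        then show ?thesis
          unfolding e3_def d_def by (rule D[OF dxy(2), THEN conjunct2, rule_format])
      qed
      moreover have "norm (D y v' - D x v') = norm (e1 - e2 - e3)"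
        unfolding e1_def e2_def e3_def linear_add[OF lin(2), of "y - x" v'] by (simp add: algebra_simps)
      moreover have "norm (e1 - e2 - e3) \<le> norm e1 + norm e2 + norm e3"
        using norm_triangle_ineq4[of "e1 - e2" e3] norm_triangle_ineq4[of e1 e2] by linarith
      ultimately have "norm (D y v' - D x v') \<le> 6 * C * d\<^sup>2" by linarith
      moreover have "D y v' - D x v' = (d / norm v) *\<^sub>R (D y v - D x v)"
        by (simp add: v'_def linear_scale[OF lin(1)] linear_scale[OF lin(2)] scaleR_diff_right)
      ultimately have "d / norm v * norm (D y v - D x v) \<le> 6 * C * d\<^sup>2" using d by simp
      then have "norm (D y v - D x v) \<le> 6 * C * norm v * d"
        using d False by (simp add: field_simps power2_eq_square)
      then show ?thesis by (simp add: d_def)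
    qed
    have "(\<lambda>y. D y v) \<midarrow>x\<rightarrow> D x v"
    proof (subst LIM_zero_iff[symmetric], rule Lim_null_comparison)
      have "(\<lambda>y. 6 * C * norm v * norm (y - x)) \<midarrow>x\<rightarrow> 6 * C * norm v * norm (x - x)"
        by (intro tendsto_intros)
      then show "(\<lambda>y. 6 * C * norm v * norm (y - x)) \<midarrow>x\<rightarrow> 0" by simp
      show "\<forall>\<^sub>F y in at x. norm (D y v - D x v) \<le> 6 * C * norm v * norm (y - x)"
        unfolding eventually_at using r lipD by (intro exI[of _ "r / 4"]) (auto simp: dist_norm)
    qed
    then have "isCont (\<lambda>y. D y v) x" by (simp add: isCont_def)
    moreover have "\<phi> differentiable (at x)" using D[of x] r unfolding differentiable_def by auto
    ultimately show ?thesis unfolding D_def by blast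
  qed
  then show ?thesis by (auto intro!: continuous_at_imp_continuous_on)
qed

section \<open>Order of vanishing of smooth functions and of their differences\<close>

text \<open>A Markov type inequality, in the form needed to extract a derivative from a Taylor expansion: the
  constant depends on the degree only, and the length h of the interval is at our disposal. The induction
  lowers the degree by cancelling the top coefficient of p(s) against that of p(s / 2).\<close>
lemma polynomial_linear_coefficient_bound:
  assumes "1 \<le> k"
  shows "\<exists>C\<ge>0. \<forall>(a :: nat \<Rightarrow> 'b::real_normed_vector) h M. 0 < h \<longrightarrow>
     (\<forall>s\<in>{0..h}. norm (\<Sum>i\<le>k. s ^ i *\<^sub>R a i) \<le> M) \<longrightarrow> norm (a 1) * h \<le> C * M"
  using assms
proof (induction k rule: nat_induct_at_least)
  case base
  have "norm (a 1) * h \<le> 2 * M"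
    if h: "0 < h" and M: "\<forall>s\<in>{0..h}. norm (\<Sum>i\<le>1. s ^ i *\<^sub>R a i) \<le> M" 
    for a :: "nat \<Rightarrow> 'b" and h M
  proof -
    have "norm (a 0) \<le> M" using M[rule_format, of 0] h by simp
    moreover have "norm (a 0 + h *\<^sub>R a 1) \<le> M" using M[rule_format, of h] h by simp
    ultimately have "norm ((a 0 + h *\<^sub>R a 1) - a 0) \<le> 2 * M" 
      using norm_triangle_ineq4[of "a 0 + h *\<^sub>R a 1" "a 0"] by linarith
    then show ?thesis using h by (simp add: mult.commute)
  qed
  then show ?case by (intro exI[of _ 2]) simp
next
  case (Suc k)
  then obtain C where C: "0 \<le> C" and IH: "\<And>(a :: nat \<Rightarrow> 'b) h M. 0 < h \<Longrightarrow>
     (\<forall>s\<in>{0..h}. norm (\<Sum>i\<le>k. s ^ i *\<^sub>R a i) \<le> M) \<Longrightarrow> norm (a 1) * h \<le> C * M" by blast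
  have "norm (a 1) * h \<le> C * (2 ^ Suc k + 1) * M"
    if h: "0 < h" and M: "\<forall>s\<in>{0..h}. norm (\<Sum>i\<le>Suc k. s ^ i *\<^sub>R a i) \<le> M" 
    for a :: "nat \<Rightarrow> 'b" and h M
  proof -
    define p where "p s = (\<Sum>i\<le>Suc k. s ^ i *\<^sub>R a i)" for s
    define b where "b i = (2 ^ Suc k / 2 ^ i - 1) *\<^sub>R a i" for i
    \<comment> \<open>the combination of the polynomial at s and at s / 2 that cancels the top coefficient\<close>
    have q: "(\<Sum>i\<le>k. s ^ i *\<^sub>R b i) = 2 ^ Suc k *\<^sub>R p (s / 2) - p s" for s :: real
    proof -
      have "2 ^ Suc k *\<^sub>R p (s / 2) - p s
        = (\<Sum>i\<le>Suc k. 2 ^ Suc k *\<^sub>R ((s / 2) ^ i *\<^sub>R a i) - s ^ i *\<^sub>R a i)"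
        unfolding p_def by (simp only: scaleR_sum_right sum_subtractf)
      also have "\<dots> = (\<Sum>i\<le>Suc k. s ^ i *\<^sub>R b i)"
        by (intro sum.cong refl, simp only: b_def scaleR_scaleR scaleR_diff_left[symmetric])
          (simp add: power_divide right_diff_distrib mult.commute)
      also have "\<dots> = (\<Sum>i\<le>k. s ^ i *\<^sub>R b i)" by (simp add: b_def)
      finally show ?thesis by simp
    qed
    have pM: "norm (p s) \<le> M" if "s \<in> {0..h}" for s unfolding p_def using M that by blast
    have "0 \<in> {0..h}" using h by simp
    then have M0: "0 \<le> M" using M norm_ge_zero order_trans by blast
    have "norm (\<Sum>i\<le>k. s ^ i *\<^sub>R b i) \<le> (2 ^ Suc k + 1) * M" if s: "s \<in> {0..h}" for s
    proof -
      have "norm (2 ^ Suc k *\<^sub>R p (s / 2) - p s) \<le> 2 ^ Suc k * norm (p (s / 2)) + norm (p s)"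
        using norm_triangle_ineq4[of "2 ^ Suc k *\<^sub>R p (s / 2)" "p s"] by simp
      also have "\<dots> \<le> 2 ^ Suc k * M + M"
        using s h by (intro add_mono mult_left_mono pM) auto
      finally show ?thesis unfolding q by (simp add: algebra_simps)
    qed
    then have "norm (b 1) * h \<le> C * ((2 ^ Suc k + 1) * M)" using IH[OF h] by blast
    moreover have "norm (a 1) \<le> norm (b 1)"
    proof -
      have "(2::real) ^ 1 \<le> 2 ^ k" using Suc.hyps by (intro power_increasing) auto
      then have "1 \<le> \<bar>2 ^ k - 1 :: real\<bar>" by simp
      from mult_right_mono[OF this norm_ge_zero[of "a 1"]] show ?thesis by (simp add: b_def)
    qed
    then have "norm (a 1) * h \<le> norm (b 1) * h" using h by (intro mult_right_mono) auto
    ultimately show ?thesis by (simp add: mult.assoc)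
  qed
  then have "\<forall>(a :: nat \<Rightarrow> 'b) h M. 0 < h \<longrightarrow>
     (\<forall>s\<in>{0..h}. norm (\<Sum>i\<le>Suc k. s ^ i *\<^sub>R a i) \<le> M) \<longrightarrow>
     norm (a 1) * h \<le> C * (2 ^ Suc k + 1) * M" by blast
  moreover have "0 \<le> C * (2 ^ Suc k + 1)" using C by simp
  ultimately show ?case by blast
qed

lemma Ck_on_Suc_D:
  assumes "Ck_on (Suc k) S f"
  shows "x \<in> S \<Longrightarrow> f differentiable (at x)" "Ck_on k S (\<lambda>x. frechet_derivative f (at x) v)"
  using assms by auto

lemma smooth_on_directional_derivative:
  assumes "smooth_on S f"
  shows "smooth_on S (\<lambda>x. frechet_derivative f (at x) v)"
  using assms unfolding smooth_on_def by (metis Ck_on.simps(2))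

lemma smooth_on_has_derivative:
  assumes "smooth_on UNIV f"
  shows "(f has_derivative frechet_derivative f (at x)) (at x)"
  using assms unfolding smooth_on_def
  by (metis Ck_on_Suc_D(1) UNIV_I frechet_derivative_works)

lemma smooth_on_continuous_on:
  assumes "smooth_on S f"
  shows "continuous_on S f"
  using assms unfolding smooth_on_def by (metis Ck_on.simps(1))

lemma Ck_on_const: "Ck_on k S (\<lambda>_. c)"
  by (induction k arbitrary: c) (auto simp: frechet_derivative_const)

lemma smooth_on_bounded_linear:
  assumes "bounded_linear L" shows "smooth_on S L"
  unfolding smooth_on_def
proof
  fix k show "Ck_on k S L"
  proof (cases k)
    case 0 then show ?thesis using assms by (simp add: linear_continuous_on)
  next
    case (Suc m)
    have "(L has_derivative L) (at x)" for x 
      using assms by (rule bounded_linear_imp_has_derivative)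
    then have "frechet_derivative L (at x) = L" "L differentiable (at x)" for x
      by (auto intro: frechet_derivative_at[symmetric] differentiableI)
    then show ?thesis by (simp add: Suc Ck_on_const)
  qed
qed

lemma Ck_on_diff:
  assumes "Ck_on k UNIV f" "Ck_on k UNIV g"
  shows "Ck_on k UNIV (\<lambda>x. f x - g x)"
  using assms
proof (induction k arbitrary: f g)
  case 0 then show ?case by (auto intro: continuous_on_diff)
next
  case (Suc k)
  have fg: "(f has_derivative frechet_derivative f (at x)) (at x)"
    "(g has_derivative frechet_derivative g (at x)) (at x)" for x
    using Suc.prems by (auto simp: frechet_derivative_works)
  have eq: "frechet_derivative (\<lambda>x. f x - g x) (at x)
    = (\<lambda>v. frechet_derivative f (at x) v - frechet_derivative g (at x) v)" for x
    by (rule frechet_derivative_at[symmetric], rule has_derivative_diff[OF fg])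
  then show ?case using Suc by (auto intro: differentiable_diff)
qed

lemma smooth_on_diff:
  "smooth_on UNIV f \<Longrightarrow> smooth_on UNIV g \<Longrightarrow> smooth_on UNIV (\<lambda>x. f x - g x)"
  unfolding smooth_on_def by (blast intro: Ck_on_diff)

text \<open>The bound refers to the radius \<sigma> of a ball around 0 because 0 powr p is 0: a bound by a multiple of
  norm x powr p would force G 0 = 0 even for p = 0, a case that arises from the second derivatives of a
  function of order 2.\<close>
definition vanishes_to_order :: "('a::real_normed_vector \<Rightarrow> 'b::real_normed_vector) \<Rightarrow> real \<Rightarrow> bool" where
  "vanishes_to_order G p \<longleftrightarrow> (\<forall>R>0. \<exists>C\<ge>0. \<forall>\<sigma>. 0 < \<sigma> \<longrightarrow> \<sigma> \<le> R \<longrightarrow>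
     (\<forall>x. norm x \<le> \<sigma> \<longrightarrow> norm (G x) \<le> C * \<sigma> powr p))"

lemma vanishes_to_orderD:
  assumes "vanishes_to_order G p" "0 < R"
  obtains C where "0 \<le> C" "\<And>\<sigma> x. 0 < \<sigma> \<Longrightarrow> \<sigma> \<le> R \<Longrightarrow> norm x \<le> \<sigma> \<Longrightarrow> norm (G x) \<le> C * \<sigma> powr p"
proof -
  have "\<exists>C\<ge>0. \<forall>\<sigma>. 0 < \<sigma> \<longrightarrow> \<sigma> \<le> R \<longrightarrow> (\<forall>x. norm x \<le> \<sigma> \<longrightarrow> norm (G x) \<le> C * \<sigma> powr p)"
    by (rule assms(1)[unfolded vanishes_to_order_def, rule_format, OF assms(2)])
  then show thesis using that by auto
qed

text \<open>Restrict G to the segment of length \<sigma> from x in direction u. Up to a remainder of higher order, the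
  restriction is a polynomial, which is of size \<sigma>^p on the whole segment. So its linear coefficient, which
  is the directional derivative, is of size \<sigma>^(p-1).\<close>
lemma vanishes_to_order_directional_derivative:
  fixes G :: "'a::euclidean_space \<Rightarrow> 'b::banach"
  assumes smooth: "smooth_on UNIV G" and van: "vanishes_to_order G p"
  shows "vanishes_to_order (\<lambda>x. frechet_derivative G (at x) u) (p - 1)"
  unfolding vanishes_to_order_def
proof (intro allI impI)
  fix R :: real assume R: "0 < R"
  define D where "D j = ((\<lambda>g x. frechet_derivative g (at x) u) ^^ j) G" for j
  have D0: "D 0 = G" and D1: "D 1 = (\<lambda>x. frechet_derivative G (at x) u)" by (simp_all add: D_def)
  have DSuc: "D (Suc j) = (\<lambda>x. frechet_derivative (D j) (at x) u)" for j by (simp add: D_def)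
  have smD: "smooth_on UNIV (D j)" for j
  proof (induction j)
    case 0 show ?case unfolding D0 by (rule smooth)
  next
    case (Suc j) then show ?case unfolding DSuc by (rule smooth_on_directional_derivative)
  qed
  \<comment> \<open>A Taylor polynomial of degree n \<ge> p - 1, so that the remainder, of size \<sigma>^(n+1), is also of size \<sigma>^p.\<close>
  define n where "n = Suc (nat \<lceil>\<bar>p\<bar>\<rceil>)"
  have n1: "1 \<le> n" and np: "p \<le> real (Suc n)" unfolding n_def by linarith+
  define R' where "R' = (1 + norm u) * R"
  have R': "0 < R'" using R by (simp add: R'_def add_pos_nonneg)
  obtain C0 where C0: "0 \<le> C0"
    "\<And>\<sigma> x. 0 < \<sigma> \<Longrightarrow> \<sigma> \<le> R' \<Longrightarrow> norm x \<le> \<sigma> \<Longrightarrow> norm (G x) \<le> C0 * \<sigma> powr p"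
    using vanishes_to_orderD[OF van R'] by blast
  have "bounded (D (Suc n) ` cball 0 R')"
    by (intro compact_imp_bounded compact_continuous_image compact_cball
        continuous_on_subset[OF smooth_on_continuous_on[OF smD]]) simp
  then obtain K where K: "0 < K" "\<And>x. norm x \<le> R' \<Longrightarrow> norm (D (Suc n) x) \<le> K"
    unfolding bounded_pos by auto
  obtain Cp where Cp: "0 \<le> Cp" "\<And>(a :: nat \<Rightarrow> 'b) h M. 0 < h \<Longrightarrow>
     (\<forall>s\<in>{0..h}. norm (\<Sum>i\<le>n. s ^ i *\<^sub>R a i) \<le> M) \<Longrightarrow> norm (a 1) * h \<le> Cp * M"
    using polynomial_linear_coefficient_bound[OF n1] by blast
  define C1 where "C1 = C0 * (1 + norm u) powr p + K * R powr (real (Suc n) - p)"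
  show "\<exists>C\<ge>0. \<forall>\<sigma>>0. \<sigma> \<le> R \<longrightarrow> (\<forall>x. norm x \<le> \<sigma> \<longrightarrow>
    norm (frechet_derivative G (at x) u) \<le> C * \<sigma> powr (p - 1))"
  proof (intro exI[of _ "Cp * C1"] conjI allI impI)
    show "0 \<le> Cp * C1" using Cp(1) C0(1) K(1) by (simp add: C1_def)
    fix \<sigma> x assume \<sigma>: "0 < \<sigma>" "\<sigma> \<le> R" and x: "norm (x::'a) \<le> \<sigma>"
    have seg: "norm (x + s *\<^sub>R u) \<le> (1 + norm u) * \<sigma>" if "s \<in> {0..\<sigma>}" for s
    proof -
      have "norm (x + s *\<^sub>R u) \<le> norm x + \<bar>s\<bar> * norm u" using norm_triangle_ineq[of x "s *\<^sub>R u"] by simp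
      also have "\<dots> \<le> \<sigma> + \<sigma> * norm u" using x that by (intro add_mono mult_right_mono) auto
      finally show ?thesis by (simp add: algebra_simps)
    qed
    have le: "(1 + norm u) * \<sigma> \<le> R'" "0 < (1 + norm u) * \<sigma>"
      unfolding R'_def using \<sigma> by (auto intro!: mult_left_mono mult_pos_pos add_pos_nonneg)
    define a where "a i = (1 / fact i) *\<^sub>R D i x" for i
    have "norm (\<Sum>i\<le>n. s ^ i *\<^sub>R a i) \<le> C1 * \<sigma> powr p" if s: "s \<in> {0..\<sigma>}" for s
    proof -
      define Df where "Df i t = D i (x + t *\<^sub>R u)" for i t
      have dD: "(Df m has_vector_derivative Df (Suc m) t) (at t within T)" for m t T
      proof -
        have 1: "(D m has_derivative frechet_derivative (D m) (at (x + t *\<^sub>R u))) (at (x + t *\<^sub>R u))"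
          by (rule smooth_on_has_derivative[OF smD])
        have "((\<lambda>t. D m (x + t *\<^sub>R u)) has_derivative
            (\<lambda>h. frechet_derivative (D m) (at (x + t *\<^sub>R u)) (h *\<^sub>R u))) (at t within T)"
          by (rule has_derivative_compose[where f = "\<lambda>t. x + t *\<^sub>R u" and f' = "\<lambda>h. h *\<^sub>R u", OF _ 1])
              (auto intro!: derivative_eq_intros)
        moreover have "frechet_derivative (D m) (at (x + t *\<^sub>R u)) (h *\<^sub>R u)
           = h *\<^sub>R frechet_derivative (D m) (at (x + t *\<^sub>R u)) u" for h
          using linear_scale[OF has_derivative_linear[OF 1]] .
        ultimately show ?thesis unfolding has_vector_derivative_def Df_def DSuc by simp
      qed
      define ig where "ig t = ((s - t) ^ n / fact n) *\<^sub>R Df (Suc n) t" for t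
      have tay: "(ig has_integral Df 0 s - (\<Sum>i<Suc n. ((s - 0) ^ i / fact i) *\<^sub>R Df i 0)) {0..s}"
        using Taylor_has_integral[of "Suc n" Df "Df 0" 0 s] dD s unfolding ig_def by simp
      have "norm (Df 0 s - (\<Sum>i<Suc n. ((s - 0) ^ i / fact i) *\<^sub>R Df i 0)) \<le> (s ^ n * K) * (s - 0)"
      proof (rule order_trans[OF has_integral_bound_real[OF _ finite.emptyI tay]])
        show "0 \<le> s ^ n * K" using s K by auto
        show "norm (ig t) \<le> s ^ n * K" if "t \<in> {0..s} - {}" for t
        proof -
          have "norm (Df (Suc n) t) \<le> K"
            unfolding Df_def using seg[of t] le that s by (intro K(2)) auto
          moreover have "\<bar>(s - t) ^ n / fact n\<bar> \<le> s ^ n"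
          proof -
            have "\<bar>(s - t) ^ n / fact n\<bar> = (s - t) ^ n / fact n" using that by simp
            also have "\<dots> \<le> (s - t) ^ n / 1"
              using that by (intro divide_left_mono) (auto simp: fact_ge_1)
            also have "\<dots> \<le> s ^ n" using that by (auto intro: power_mono)
            finally show ?thesis .
          qed
          ultimately show ?thesis unfolding ig_def norm_scaleR
            using s by (intro mult_mono) auto
        qed
      qed (use s in auto)
      moreover have "(\<Sum>i<Suc n. ((s - 0) ^ i / fact i) *\<^sub>R Df i 0) = (\<Sum>i\<le>n. s ^ i *\<^sub>R a i)"
        by (simp add: lessThan_Suc_atMost Df_def a_def)
      moreover have "Df 0 s = G (x + s *\<^sub>R u)" by (simp add: Df_def D0)
      ultimately have "norm (G (x + s *\<^sub>R u) - (\<Sum>i\<le>n. s ^ i *\<^sub>R a i)) \<le> K * s ^ Suc n"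
        by (simp add: mult_ac)
      then have "norm (\<Sum>i\<le>n. s ^ i *\<^sub>R a i) \<le> norm (G (x + s *\<^sub>R u)) + K * s ^ Suc n"
        using norm_triangle_ineq2[of "\<Sum>i\<le>n. s ^ i *\<^sub>R a i" "G (x + s *\<^sub>R u)"]
        by (simp add: norm_minus_commute)
      also have "norm (G (x + s *\<^sub>R u)) \<le> C0 * ((1 + norm u) * \<sigma>) powr p"
        using C0(2)[OF le(2,1) seg[OF s]] .
      also have "\<dots> = C0 * (1 + norm u) powr p * \<sigma> powr p"
        using \<sigma> by (simp add: powr_mult)
      also have "K * s ^ Suc n \<le> K * (R powr (real (Suc n) - p) * \<sigma> powr p)"
      proof (intro mult_left_mono)
        have "s ^ Suc n \<le> \<sigma> ^ Suc n" using s by (intro power_mono) auto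
        also have "\<dots> = \<sigma> powr (real (Suc n) - p) * \<sigma> powr p"
          using \<sigma> by (simp add: powr_realpow[symmetric] del: power_Suc flip: powr_add)
        also have "\<dots> \<le> R powr (real (Suc n) - p) * \<sigma> powr p"
          using \<sigma> np by (intro mult_right_mono powr_mono2) auto
        finally show "s ^ Suc n \<le> R powr (real (Suc n) - p) * \<sigma> powr p" .
      qed (use K in auto)
      finally show ?thesis by (simp add: C1_def algebra_simps)
    qed
    then have "norm (a 1) * \<sigma> \<le> Cp * (C1 * \<sigma> powr p)" using Cp(2)[OF \<sigma>(1)] by blast
    moreover have a1: "a 1 = frechet_derivative G (at x) u" using D1 by (simp add: a_def)
    ultimately have main: "norm (frechet_derivative G (at x) u) * \<sigma> \<le> Cp * (C1 * \<sigma> powr p)" by simp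
    show "norm (frechet_derivative G (at x) u) \<le> Cp * C1 * \<sigma> powr (p - 1)"
    proof -
      have "\<sigma> powr p = \<sigma> powr (p - 1) * \<sigma>" using \<sigma> by (simp add: powr_diff)
      with main have "norm (frechet_derivative G (at x) u) * \<sigma> \<le> (Cp * C1 * \<sigma> powr (p - 1)) * \<sigma>"
        by (simp only: mult.assoc)
      then show ?thesis using \<sigma>(1) by (simp only: mult_le_cancel_right_pos)
    qed
  qed
qed

lemma directional_derivatives_bound_imp_lipschitz:
  fixes G :: "'a::euclidean_space \<Rightarrow> 'b::real_normed_vector" and K :: real
  assumes S: "convex S" and G: "\<And>x. x \<in> S \<Longrightarrow> G differentiable (at x)"
    and K: "\<And>x u. x \<in> S \<Longrightarrow> u \<in> Basis \<Longrightarrow> norm (frechet_derivative G (at x) u) \<le> K"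
    and x: "x \<in> S" and y: "y \<in> S"
  shows "norm (G x - G y) \<le> DIM('a) * K * norm (x - y)"
proof (rule differentiable_bound[OF S _ _ x y])
  fix z assume z: "z \<in> S"
  have d: "(G has_derivative frechet_derivative G (at z)) (at z)"
    using G[OF z] by (simp add: frechet_derivative_works)
  then show "(G has_derivative frechet_derivative G (at z)) (at z within S)"
    by (rule has_derivative_at_withinI)
  interpret bounded_linear "frechet_derivative G (at z)"
    using d by (rule has_derivative_bounded_linear)
  show "onorm (frechet_derivative G (at z)) \<le> DIM('a) * K"
  proof (rule onorm_le)
    fix v
    have "frechet_derivative G (at z) v = (\<Sum>u\<in>Basis. (inner v u) *\<^sub>R frechet_derivative G (at z) u)"
      using arg_cong[OF euclidean_representation[of v], of "frechet_derivative G (at z)"]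
      by (simp add: sum scaleR)
    also have "norm \<dots> \<le> (\<Sum>u\<in>(Basis::'a set). norm v * K)"
    proof (rule sum_norm_le)
      fix u :: 'a assume u: "u \<in> Basis"
      have "\<bar>inner v u\<bar> * norm (frechet_derivative G (at z) u) \<le> norm v * K"
        by (rule mult_mono[OF Basis_le_norm[OF u] K[OF z u]]) auto
      then show "norm (inner v u *\<^sub>R frechet_derivative G (at z) u) \<le> norm v * K" by simp
    qed
    finally show "norm (frechet_derivative G (at z) v) \<le> DIM('a) * K * norm v"
      by (simp add: mult_ac)
  qed
qed

lemma vanishes_to_order_lipschitz:
  fixes G :: "'a::euclidean_space \<Rightarrow> 'b::banach"
  assumes smooth: "smooth_on UNIV G" and van: "vanishes_to_order G p" and R: "0 < R"
  obtains C where "0 \<le> C" "\<And>\<sigma> x y. 0 < \<sigma> \<Longrightarrow> \<sigma> \<le> R \<Longrightarrow> norm x \<le> \<sigma> \<Longrightarrow> norm y \<le> \<sigma> \<Longrightarrow>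
     norm (G x - G y) \<le> C * \<sigma> powr (p - 1) * norm (x - y)"
proof -
  have "\<forall>u. \<exists>C\<ge>0. \<forall>\<sigma>. 0 < \<sigma> \<longrightarrow> \<sigma> \<le> R \<longrightarrow> (\<forall>x. norm x \<le> \<sigma> \<longrightarrow>
      norm (frechet_derivative G (at x) u) \<le> C * \<sigma> powr (p - 1))"
    using vanishes_to_order_directional_derivative[OF smooth van] R
    unfolding vanishes_to_order_def by blast
  then obtain c where c: "\<And>u. 0 \<le> c u" "\<And>u \<sigma> x. 0 < \<sigma> \<Longrightarrow> \<sigma> \<le> R \<Longrightarrow> norm x \<le> \<sigma> \<Longrightarrow>
      norm (frechet_derivative G (at x) u) \<le> c u * \<sigma> powr (p - 1)"
    by metis
  define C where "C = sum c (Basis :: 'a set)"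
  have cC: "c u \<le> C" if "u \<in> Basis" for u :: 'a
    unfolding C_def using that c(1) by (intro member_le_sum) auto
  show thesis
  proof (rule that[of "DIM('a) * C"])
    show "0 \<le> DIM('a) * C" using c(1) by (simp add: C_def sum_nonneg)
    fix \<sigma> :: real and x y :: 'a
    assume \<sigma>: "0 < \<sigma>" "\<sigma> \<le> R" and xy: "norm x \<le> \<sigma>" "norm y \<le> \<sigma>"
    have "norm (G x - G y) \<le> DIM('a) * (C * \<sigma> powr (p - 1)) * norm (x - y)"
    proof (rule directional_derivatives_bound_imp_lipschitz[where S = "cball 0 \<sigma>" and G = G and x = x and y = y])
      fix z u :: 'a assume z: "z \<in> cball 0 \<sigma>" and u: "u \<in> Basis"
      have "norm (frechet_derivative G (at z) u) \<le> c u * \<sigma> powr (p - 1)"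
        using \<sigma> z by (intro c(2)) auto
      also have "\<dots> \<le> C * \<sigma> powr (p - 1)" using cC[OF u] by (intro mult_right_mono) auto
      finally show "norm (frechet_derivative G (at z) u) \<le> C * \<sigma> powr (p - 1)" .
    qed (use xy smooth_on_has_derivative[OF smooth] in \<open>auto intro: differentiableI\<close>)
    then show "norm (G x - G y) \<le> DIM('a) * C * \<sigma> powr (p - 1) * norm (x - y)"
      by (simp add: mult_ac)
  qed
qed

text \<open>Apply the Lipschitz bound for the directional derivatives of G to the function y \<mapsto> G(y + a) - G(y), on the
  convex set of those y for which both y and y + a lie in the ball.\<close>
lemma vanishes_to_order_second_difference:
  fixes G :: "'a::euclidean_space \<Rightarrow> 'b::banach"
  assumes smooth: "smooth_on UNIV G" and van: "vanishes_to_order G p" and R: "0 < R"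
  obtains C where "0 \<le> C" "\<And>\<sigma> x a b. 0 < \<sigma> \<Longrightarrow> \<sigma> \<le> R \<Longrightarrow> norm x \<le> \<sigma> \<Longrightarrow> norm (x + a) \<le> \<sigma> \<Longrightarrow>
     norm (x + b) \<le> \<sigma> \<Longrightarrow> norm (x + a + b) \<le> \<sigma> \<Longrightarrow>
     norm (G (x + a + b) - G (x + a) - G (x + b) + G x) \<le> C * \<sigma> powr (p - 2) * norm a * norm b"
proof -
  define D where "D u x = frechet_derivative G (at x) u" for u x
  have dG: "(G has_derivative (\<lambda>u. D u x)) (at x)" for x
    unfolding D_def using smooth_on_has_derivative[OF smooth] .
  have "\<exists>C\<ge>0. \<forall>\<sigma> x y. 0 < \<sigma> \<longrightarrow> \<sigma> \<le> R \<longrightarrow> norm x \<le> \<sigma> \<longrightarrow> norm y \<le> \<sigma> \<longrightarrow>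
      norm (D u x - D u y) \<le> C * \<sigma> powr (p - 2) * norm (x - y)" for u
  proof -
    have "smooth_on UNIV (D u)" "vanishes_to_order (D u) (p - 1)"
      unfolding D_def using smooth_on_directional_derivative[OF smooth]
        vanishes_to_order_directional_derivative[OF smooth van] by auto
    from vanishes_to_order_lipschitz[OF this R] show ?thesis 
      by (smt (verit, ccfv_SIG) diff_diff_eq)
  qed
  then obtain c where c: "\<And>u. 0 \<le> c u" "\<And>u \<sigma> x y. 0 < \<sigma> \<Longrightarrow> \<sigma> \<le> R \<Longrightarrow> norm x \<le> \<sigma> \<Longrightarrow>
      norm y \<le> \<sigma> \<Longrightarrow> norm (D u x - D u y) \<le> c u * \<sigma> powr (p - 2) * norm (x - y)"
    by metis
  define C where "C = sum c (Basis :: 'a set)"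
  have cC: "c u \<le> C" if "u \<in> Basis" for u :: 'a
    unfolding C_def using that c(1) by (intro member_le_sum) auto
  show thesis
  proof (rule that[of "DIM('a) * C"])
    show "0 \<le> DIM('a) * C" using c(1) by (simp add: C_def sum_nonneg)
    fix \<sigma> :: real and x a b :: 'a
    assume \<sigma>: "0 < \<sigma>" "\<sigma> \<le> R" and x: "norm x \<le> \<sigma>" "norm (x + a) \<le> \<sigma>" "norm (x + b) \<le> \<sigma>"
      "norm (x + a + b) \<le> \<sigma>"
    define H where "H y = G (y + a) - G y" for y
    define S where "S = cball 0 \<sigma> \<inter> (\<lambda>y. - a + y) ` cball 0 \<sigma>"
    have S: "y \<in> S \<longleftrightarrow> norm y \<le> \<sigma> \<and> norm (y + a) \<le> \<sigma>" for y
    proof -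
      have "y \<in> (\<lambda>y. - a + y) ` cball 0 \<sigma> \<longleftrightarrow> norm (y + a) \<le> \<sigma>"
        by (auto simp: image_iff intro!: bexI[of _ "y + a"])
      then show ?thesis by (auto simp: S_def)
    qed
    have dH: "(H has_derivative (\<lambda>u. D u (y + a) - D u y)) (at y)" for y
    proof -
      have "((\<lambda>y. G (y + a)) has_derivative (\<lambda>u. D u (y + a))) (at y)"
        by (rule has_derivative_compose[OF _ dG, of "\<lambda>y. y + a" "\<lambda>u. u"])
          (auto intro!: derivative_eq_intros)
      then show ?thesis unfolding H_def by (intro has_derivative_diff dG)
    qed
    then have fH: "frechet_derivative H (at y) = (\<lambda>u. D u (y + a) - D u y)" for y
      by (rule frechet_derivative_at[symmetric])
    have "norm (H (x + b) - H x) \<le> DIM('a) * (C * \<sigma> powr (p - 2) * norm a) * norm (x + b - x)"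
    proof (rule directional_derivatives_bound_imp_lipschitz[where S = S and G = H and x = "x + b" and y = x])
      show "convex S" unfolding S_def by (intro convex_Int convex_translation) auto
      fix z u :: 'a assume z: "z \<in> S" and u: "u \<in> Basis"
      have "norm (D u (z + a) - D u z) \<le> c u * \<sigma> powr (p - 2) * norm (z + a - z)"
        using z \<sigma> by (intro c(2)) (auto simp: S)
      also have "\<dots> \<le> C * \<sigma> powr (p - 2) * norm a"
        using cC[OF u] by (simp add: mult_right_mono)
      finally show "norm (frechet_derivative H (at z) u) \<le> C * \<sigma> powr (p - 2) * norm a"
        unfolding fH .
    qed (use dH x in \<open>auto simp: S add_ac intro: differentiableI\<close>)
    moreover have "H (x + b) - H x = G (x + a + b) - G (x + a) - G (x + b) + G x"
      unfolding H_def by (simp add: add.assoc add.commute[of a b])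
    ultimately show "norm (G (x + a + b) - G (x + a) - G (x + b) + G x)
        \<le> DIM('a) * C * \<sigma> powr (p - 2) * norm a * norm b"
      by (simp only: mult.assoc add_diff_cancel_left')
  qed
qed

text \<open>The four points need not be the vertices of a parallelogram: the defect u3 - u1 - u2 + u is charged to
  the Lipschitz bound. This is the form in which the estimate is applied to four solutions. The factor 3
  keeps the missing vertex u1 + u2 - u inside the ball of radius \<sigma>.\<close>
lemma vanishes_to_order_four_points:
  fixes G :: "'a::euclidean_space \<Rightarrow> 'b::banach"
  assumes smooth: "smooth_on UNIV G" and van: "vanishes_to_order G p" and R: "0 < R"
  obtains C where "0 \<le> C" "\<And>\<sigma> u u1 u2 u3. 0 < \<sigma> \<Longrightarrow> \<sigma> \<le> R \<Longrightarrow>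
     3 * norm u \<le> \<sigma> \<Longrightarrow> 3 * norm u1 \<le> \<sigma> \<Longrightarrow> 3 * norm u2 \<le> \<sigma> \<Longrightarrow> 3 * norm u3 \<le> \<sigma> \<Longrightarrow>
     norm (G u3 - G u1 - G u2 + G u) \<le> C * \<sigma> powr (p - 1) * norm (u3 - u1 - u2 + u)
       + C * \<sigma> powr (p - 2) * norm (u1 - u) * norm (u2 - u)"
proof -
  obtain C1 where C1: "0 \<le> C1" "\<And>\<sigma> x y. 0 < \<sigma> \<Longrightarrow> \<sigma> \<le> R \<Longrightarrow> norm x \<le> \<sigma> \<Longrightarrow> norm y \<le> \<sigma> \<Longrightarrow>
     norm (G x - G y) \<le> C1 * \<sigma> powr (p - 1) * norm (x - y)"
    using vanishes_to_order_lipschitz[OF assms] by blast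
  obtain C2 where C2: "0 \<le> C2" "\<And>\<sigma> x a b. 0 < \<sigma> \<Longrightarrow> \<sigma> \<le> R \<Longrightarrow> norm x \<le> \<sigma> \<Longrightarrow>
     norm (x + a) \<le> \<sigma> \<Longrightarrow> norm (x + b) \<le> \<sigma> \<Longrightarrow> norm (x + a + b) \<le> \<sigma> \<Longrightarrow>
     norm (G (x + a + b) - G (x + a) - G (x + b) + G x) \<le> C2 * \<sigma> powr (p - 2) * norm a * norm b"
    using vanishes_to_order_second_difference[OF assms] by blast
  show thesis
  proof (rule that[of "C1 + C2"])
    show "0 \<le> C1 + C2" using C1(1) C2(1) by simp
    fix \<sigma> :: real and u u1 u2 u3 :: 'a
    assume \<sigma>: "0 < \<sigma>" "\<sigma> \<le> R" and u: "3 * norm u \<le> \<sigma>" "3 * norm u1 \<le> \<sigma>"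
      "3 * norm u2 \<le> \<sigma>" "3 * norm u3 \<le> \<sigma>"
    define v where "v = u1 + u2 - u"
    have small: "norm u \<le> \<sigma>" "norm u1 \<le> \<sigma>" "norm u2 \<le> \<sigma>" "norm u3 \<le> \<sigma>"
      using u \<sigma> by linarith+
    have nv: "norm v \<le> \<sigma>" unfolding v_def
      using norm_triangle_ineq4[of "u1 + u2" u] norm_triangle_ineq[of u1 u2] u by linarith
    have par: "u + (u1 - u) = u1" "u + (u2 - u) = u2" "u + (u1 - u) + (u2 - u) = v"
      "u1 + (u2 - u) = v" by (simp_all add: v_def)
    have 1: "norm (G u3 - G v) \<le> C1 * \<sigma> powr (p - 1) * norm (u3 - v)"
      using C1(2)[OF \<sigma> small(4) nv] .
    have 2: "norm (G v - G u1 - G u2 + G u) \<le> C2 * \<sigma> powr (p - 2) * norm (u1 - u) * norm (u2 - u)"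
      using C2(2)[OF \<sigma>, of u "u1 - u" "u2 - u"] small nv unfolding par by blast
    have "G u3 - G u1 - G u2 + G u = (G u3 - G v) + (G v - G u1 - G u2 + G u)" by simp
    then have "norm (G u3 - G u1 - G u2 + G u) \<le> norm (G u3 - G v) + norm (G v - G u1 - G u2 + G u)"
      by (metis norm_triangle_ineq)
    also have "\<dots> \<le> C1 * \<sigma> powr (p - 1) * norm (u3 - v)
        + C2 * \<sigma> powr (p - 2) * norm (u1 - u) * norm (u2 - u)"
      using 1 2 by (rule add_mono)
    also have "u3 - v = u3 - u1 - u2 + u" by (simp add: v_def)
    also have "C1 * \<sigma> powr (p - 1) * norm (u3 - u1 - u2 + u)
        + C2 * \<sigma> powr (p - 2) * norm (u1 - u) * norm (u2 - u)
      \<le> (C1 + C2) * \<sigma> powr (p - 1) * norm (u3 - u1 - u2 + u)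
        + (C1 + C2) * \<sigma> powr (p - 2) * norm (u1 - u) * norm (u2 - u)"
      using C1(1) C2(1) by (intro add_mono mult_right_mono) auto
    finally show "norm (G u3 - G u1 - G u2 + G u)
      \<le> (C1 + C2) * \<sigma> powr (p - 1) * norm (u3 - u1 - u2 + u)
        + (C1 + C2) * \<sigma> powr (p - 2) * norm (u1 - u) * norm (u2 - u)" .
  qed
qed

text \<open>Only points close to 0 are covered by the assumption; elsewhere the function is bounded on bounded sets
  and \<sigma> is bounded below.\<close>
lemma bigo_powr_imp_vanishes_to_order:
  fixes G :: "'a::euclidean_space \<Rightarrow> 'b::real_normed_vector"
  assumes cont: "continuous_on UNIV G" and G0: "G 0 = 0"
    and order: "(\<lambda>x. norm (G x)) \<in> O[at 0](\<lambda>x. norm x powr p)" and p: "0 \<le> p"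
  shows "vanishes_to_order G p"
  unfolding vanishes_to_order_def
proof (intro allI impI)
  fix R :: real assume R: "0 < R"
  obtain c where c: "c > 0" "eventually (\<lambda>x. norm (norm (G x)) \<le> c * norm (norm x powr p)) (at 0)"
    using order by (auto elim: landau_o.bigE)
  then obtain d where d: "d > 0" "\<And>x. x \<noteq> 0 \<Longrightarrow> norm x < d \<Longrightarrow> norm (G x) \<le> c * norm x powr p"
    unfolding eventually_at by auto
  have "bounded (G ` cball 0 R)"
    by (intro compact_imp_bounded compact_continuous_image compact_cball
        continuous_on_subset[OF cont]) simp
  then obtain M where M: "0 < M" "\<And>x. norm x \<le> R \<Longrightarrow> norm (G x) \<le> M"
    unfolding bounded_pos by auto
  show "\<exists>C\<ge>0. \<forall>\<sigma>>0. \<sigma> \<le> R \<longrightarrow> (\<forall>x. norm x \<le> \<sigma> \<longrightarrow> norm (G x) \<le> C * \<sigma> powr p)"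
  proof (intro exI[of _ "c + M / d powr p"] conjI allI impI)
    show "0 \<le> c + M / d powr p" using c M by simp
    fix \<sigma> x assume \<sigma>: "0 < \<sigma>" "\<sigma> \<le> R" and x: "norm (x::'a) \<le> \<sigma>"
    have "norm (G x) \<le> c * \<sigma> powr p + M / d powr p * \<sigma> powr p"
    proof (cases "norm x < d")
      case True
      have "norm (G x) \<le> c * \<sigma> powr p"
      proof (cases "x = 0")
        case False
        then have "norm (G x) \<le> c * norm x powr p" using d True by auto
        also have "\<dots> \<le> c * \<sigma> powr p" using c x p by (intro mult_left_mono powr_mono2) auto
        finally show ?thesis .
      qed (use G0 c in auto)
      moreover have "0 \<le> M / d powr p * \<sigma> powr p" using M by simp
      ultimately show ?thesis by linarith
    next
      case False
      have "norm (G x) \<le> M" using M x \<sigma> by auto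
      also have "\<dots> = M / d powr p * d powr p" using d by simp
      also have "\<dots> \<le> M / d powr p * \<sigma> powr p"
        using False x d p M by (intro mult_left_mono powr_mono2) auto
      moreover have "0 \<le> c * \<sigma> powr p" using c by simp
      ultimately show ?thesis by linarith
    qed
    then show "norm (G x) \<le> (c + M / d powr p) * \<sigma> powr p" by (simp add: algebra_simps)
  qed
qed

section \<open>A quadratic form adapted to a stable matrix\<close>

definition shifted_mult :: "complex^'n^'n \<Rightarrow> complex \<Rightarrow> complex^'n \<Rightarrow> complex^'n" where
  "shifted_mult M z v = M *v v - z *s v"

lemma matrix_vector_mult_vector_smult:
  fixes M :: "'a::comm_semiring_1^'n^'m"
  shows "M *v (c *s v) = c *s (M *v v)"
  by (simp add: vec_eq_iff matrix_vector_mult_def sum_distrib_left mult_ac)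

lemma shifted_mult_commute:
  "shifted_mult M y (shifted_mult M z v) = shifted_mult M z (shifted_mult M y v)"
  by (simp add: shifted_mult_def matrix_vector_mult_diff_distrib matrix_vector_mult_vector_smult
      vector_ssub_ldistrib vector_smult_assoc mult.commute)

lemma matrix_mult_shifted_mult:
  "M *v shifted_mult M z v = shifted_mult M z (M *v v)"
  by (simp add: shifted_mult_def matrix_vector_mult_diff_distrib matrix_vector_mult_vector_smult)

lemma linear_shifted_mult: "linear (shifted_mult M z)"
  by (rule linearI) (simp_all add: shifted_mult_def vec_eq_iff matrix_vector_mult_def
      sum.distrib scaleR_sum_right algebra_simps)

lemma fold_shifted_mult_commute:
  "fold (shifted_mult M) zs (shifted_mult M z v) = shifted_mult M z (fold (shifted_mult M) zs v)"
  by (induction zs arbitrary: v) (simp_all add: shifted_mult_commute[of M _ z])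

text \<open>Horner evaluation of a polynomial at the matrix M; only its action on vectors matters here.\<close>
definition poly_apply :: "complex^'n^'n \<Rightarrow> complex poly \<Rightarrow> complex^'n \<Rightarrow> complex^'n" where
  "poly_apply M p v = fold_coeffs (\<lambda>a u. a *s v + M *v u) p 0"

lemma poly_apply_0: "poly_apply M 0 v = 0"
  by (simp add: poly_apply_def)

lemma poly_apply_pCons: "poly_apply M (pCons a p) v = a *s v + M *v poly_apply M p v"
  by (cases "p = 0 \<and> a = 0") (auto simp: poly_apply_def)

lemma poly_apply_add: "poly_apply M (p + q) v = poly_apply M p v + poly_apply M q v"
  by (induction p q rule: poly_induct2)
    (simp_all add: poly_apply_0 poly_apply_pCons matrix_vector_right_distrib vector_sadd_rdistrib)

lemma poly_apply_smult: "poly_apply M (smult c p) v = c *s poly_apply M p v"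
  by (induction p) (simp_all add: poly_apply_0 poly_apply_pCons vector_add_ldistrib
      matrix_vector_mult_vector_smult vector_smult_assoc)

lemma poly_apply_linear_factor:
  "poly_apply M ([:- z, 1:] * p) v = shifted_mult M z (poly_apply M p v)"
proof -
  have "[:- z, 1:] * p = smult (- z) p + pCons 0 p" by simp
  then show ?thesis
    by (simp only: poly_apply_add poly_apply_smult poly_apply_pCons)
      (simp add: shifted_mult_def vector_smult_lneg)
qed

lemma poly_apply_prod_list:
  "poly_apply M (\<Prod>z\<leftarrow>zs. [:- z, 1:]) v = fold (shifted_mult M) zs v"
proof (induction zs arbitrary: v)
  case Nil
  show ?case using poly_apply_pCons[of M 1 0 v] by (simp add: poly_apply_0 one_pCons)
next
  case (Cons z zs)
  have "poly_apply M (\<Prod>z\<leftarrow>z # zs. [:- z, 1:]) v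
      = shifted_mult M z (poly_apply M (\<Prod>z\<leftarrow>zs. [:- z, 1:]) v)"
    unfolding list.map prod_list.Cons by (rule poly_apply_linear_factor)
  then show ?case by (simp only: Cons fold_shifted_mult_commute[symmetric] fold.simps o_apply)
qed

lemma poly_apply_monom: "poly_apply M (monom c k) v = c *s (((*v) M ^^ k) v)"
  by (induction k) (simp_all add: monom_0 monom_Suc poly_apply_pCons poly_apply_0
      matrix_vector_mult_vector_smult)

lemma poly_apply_sum: "poly_apply M (\<Sum>k\<in>K. p k) v = (\<Sum>k\<in>K. poly_apply M (p k) v)"
  by (induction K rule: infinite_finite_induct) (simp_all add: poly_apply_0 poly_apply_add)

lemma scaleR_matrix_vector_mult:
  fixes M :: "complex^'n^'m"
  shows "(c *\<^sub>R M) *v v = c *\<^sub>R (M *v v)"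
  by (simp add: vec_eq_iff matrix_vector_mult_def scaleR_sum_right)

text \<open>The matrices form a finite dimensional space, so finitely many powers of M are linearly dependent. Two
  powers may also coincide, in which case their difference is the annihilating polynomial.\<close>
lemma annihilating_poly_exists:
  fixes M :: "complex^'n^'n"
  shows "\<exists>p. p \<noteq> 0 \<and> (\<forall>v. poly_apply M p v = 0)"
proof -
  define P where "P k = ((**) M ^^ k) (mat 1)" for k
  have P: "P k *v v = ((*v) M ^^ k) v" for k v
    by (induction k) (simp_all add: P_def flip: matrix_vector_mul_assoc)
  define N where "N = DIM(complex^'n^'n)"
  show ?thesis
  proof (cases "inj_on P {..N}")
    case False
    then obtain i j where ij: "i \<noteq> j" "P i = P j" by (auto simp: inj_on_def)
    define p where "p = monom 1 i + monom (- 1 :: complex) j"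
    have "coeff p i = 1" using ij by (simp add: p_def)
    then have "p \<noteq> 0" by auto
    moreover have "poly_apply M p v = 0" for v
      by (simp add: p_def poly_apply_add poly_apply_monom ij(2) vector_smult_lneg flip: P)
    ultimately show ?thesis by blast
  next
    case True
    have "dependent (P ` {..N})"
    proof (rule dependent_biggerset)
      show "card (P ` {..N}) > DIM(complex^'n^'n)" unfolding card_image[OF True] by (simp add: N_def)
    qed
    then obtain u k0 where u: "k0 \<le> N" "u (P k0) \<noteq> 0" "(\<Sum>X\<in>P ` {..N}. u X *\<^sub>R X) = 0"
      by (auto simp: dependent_finite)
    define p where "p = (\<Sum>k\<le>N. monom (complex_of_real (u (P k))) k)"
    have "coeff p k0 = of_real (u (P k0))" using u(1) by (simp add: p_def coeff_sum)
    then have "p \<noteq> 0" using u(2) by auto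
    moreover have "poly_apply M p v = 0" for v
    proof -
      have lin: "linear (\<lambda>X. X *v v)" for v :: "complex^'n"
        by (rule linearI) (simp_all add: matrix_vector_mult_add_rdistrib scaleR_matrix_vector_mult)
      have "poly_apply M p v = (\<Sum>k\<le>N. complex_of_real (u (P k)) *s (P k *v v))"
        by (simp add: p_def poly_apply_sum poly_apply_monom P)
      also have "\<dots> = (\<Sum>k\<le>N. (u (P k) *\<^sub>R P k) *v v)"
        by (intro sum.cong refl, subst scaleR_matrix_vector_mult)
          (simp add: vec_eq_iff scaleR_conv_of_real[where 'a = complex])
      also have "\<dots> = (\<Sum>k\<le>N. u (P k) *\<^sub>R P k) *v v" by (simp add: linear_sum[OF lin])
      also have "(\<Sum>k\<le>N. u (P k) *\<^sub>R P k) = 0" using u(3) by (simp add: sum.reindex[OF True])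
      finally show ?thesis by simp
    qed
    ultimately show ?thesis by blast
  qed
qed

text \<open>Factor an annihilating polynomial over the complex numbers. A factor whose root is not an eigenvalue is
  an injective operator and can be dropped.\<close>
lemma eigenvalue_product_annihilates:
  fixes M :: "complex^'n^'n"
  obtains zs where "\<And>z. z \<in> set zs \<Longrightarrow> \<exists>v. v \<noteq> 0 \<and> M *v v = z *s v"
    "\<And>v. fold (shifted_mult M) zs v = 0"
proof -
  obtain p where p: "p \<noteq> 0" "\<And>v. poly_apply M p v = 0"
    using annihilating_poly_exists by blast
  obtain Z where Z: "p = smult (lead_coeff p) (\<Prod>z\<in>#Z. [:- z, 1:])"
    using alg_closed_imp_factorization[OF p(1)] by blast
  obtain zs where zs: "mset zs = Z" using ex_mset by blast
  have "fold (shifted_mult M) zs v = 0" for v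
  proof -
    have "(\<Prod>z\<in>#Z. [:- z, 1:]) = (\<Prod>z\<leftarrow>zs. [:- z, 1:])"
      unfolding zs[symmetric] mset_map[symmetric] prod_mset_prod_list ..
    then have "poly_apply M p v = lead_coeff p *s fold (shifted_mult M) zs v"
      by (subst Z) (simp only: poly_apply_smult poly_apply_prod_list)
    then have "lead_coeff p *s fold (shifted_mult M) zs v = 0" using p(2) by simp
    then show ?thesis using p(1) by simp
  qed
  moreover define E where "E z \<longleftrightarrow> (\<exists>v. v \<noteq> 0 \<and> M *v v = z *s v)" for z
  have "fold (shifted_mult M) ys v = 0 \<Longrightarrow> fold (shifted_mult M) (filter E ys) v = 0" for ys v
  proof (induction ys arbitrary: v)
    case (Cons y ys)
    show ?case
    proof (cases "E y")
      case True then show ?thesis using Cons by simp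
    next
      case False
      have "shifted_mult M y (fold (shifted_mult M) ys v) = 0"
        using Cons.prems by (simp add: fold_shifted_mult_commute)
      then have "fold (shifted_mult M) ys v = 0"
        using False by (auto simp: E_def shifted_mult_def)
      then show ?thesis using False Cons.IH by simp
    qed
  qed simp
  ultimately show thesis using that[of "filter E zs"] by (auto simp: E_def)
qed

lemma inner_vector_smult:
  fixes v :: "complex^'n"
  shows "inner v (z *s v) = Re z * inner v v"
  by (simp add: inner_vec_def inner_complex_def sum_distrib_left algebra_simps)

lemma bilinear_intro:
  assumes "\<And>x. linear (S x)" "\<And>y. linear (\<lambda>x. S x y)"
  shows "bilinear S"
  using assms by (simp add: bilinear_def)

text \<open>Induction over the factors of the annihilating product. With y = (M - z) v one has M v = z v + y, and y is
  annihilated by the remaining factors, so that the form S of the induction hypothesis decays along y. A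
  sufficiently large multiple of S(y, y) absorbs the mixed term in the derivative of |v|^2. Each step costs a
  part of the rate, which is why \<beta> is generalized.\<close>
lemma lyapunov_form_of_annihilator:
  fixes M :: "complex^'n^'n"
  assumes "\<And>z. z \<in> set zs \<Longrightarrow> Re z \<le> - \<alpha>" and "\<beta> < \<alpha>"
  shows "\<exists>S. bilinear S \<and> (\<forall>v w. S v w = S w v) \<and> (\<forall>v. inner v v \<le> S v v) \<and>
     (\<forall>v. fold (shifted_mult M) zs v = 0 \<longrightarrow> S v (M *v v) \<le> - \<beta> * S v v)"
  using assms
proof (induction zs arbitrary: \<beta>)
  case Nil
  have "bilinear (inner :: complex^'n \<Rightarrow> _)"
    using bilinear_conv_bounded_bilinear bounded_bilinear_inner by blast
  then show ?case by (intro exI[of _ inner]) (auto simp: inner_commute)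
next
  case (Cons z zs)
  define \<beta>' where "\<beta>' = (\<alpha> + \<beta>) / 2"
  define \<eta> where "\<eta> = \<alpha> - \<beta>"
  have pos: "0 < \<eta>" "\<beta>' < \<alpha>" "0 < \<beta>' - \<beta>" using Cons.prems by (auto simp: \<beta>'_def \<eta>_def)
  obtain S where S: "bilinear S" "\<And>v w. S v w = S w v" "\<And>v. inner v v \<le> S v v"
    "\<And>v. fold (shifted_mult M) zs v = 0 \<Longrightarrow> S v (M *v v) \<le> - \<beta>' * S v v"
    using Cons.IH[OF _ pos(2)] Cons.prems(1) by auto
  \<comment> \<open>The surplus K (\<beta>' - \<beta>) of the decay along y has to pay for the constant 1 / (4 \<eta>) in
      Young's inequality for the mixed term inner v y.\<close>
  define K where "K = 1 / (4 * \<eta> * (\<beta>' - \<beta>))"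
  have K: "0 < K" "K * (\<beta>' - \<beta>) = 1 / (4 * \<eta>)" using pos by (auto simp: K_def)
  let ?T = "shifted_mult M z"
  define S' where "S' v w = inner v w + K * S (?T v) (?T w)" for v w
  have linS: "linear (S v)" "linear (\<lambda>v. S v w)" for v w using S(1) by (auto simp: bilinear_def)
  have "bilinear S'"
  proof (rule bilinear_intro)
    have l: "linear (\<lambda>w. S (?T v) (?T w))" "linear (\<lambda>v. S (?T v) (?T w))" for v w
      using linear_compose[OF linear_shifted_mult linS(1)]
        linear_compose[OF linear_shifted_mult linS(2)] by (auto simp: o_def)
    show "linear (S' v)" "linear (\<lambda>v. S' v w)" for v w
      unfolding S'_def
      by (auto intro!: linearI simp: inner_add_right inner_add_left linear_add[OF l(1)]
          linear_add[OF l(2)] linear_scale[OF l(1)] linear_scale[OF l(2)] algebra_simps)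
  qed
  moreover have "S' v w = S' w v" for v w by (simp add: S'_def inner_commute S(2))
  moreover have S0: "0 \<le> S v v" for v using S(3)[of v] inner_ge_zero[of v] by linarith
  then have "inner v v \<le> S' v v" for v using K(1) by (simp add: S'_def)
  moreover have "S' v (M *v v) \<le> - \<beta> * S' v v" if "fold (shifted_mult M) (z # zs) v = 0" for v
  proof -
    let ?y = "?T v"
    have "M *v v = z *s v + ?y" by (simp add: shifted_mult_def)
    then have "inner v (M *v v) = Re z * inner v v + inner v ?y"
      by (simp add: inner_add_right inner_vector_smult)
    moreover have "Re z * inner v v \<le> - \<alpha> * inner v v"
      using Cons.prems(1)[of z] by (intro mult_right_mono) auto
    moreover have "inner v ?y \<le> \<eta> * inner v v + 1 / (4 * \<eta>) * inner ?y ?y"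
    proof -
      define c where "c = 2 * \<eta>"
      have "0 \<le> inner (c *\<^sub>R v - ?y) (c *\<^sub>R v - ?y)" by simp
      also have "\<dots> = c * c * inner v v - 2 * c * inner v ?y + inner ?y ?y"
        by (simp add: inner_diff_left inner_diff_right inner_commute[of ?y v] algebra_simps)
      finally have "4 * \<eta> * inner v ?y \<le> 4 * \<eta> * (\<eta> * inner v v + 1 / (4 * \<eta>) * inner ?y ?y)"
        using pos(1) by (simp add: c_def distrib_left mult.assoc)
      then show ?thesis using pos(1) by simp
    qed
    moreover have "1 / (4 * \<eta>) * inner ?y ?y \<le> 1 / (4 * \<eta>) * S ?y ?y"
      using pos(1) S(3) by (intro mult_left_mono) auto
    moreover have "K * S ?y (?T (M *v v)) \<le> K * (- \<beta>' * S ?y ?y)"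
      using S(4)[of ?y] that K(1) by (intro mult_left_mono) (simp_all flip: matrix_mult_shifted_mult)
    moreover have "K * (- \<beta>' * S ?y ?y) = - \<beta> * (K * S ?y ?y) - 1 / (4 * \<eta>) * S ?y ?y"
      unfolding K(2)[symmetric] by (simp add: algebra_simps)
    moreover have "- \<alpha> * inner v v + \<eta> * inner v v = - \<beta> * inner v v"
      by (simp add: \<eta>_def algebra_simps)
    moreover have "- \<beta> * S' v v = - \<beta> * inner v v - \<beta> * (K * S ?y ?y)"
      by (simp add: S'_def algebra_simps)
    ultimately show ?thesis unfolding S'_def[of v "M *v v"] by linarith
  qed
  ultimately show ?case by blast
qed

text \<open>This replaces the exponential bound for the matrix exponential: along x' = A x the form decays at the
  rate 2 \<beta>, and it dominates the norm.\<close>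
lemma lyapunov_form_exists:
  fixes A :: "real^'n^'n"
  assumes ev: "\<And>z. eigenvalue_of A z \<Longrightarrow> Re z \<le> - \<alpha>" and "\<beta> < \<alpha>"
  obtains B :: "real^'n \<Rightarrow> real^'n \<Rightarrow> real" where "bounded_bilinear B" "\<And>x y. B x y = B y x"
    "\<And>x. (norm x)\<^sup>2 \<le> B x x" "\<And>x. B x (A *v x) \<le> - \<beta> * B x x"
proof -
  define M where "M = map_matrix complex_of_real A"
  define cx :: "real^'n \<Rightarrow> complex^'n" where "cx x = (\<chi> i. complex_of_real (x $ i))" for x
  have lin: "linear cx" by (rule linearI) (simp_all add: cx_def vec_eq_iff scaleR_conv_of_real[where 'a = complex])
  have Mcx: "M *v cx x = cx (A *v x)" for x
    by (simp add: vec_eq_iff M_def cx_def matrix_vector_mult_def map_matrix_def)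
  have inner_cx: "inner (cx x) (cx y) = inner x y" for x y
    by (simp add: inner_vec_def cx_def inner_complex_def)
  obtain zs where zs: "\<And>z. z \<in> set zs \<Longrightarrow> \<exists>v. v \<noteq> 0 \<and> M *v v = z *s v"
    "\<And>v. fold (shifted_mult M) zs v = 0" using eigenvalue_product_annihilates by blast
  have "Re z \<le> - \<alpha>" if "z \<in> set zs" for z
    using zs(1)[OF that] ev by (auto simp: eigenvalue_of_def M_def)
  from lyapunov_form_of_annihilator[of zs \<alpha> \<beta> M, OF this assms(2)] zs(2)
  obtain S where S: "bilinear S" "\<And>v w. S v w = S w v" "\<And>v. inner v v \<le> S v v"
     "\<And>v. S v (M *v v) \<le> - \<beta> * S v v" by blast
  define B where "B x y = S (cx x) (cx y)" for x y
  show thesis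
  proof (rule that[of B])
    have "linear (S v)" "linear (\<lambda>v. S v w)" for v w using S(1) by (auto simp: bilinear_def)
    then have "linear (B x)" "linear (\<lambda>x. B x y)" for x y
      unfolding B_def using linear_compose[OF lin, of "S (cx x)"]
        linear_compose[OF lin, of "\<lambda>v. S v (cx y)"] by (simp_all add: o_def)
    then show "bounded_bilinear B"
      by (simp add: bilinear_intro flip: bilinear_conv_bounded_bilinear)
    show "B x y = B y x" for x y by (simp add: B_def S(2))
    show "(norm x)\<^sup>2 \<le> B x x" for x
      using S(3)[of "cx x"] by (simp add: B_def inner_cx power2_norm_eq_inner)
    show "B x (A *v x) \<le> - \<beta> * B x x" for x using S(4)[of "cx x"] by (simp add: B_def Mcx)
  qed
qed

section \<open>Existence and uniqueness of solutions\<close>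

text \<open>Gronwall: E exp(-K) is nonincreasing.\<close>
lemma exponential_growth_bound:
  fixes E :: "real \<Rightarrow> real"
  assumes E: "\<And>s. s \<in> {a..b} \<Longrightarrow> (E has_real_derivative E' s) (at s within {a..b})"
    and K: "\<And>s. s \<in> {a..b} \<Longrightarrow> (K has_real_derivative k s) (at s within {a..b})"
    and le: "\<And>s. s \<in> {a..b} \<Longrightarrow> E' s \<le> k s * E s"
    and t: "t \<in> {a..b}"
  shows "E t \<le> E a * exp (K t - K a)"
proof -
  define G where "G s = E s * exp (- K s)" for s
  have dG: "(G has_real_derivative (E' s - k s * E s) * exp (- K s)) (at s within {a..b})"
    if "s \<in> {a..b}" for s
  proof -
    have "((\<lambda>s. exp (- K s)) has_real_derivative exp (- K s) * - k s) (at s within {a..b})"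
      by (intro derivative_intros K[OF that])
    from DERIV_mult'[OF E[OF that] this] show ?thesis
      unfolding G_def by (rule DERIV_cong) (simp add: algebra_simps)
  qed
  have "G t \<le> G a"
  proof (rule DERIV_nonpos_imp_decreasing_open[where f = G and a = a and b = t])
    show "a \<le> t" using t by simp
    show "continuous_on {a..t} G"
      by (rule continuous_on_subset[OF DERIV_continuous_on[OF dG]]) (use t in auto)
    fix s assume s: "a < s" "s < t"
    then have sab: "s \<in> {a..b}" and at: "at s within {a..b} = at s"
      using t by (auto intro: at_within_Icc_at)
    have "(E' s - k s * E s) * exp (- K s) \<le> 0"
      using le[OF sab] by (intro mult_nonpos_nonneg) auto
    then show "\<exists>y. (G has_real_derivative y) (at s) \<and> y \<le> 0"
      using dG[OF sab] unfolding at by blast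
  qed
  then have "E t * exp (- K t) * exp (K t) \<le> E a * exp (- K a) * exp (K t)"
    unfolding G_def by (intro mult_right_mono) auto
  then show ?thesis by (simp add: mult.assoc exp_diff exp_minus field_simps)
qed

lemma quadratic_form_derivative:
  assumes B: "bounded_bilinear (B :: 'a::real_normed_vector \<Rightarrow> 'a \<Rightarrow> real)" and sym: "\<And>x y. B x y = B y x"
    and z: "(z has_vector_derivative z') (at t within S)"
  shows "((\<lambda>t. B (z t) (z t)) has_real_derivative 2 * B (z t) z') (at t within S)"
  using bounded_bilinear.has_vector_derivative[OF B z z]
  by (simp add: has_real_derivative_iff_has_vector_derivative sym[of z'])

lemma at_within_atLeast:
  fixes a b t :: real
  assumes "a \<le> t" "t < b"
  shows "at t within {a..} = at t within {a..b}"
  by (rule at_within_nhd[of t "{..<b}"]) (use assms in auto)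

lemma indefinite_integral_derivative_atLeast:
  fixes k :: "real \<Rightarrow> 'a::banach"
  assumes "continuous_on UNIV k" "0 \<le> t"
  shows "((\<lambda>t. integral {0..t} k) has_vector_derivative k t) (at t within {0..})"
  using integral_has_vector_derivative[of 0 "t + 1" k t] assms
  by (simp add: at_within_atLeast[of 0 t "t + 1"] continuous_on_subset)

text \<open>Picard iteration on the whole half line at once. The unknown is w(t) = exp(-2 L t) u(t); the exponential
  weight makes the integral operator a contraction with factor 1/2 on bounded continuous functions. The
  boundedness of g makes the operator map this space to itself. The functions live on the whole real
  line, with negative times replaced by 0.\<close>
lemma global_solution_exists:
  fixes g :: "'a::euclidean_space \<Rightarrow> 'a"
  assumes L: "0 < L" and lip: "\<And>x y. norm (g x - g y) \<le> L * norm (x - y)"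
    and bd: "\<And>x. norm (g x) \<le> M"
  obtains u where "u 0 = y" "\<And>t. 0 \<le> t \<Longrightarrow> (u has_vector_derivative g (u t)) (at t within {0..})"
proof -
  define E where "E s = exp (2 * L * s)" for s :: real
  define k where "k w s = g (E s *\<^sub>R apply_bcontfun w s)" for w :: "real \<Rightarrow>\<^sub>C 'a" and s
  define I where "I w t = integral {0..t} (k w)" for w t
  define F where "F w t = exp (- (2 * L * max 0 t)) *\<^sub>R (y + I w (max 0 t))" for w t
  have M0: "0 \<le> M" using bd[of 0] norm_ge_zero order_trans by blast
  have contg: "continuous_on UNIV g"
  proof (rule lipschitz_on_continuous_on)
    show "L-lipschitz_on UNIV g"
      using L lip by (intro lipschitz_onI) (auto simp: dist_norm)
  qed
  have contk: "continuous_on T (k w)" for w T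
    unfolding k_def E_def
    by (intro continuous_on_compose2[OF contg] continuous_intros) auto
  have dI: "(I w has_vector_derivative k w t) (at t within {0..})" if "0 \<le> t" for w t
    unfolding I_def using contk that by (rule indefinite_integral_derivative_atLeast)
  have contI: "continuous_on {0..} (I w)" for w
    using dI by (intro continuous_on_vector_derivative) auto
  have normI: "norm (I w t) \<le> M * t" if "0 \<le> t" for w t
    using integral_bound[of 0 t "k w" M] that contk bd unfolding I_def k_def by simp
  have F: "F w \<in> bcontfun" for w
  proof (rule bcontfun_normI)
    show "continuous_on UNIV (F w)"
      unfolding F_def by (intro continuous_intros continuous_on_compose2[OF contI]) auto
    fix t :: real
    let ?s = "max 0 t"
    have s0: "0 \<le> 2 * L * ?s" using L by simp
    have "exp (- (2 * L * ?s)) * norm (I w ?s) \<le> exp (- (2 * L * ?s)) * (M * ?s)"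
      by (intro mult_left_mono normI) auto
    also have "\<dots> \<le> exp (- (2 * L * ?s)) * (M / (2 * L) * exp (2 * L * ?s))"
    proof (intro mult_left_mono)
      have "2 * L * ?s \<le> exp (2 * L * ?s)" using exp_ge_add_one_self[of "2 * L * ?s"] by linarith
      then have "M * (2 * L * ?s) \<le> M * exp (2 * L * ?s)" using M0 by (rule mult_left_mono)
      then show "M * ?s \<le> M / (2 * L) * exp (2 * L * ?s)" using L by (simp add: field_simps)
    qed simp
    also have "\<dots> = M / (2 * L)" by (simp add: exp_minus field_simps)
    finally have 1: "exp (- (2 * L * ?s)) * norm (I w ?s) \<le> M / (2 * L)" .
    have "norm (F w t) \<le> exp (- (2 * L * ?s)) * norm y + exp (- (2 * L * ?s)) * norm (I w ?s)"
      unfolding F_def norm_scaleR abs_exp_cancel distrib_left[symmetric]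
      by (intro mult_left_mono norm_triangle_ineq) auto
    also have "\<dots> \<le> 1 * norm y + M / (2 * L)"
      using s0 1 by (intro add_mono mult_right_mono) auto
    finally show "norm (F w t) \<le> norm y + M / (2 * L)" by simp
  qed
  define Q where "Q w = Bcontfun (F w)" for w
  have Q: "apply_bcontfun (Q w) = F w" for w unfolding Q_def using F by (rule Bcontfun_inverse)
  have "\<exists>!w. Q w = w"
  proof (rule banach_fix_type[of "1 / 2"])
    show "\<forall>w w'. dist (Q w) (Q w') \<le> 1 / 2 * dist w w'"
    proof (intro allI)
      fix w w' :: "real \<Rightarrow>\<^sub>C 'a"
      define D where "D = dist w w'"
      have I: "norm (I w t - I w' t) \<le> D / 2 * E t" if t: "0 \<le> t" for t
      proof -
        have hi: "((\<lambda>s. L * D * E s) has_integral (D / 2 * E t - D / 2 * E 0)) {0..t}"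
        proof (rule fundamental_theorem_of_calculus[OF t])
          show "((\<lambda>s. D / 2 * E s) has_vector_derivative L * D * E s) (at s within {0..t})" for s
            unfolding E_def has_real_derivative_iff_has_vector_derivative[symmetric]
            by (auto intro!: derivative_eq_intros)
        qed
        have int: "k w integrable_on {0..t}" "k w' integrable_on {0..t}"
          using contk by (auto intro: integrable_continuous_real)
        have "norm (I w t - I w' t) = norm (integral {0..t} (\<lambda>s. k w s - k w' s))"
          unfolding I_def by (simp add: integral_diff[OF int])
        also have "\<dots> \<le> integral {0..t} (\<lambda>s. L * D * E s)"
        proof (rule integral_norm_bound_integral[OF integrable_diff[OF int]])
          show "(\<lambda>s. L * D * E s) integrable_on {0..t}" using hi by blast
          fix s
          have "norm (k w s - k w' s) \<le> L * norm (E s *\<^sub>R (apply_bcontfun w s - apply_bcontfun w' s))"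
            using lip unfolding k_def scaleR_diff_right by blast
          also have "\<dots> = L * (E s * dist (apply_bcontfun w s) (apply_bcontfun w' s))"
            by (simp add: E_def dist_norm)
          also have "\<dots> \<le> L * (E s * D)"
            unfolding D_def using L by (intro mult_left_mono dist_bounded) (auto simp: E_def)
          finally show "norm (k w s - k w' s) \<le> L * D * E s" by (simp add: mult_ac)
        qed
        also have "\<dots> = D / 2 * E t - D / 2 * E 0" using hi by (rule integral_unique)
        also have "\<dots> \<le> D / 2 * E t" by (simp add: E_def D_def)
        finally show ?thesis .
      qed
      show "dist (Q w) (Q w') \<le> 1 / 2 * dist w w'"
      proof (rule dist_bound)
        fix t :: real
        let ?s = "max 0 t"
        have "dist (apply_bcontfun (Q w) t) (apply_bcontfun (Q w') t)
            = exp (- (2 * L * ?s)) * norm (I w ?s - I w' ?s)"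
          unfolding Q F_def dist_norm scaleR_diff_right[symmetric] by simp
        also have "\<dots> \<le> exp (- (2 * L * ?s)) * (D / 2 * E ?s)"
          by (intro mult_left_mono I) auto
        also have "\<dots> = D / 2" by (simp add: E_def exp_minus field_simps)
        finally show "dist (apply_bcontfun (Q w) t) (apply_bcontfun (Q w') t) \<le> 1 / 2 * dist w w'"
          by (simp add: D_def)
      qed
    qed
  qed auto
  then obtain w where w: "Q w = w" by blast
  define u where "u t = y + I w t" for t
  have ku: "k w t = g (u t)" if "0 \<le> t" for t
  proof -
    have "apply_bcontfun w t = F w t" using Q[of w] by (simp add: w)
    then have "E t *\<^sub>R apply_bcontfun w t = u t"
      using that by (simp add: F_def E_def u_def exp_minus)
    then show ?thesis by (simp add: k_def)
  qed
  show thesis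
  proof (rule that[of u])
    show "u 0 = y" by (simp add: u_def I_def)
    show "(u has_vector_derivative g (u t)) (at t within {0..})" if "0 \<le> t" for t
    proof -
      have "(u has_vector_derivative 0 + k w t) (at t within {0..})"
        unfolding u_def by (intro has_vector_derivative_add has_vector_derivative_const dI that)
      then show ?thesis using ku[OF that] by simp
    qed
  qed
qed

definition lipschitz_on_bounded :: "('a::real_normed_vector \<Rightarrow> 'b::real_normed_vector) \<Rightarrow> bool" where
  "lipschitz_on_bounded f \<longleftrightarrow> (\<forall>R. \<exists>L>0. \<forall>x y. norm x \<le> R \<longrightarrow> norm y \<le> R \<longrightarrow>
     norm (f x - f y) \<le> L * norm (x - y))"

lemma smooth_on_imp_lipschitz_on_bounded:
  fixes f :: "'a::euclidean_space \<Rightarrow> 'b::real_normed_vector"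
  assumes smooth: "smooth_on UNIV f"
  shows "lipschitz_on_bounded f"
  unfolding lipschitz_on_bounded_def
proof
  fix R :: real
  have "\<exists>K. \<forall>x. norm x \<le> R \<longrightarrow> norm (frechet_derivative f (at x) u) \<le> K" for u
  proof -
    have "bounded ((\<lambda>x. frechet_derivative f (at x) u) ` cball 0 R)"
      by (intro compact_imp_bounded compact_continuous_image compact_cball continuous_on_subset[OF
            smooth_on_continuous_on[OF smooth_on_directional_derivative[OF smooth]]]) simp
    then obtain K where "\<forall>x\<in>cball 0 R. norm (frechet_derivative f (at x) u) \<le> K"
      unfolding bounded_iff by auto
    then show ?thesis by (intro exI[of _ K]) simp
  qed
  then obtain K where K: "\<And>u x. norm x \<le> R \<Longrightarrow> norm (frechet_derivative f (at x) u) \<le> K u" by metis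
  define C where "C = (\<Sum>u\<in>(Basis::'a set). \<bar>K u\<bar>)"
  have KC: "K u \<le> C" if "u \<in> Basis" for u :: 'a
  proof -
    have "\<bar>K u\<bar> \<le> C" unfolding C_def using that by (intro member_le_sum) auto
    then show ?thesis by linarith
  qed
  have C0: "0 \<le> C" unfolding C_def by (intro sum_nonneg) auto
  have lip: "norm (f x - f y) \<le> (DIM('a) * C + 1) * norm (x - y)" if "norm x \<le> R" "norm y \<le> R" for x y
  proof -
    have "norm (f x - f y) \<le> DIM('a) * C * norm (x - y)"
    proof (rule directional_derivatives_bound_imp_lipschitz[where S = "cball 0 R" and G = f and x = x and y = y])
      fix z u :: 'a assume "z \<in> cball 0 R" "u \<in> Basis"
      then show "norm (frechet_derivative f (at z) u) \<le> C"
        using K[of z u] KC[of u] by simp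
    qed (use that smooth_on_has_derivative[OF smooth] in \<open>auto intro: differentiableI\<close>)
    then show ?thesis using norm_ge_zero[of "x - y"] unfolding distrib_right by linarith
  qed
  moreover have "0 < DIM('a) * C + 1"
    using mult_nonneg_nonneg[of "real DIM('a)" C] C0 by linarith
  ultimately show "\<exists>L>0. \<forall>x y. norm x \<le> R \<longrightarrow> norm y \<le> R \<longrightarrow> norm (f x - f y) \<le> L * norm (x - y)"
    by blast
qed

lemma solves_from_initial: "solves_from f x u I \<Longrightarrow> u 0 = x"
  and solves_from_derivative:
    "solves_from f x u I \<Longrightarrow> t \<in> I \<Longrightarrow> (u has_vector_derivative f (u t)) (at t within I)"
  unfolding solves_from_def by blast+

lemma solves_from_subset: "solves_from f x u I \<Longrightarrow> J \<subseteq> I \<Longrightarrow> solves_from f x u J"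
  unfolding solves_from_def by (blast intro: has_vector_derivative_within_subset)

lemma solves_from_continuous_on: "solves_from f x u I \<Longrightarrow> continuous_on I u"
  unfolding solves_from_def by (auto intro: continuous_on_vector_derivative)

lemma solves_from_bounded:
  assumes "solves_from f x u {0..T}"
  obtains R where "0 \<le> R" "\<And>t. t \<in> {0..T} \<Longrightarrow> norm (u t) \<le> R"
proof -
  have "bounded (u ` {0..T})"
    by (intro compact_imp_bounded compact_continuous_image solves_from_continuous_on[OF assms]) simp
  then obtain R where "0 < R" "\<And>t. t \<in> {0..T} \<Longrightarrow> norm (u t) \<le> R" unfolding bounded_pos by auto
  then show thesis using that[of R] by simp
qed

lemma norm_difference_growth:
  fixes u v :: "real \<Rightarrow> 'a::euclidean_space"
  assumes u: "\<And>s. s \<in> {0..T} \<Longrightarrow> (u has_vector_derivative f (u s)) (at s within {0..T})"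
    and v: "\<And>s. s \<in> {0..T} \<Longrightarrow> (v has_vector_derivative f (v s)) (at s within {0..T})"
    and lip: "\<And>s. s \<in> {0..T} \<Longrightarrow> norm (f (u s) - f (v s)) \<le> L * norm (u s - v s)"
    and t: "t \<in> {0..T}"
  shows "norm (u t - v t) \<le> exp (L * t) * norm (u 0 - v 0)"
proof -
  define z where "z s = u s - v s" for s
  have "(\<lambda>s. inner (z s) (z s)) t \<le> (\<lambda>s. inner (z s) (z s)) 0 * exp (2 * L * t - 2 * L * 0)"
  proof (rule exponential_growth_bound[OF _ _ _ t, where k = "\<lambda>s. 2 * L"
        and E' = "\<lambda>s. 2 * inner (z s) (f (u s) - f (v s))"])
    fix s assume s: "s \<in> {0..T}"
    show "((\<lambda>s. inner (z s) (z s)) has_real_derivative 2 * inner (z s) (f (u s) - f (v s))) (at s within {0..T})"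
      unfolding z_def
      by (intro quadratic_form_derivative bounded_bilinear_inner inner_commute
          has_vector_derivative_diff u[OF s] v[OF s])
    show "((*) (2 * L) has_real_derivative 2 * L) (at s within {0..T})"
      by (auto intro!: derivative_eq_intros)
    have "inner (z s) (f (u s) - f (v s)) \<le> norm (z s) * norm (f (u s) - f (v s))"
      by (rule norm_cauchy_schwarz)
    also have "\<dots> \<le> norm (z s) * (L * norm (z s))"
      using lip[OF s] unfolding z_def by (rule mult_left_mono) simp
    finally show "2 * inner (z s) (f (u s) - f (v s)) \<le> 2 * L * inner (z s) (z s)"
      by (simp add: power2_norm_eq_inner[symmetric] power2_eq_square mult_ac)
  qed
  then have "(norm (z t))\<^sup>2 \<le> (exp (L * t) * norm (z 0))\<^sup>2"
    by (simp add: power2_norm_eq_inner power_mult_distrib mult_ac flip: exp_double)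
  then show ?thesis unfolding z_def by (rule power2_le_imp_le) simp
qed

lemma solution_unique:
  assumes f: "lipschitz_on_bounded f"
    and u: "solves_from f x u {0..T}" and v: "solves_from f x v {0..T}" and t: "t \<in> {0..T}"
  shows "u t = v t"
proof -
  obtain R1 where R1: "\<And>t. t \<in> {0..T} \<Longrightarrow> norm (u t) \<le> R1" using solves_from_bounded[OF u] by blast
  obtain R2 where R2: "\<And>t. t \<in> {0..T} \<Longrightarrow> norm (v t) \<le> R2" using solves_from_bounded[OF v] by blast
  obtain L where L: "\<And>x y. norm x \<le> max R1 R2 \<Longrightarrow> norm y \<le> max R1 R2 \<Longrightarrow>
      norm (f x - f y) \<le> L * norm (x - y)"
    using f unfolding lipschitz_on_bounded_def by meson
  have "norm (u t - v t) \<le> exp (L * t) * norm (u 0 - v 0)"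
    by (rule norm_difference_growth[where f = f, OF _ _ _ t])
      (use u v R1 R2 L in \<open>auto simp: solves_from_def le_max_iff_disj\<close>)
  then show ?thesis using u v by (simp add: solves_from_def)
qed

lemma flow_eq_solution:
  assumes f: "lipschitz_on_bounded f" and u: "solves_from f x u {0..}" and t: "0 \<le> t"
  shows "flow f t x = u t"
  unfolding flow_def
proof (rule the_equality)
  have u': "solves_from f x u {0..t}" by (rule solves_from_subset[OF u]) auto
  then show "\<exists>v. solves_from f x v {0..t} \<and> v t = u t" by blast
  show "y = u t" if "\<exists>v. solves_from f x v {0..t} \<and> v t = y" for y
    using that solution_unique[OF f _ u'] t by auto
qed

lemma solves_from_shift:
  assumes "solves_from f x u {0..}" and s: "0 \<le> s"
  shows "solves_from f (u s) (\<lambda>t. u (s + t)) {0..}"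
  unfolding solves_from_def
proof (intro conjI ballI)
  fix t :: real assume "t \<in> {0..}"
  then have "(u has_vector_derivative f (u (s + t))) (at (s + t) within {0..})"
    using solves_from_derivative[OF assms(1), of "s + t"] s by simp
  then have "(u has_vector_derivative f (u (s + t))) (at (s + t) within (+) s ` {0..})"
    by (rule has_vector_derivative_within_subset) (use s in auto)
  then have "((u \<circ> (+) s) has_vector_derivative 1 *\<^sub>R f (u (s + t))) (at t within {0..})"
    by (intro vector_diff_chain_within) (auto intro!: derivative_eq_intros)
  then show "((\<lambda>t. u (s + t)) has_vector_derivative f (u (s + t))) (at t within {0..})"
    by (simp add: o_def)
qed simp

lemma solves_from_concatenate:
  assumes T: "0 \<le> T" and u: "solves_from f x u {0..T}" and v: "solves_from f (u T) v {0..}"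
  shows "solves_from f x (\<lambda>t. if t \<in> {0..T} then u t else v (t - T)) {0..}"
  unfolding solves_from_def
proof (intro conjI ballI)
  show "(if 0 \<in> {0..T} then u 0 else v (0 - T)) = x" using T u by (simp add: solves_from_def)
  fix t :: real assume t: "t \<in> {0..}"
  have cl: "{0..T} \<union> (closure {0..T} \<inter> closure {T<..}) = {0..T}"
    "{T<..} \<union> (closure {0..T} \<inter> closure {T<..}) = {T..}" using T by auto
  have "((\<lambda>t. if t \<in> {0..T} then u t else v (t - T)) has_vector_derivative
      (if t \<in> {0..T} then f (u t) else f (v (t - T)))) (at t within {0..})"
  proof (rule has_vector_derivative_If_within_closures[where S = "{0..T}" and T = "{T<..}"
        and f = u and f' = "\<lambda>t. f (u t)" and g = "\<lambda>t. v (t - T)" and g' = "\<lambda>t. f (v (t - T))"],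
      unfold cl)
    show "t \<in> {0..T} \<union> {T<..}" "{0..} = {0..T} \<union> {T<..}" using t T by auto
    show "(u has_vector_derivative f (u t)) (at t within {0..T})" if "t \<in> {0..T}"
      using u that by (rule solves_from_derivative)
    show "((\<lambda>t. v (t - T)) has_vector_derivative f (v (t - T))) (at t within {T..})" if "t \<in> {T..}"
    proof -
      have "(v has_vector_derivative f (v (t - T))) (at (t - T) within (\<lambda>t. t - T) ` {T..})"
      proof (rule has_vector_derivative_within_subset[where S = "{0..}"])
        show "(v has_vector_derivative f (v (t - T))) (at (t - T) within {0..})"
          by (rule solves_from_derivative[OF v]) (use that in simp)
      qed auto
      then have "((v \<circ> (\<lambda>t. t - T)) has_vector_derivative 1 *\<^sub>R f (v (t - T))) (at t within {T..})"
        by (rule vector_diff_chain_within[rotated])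
          (intro derivative_eq_intros, auto)
      then show ?thesis by (simp add: o_def)
    qed
    show "u t = v (t - T)" "f (u t) = f (v (t - T))"
      if "t \<in> closure {0..T}" "t \<in> closure {T<..}"
    proof -
      have "t = T" using that by auto
      then show "u t = v (t - T)" "f (u t) = f (v (t - T))" using v by (simp_all add: solves_from_def)
    qed
  qed
  then show "((\<lambda>t. if t \<in> {0..T} then u t else v (t - T)) has_vector_derivative
      f (if t \<in> {0..T} then u t else v (t - T))) (at t within {0..})"
    by (simp only: if_distrib[of f])
qed

text \<open>Precompose f with the projection onto a large ball. The new field is bounded and globally Lipschitz, and
  by the growth bound its solutions that start close to x0 stay so close to the reference solution up to
  time T that they never see the modification.\<close>
lemma nearby_solution_exists:
  fixes f :: "real^'n \<Rightarrow> real^'n"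
  assumes f: "lipschitz_on_bounded f" and u0: "solves_from f x0 u0 {0..T}" and T: "0 \<le> T"
    and \<epsilon>: "0 < \<epsilon>"
  obtains r where "0 < r" "\<And>y. y \<in> ball x0 r \<Longrightarrow>
     \<exists>u. solves_from f y u {0..T} \<and> (\<forall>t\<in>{0..T}. norm (u t - u0 t) < \<epsilon>)"
proof -
  obtain R0 where R0: "0 \<le> R0" "\<And>t. t \<in> {0..T} \<Longrightarrow> norm (u0 t) \<le> R0"
    using solves_from_bounded[OF u0] by blast
  define R where "R = R0 + \<epsilon>"
  have R: "0 \<le> R" using R0 \<epsilon> by (simp add: R_def)
  obtain L where L: "0 < L" "\<And>x y. norm x \<le> R \<Longrightarrow> norm y \<le> R \<Longrightarrow> norm (f x - f y) \<le> L * norm (x - y)"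
    using f unfolding lipschitz_on_bounded_def by meson
  define P where "P = closest_point (cball (0 :: real^'n) R)"
  have P: "norm (P x) \<le> R" "norm (P x - P y) \<le> norm (x - y)" for x y
    using closest_point_in_set[of "cball 0 R" x] closest_point_lipschitz[of "cball 0 R" x y] R
    by (auto simp: P_def dist_norm)
  have P_self: "P x = x" if "norm x \<le> R" for x
    using that by (simp add: P_def closest_point_self)
  define g where "g x = f (P x)" for x
  have g_lip: "norm (g x - g y) \<le> L * norm (x - y)" for x y
  proof -
    have "norm (g x - g y) \<le> L * norm (P x - P y)" unfolding g_def by (intro L(2) P)
    also have "\<dots> \<le> L * norm (x - y)" using L(1) P(2) by (intro mult_left_mono) auto
    finally show ?thesis .
  qed
  have g_bd: "norm (g x) \<le> norm (f 0) + L * R" for x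
  proof -
    have "norm (g x - f 0) \<le> L * norm (P x - 0)" unfolding g_def using P R by (intro L(2)) auto
    also have "\<dots> \<le> L * R" using L(1) P(1) by simp
    finally show ?thesis using norm_triangle_ineq2[of "g x" "f 0"] by linarith
  qed
  define r where "r = \<epsilon> * exp (- (L * T))"
  show thesis
  proof (rule that[of r])
    show "0 < r" using \<epsilon> by (simp add: r_def)
    fix y assume y: "y \<in> ball x0 r"
    obtain u where u: "u 0 = y" "\<And>t. 0 \<le> t \<Longrightarrow> (u has_vector_derivative g (u t)) (at t within {0..})"
      using global_solution_exists[OF L(1) g_lip g_bd] by blast
    have du: "(u has_vector_derivative g (u t)) (at t within {0..T})" if "t \<in> {0..T}" for t
      by (rule has_vector_derivative_within_subset[OF u(2)]) (use that in auto)
    have du0: "(u0 has_vector_derivative g (u0 t)) (at t within {0..T})" if "t \<in> {0..T}" for t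
      using u0 that R0(2)[OF that] \<epsilon> by (simp add: solves_from_def g_def P_self R_def)
    have close: "norm (u t - u0 t) < \<epsilon>" if t: "t \<in> {0..T}" for t
    proof -
      have "norm (u t - u0 t) \<le> exp (L * t) * norm (u 0 - u0 0)"
        by (rule norm_difference_growth[where f = g, OF du du0 g_lip t])
      also have "\<dots> \<le> exp (L * T) * norm (u 0 - u0 0)"
        using t L(1) by (intro mult_right_mono) auto
      also have "\<dots> < exp (L * T) * r"
        using y u(1) u0 by (intro mult_strict_left_mono) (auto simp: solves_from_def dist_norm norm_minus_commute)
      also have "\<dots> = \<epsilon>" by (simp add: r_def exp_minus field_simps)
      finally show ?thesis .
    qed
    have "P (u t) = u t" if "t \<in> {0..T}" for t
      using close[OF that] R0(2)[OF that] norm_triangle_ineq2[of "u t" "u0 t"]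
      by (intro P_self) (simp add: R_def)
    then have "solves_from f y u {0..T}" using u(1) du by (simp add: solves_from_def g_def)
    then show "\<exists>u. solves_from f y u {0..T} \<and> (\<forall>t\<in>{0..T}. norm (u t - u0 t) < \<epsilon>)"
      using close by blast
  qed
qed

section \<open>Energy estimates with forcing\<close>

text \<open>The square of the norm is augmented by q^2, so that the forcing term is absorbed into a homogeneous
  differential inequality.\<close>
lemma forced_growth:
  fixes z :: "real \<Rightarrow> 'a::euclidean_space"
  assumes z: "\<And>s. s \<in> {0..T} \<Longrightarrow> (z has_vector_derivative z' s) (at s within {0..T})"
    and le: "\<And>s. s \<in> {0..T} \<Longrightarrow> norm (z' s) \<le> L * norm (z s) + q" and L: "0 \<le> L" and t: "t \<in> {0..T}"
  shows "(norm (z t))\<^sup>2 \<le> ((norm (z 0))\<^sup>2 + q\<^sup>2) * exp ((2 * L + 1) * t)"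
proof -
  define E where "E s = inner (z s) (z s) + q\<^sup>2" for s
  have "E t \<le> E 0 * exp ((2 * L + 1) * t - (2 * L + 1) * 0)"
  proof (rule exponential_growth_bound[where E = E and E' = "\<lambda>s. 2 * inner (z s) (z' s)"
        and k = "\<lambda>s. 2 * L + 1" and K = "\<lambda>s. (2 * L + 1) * s", OF _ _ _ t])
    fix s assume s: "s \<in> {0..T}"
    have "((\<lambda>s. inner (z s) (z s)) has_real_derivative 2 * inner (z s) (z' s)) (at s within {0..T})"
      by (intro quadratic_form_derivative bounded_bilinear_inner inner_commute z s)
    from DERIV_add[OF this DERIV_const]
    show "(E has_real_derivative 2 * inner (z s) (z' s)) (at s within {0..T})"
      unfolding E_def by simp
    show "((*) (2 * L + 1) has_real_derivative 2 * L + 1) (at s within {0..T})"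
      using DERIV_cmult_Id by blast
    have "inner (z s) (z' s) \<le> norm (z s) * norm (z' s)" by (rule norm_cauchy_schwarz)
    also have "\<dots> \<le> norm (z s) * (L * norm (z s) + q)"
      by (intro mult_left_mono le s) simp
    finally have "2 * inner (z s) (z' s) \<le> 2 * L * (norm (z s))\<^sup>2 + 2 * norm (z s) * q"
      by (simp add: power2_eq_square algebra_simps)
    moreover have "2 * norm (z s) * q \<le> (norm (z s))\<^sup>2 + q\<^sup>2" by (rule sum_squares_bound)
    moreover have "E s = (norm (z s))\<^sup>2 + q\<^sup>2" by (simp add: E_def power2_norm_eq_inner)
    moreover have "0 \<le> 2 * L * q\<^sup>2"
      using L by simp
    ultimately show "2 * inner (z s) (z' s) \<le> (2 * L + 1) * E s"
      by (simp add: algebra_simps)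
  qed
  then have "inner (z t) (z t) + q\<^sup>2 \<le> (inner (z 0) (z 0) + q\<^sup>2) * exp ((2 * L + 1) * t)"
    by (simp add: E_def)
  then show ?thesis unfolding power2_norm_eq_inner using zero_le_power2[of q] by linarith
qed

text \<open>Multiplied by exp(2 \<beta> t), the form B(z, z) would be nonincreasing without forcing. The forcing decays at
  the doubled rate because it is quadratic in decaying quantities; so it contributes an integrable factor
  exp(-\<beta> t), whose integral over the half line is at most 1 / \<beta>.\<close>
lemma forced_decay:
  fixes z :: "real \<Rightarrow> 'a::real_normed_vector"
  assumes B: "bounded_bilinear (B :: 'a \<Rightarrow> 'a \<Rightarrow> real)" and sym: "\<And>x y. B x y = B y x"
    and pos: "\<And>x. (norm x)\<^sup>2 \<le> B x x" and \<beta>: "0 < \<beta>" and T: "0 \<le> T"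
    and z: "\<And>s. s \<in> {T..b} \<Longrightarrow> (z has_vector_derivative z' s) (at s within {T..b})"
    and le: "\<And>s. s \<in> {T..b} \<Longrightarrow> B (z s) (z' s) \<le> - \<beta> * B (z s) (z s) + q * norm (z s) * exp (- 2 * \<beta> * s)"
    and t: "t \<in> {T..b}"
  shows "(norm (z t))\<^sup>2 \<le> exp (- 2 * \<beta> * t) * exp (1 / \<beta>) * (exp (2 * \<beta> * T) * B (z T) (z T) + q\<^sup>2)"
proof -
  define e where "e s = exp (2 * \<beta> * s)" for s
  \<comment> \<open>As in the growth estimate, q^2 is added in order to absorb the forcing.\<close>
  define W where "W s = e s * B (z s) (z s) + q\<^sup>2" for s
  define W' where "W' s = e s * (2 * B (z s) (z' s)) + 2 * \<beta> * e s * B (z s) (z s)" for s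
  define K where "K s = - exp (- \<beta> * s) / \<beta>" for s
  have "W t \<le> W T * exp (K t - K T)"
  proof (rule exponential_growth_bound[where E = W and E' = W' and k = "\<lambda>s. exp (- \<beta> * s)" and K = K, OF _ _ _ t])
    fix s assume s: "s \<in> {T..b}"
    have 1: "((\<lambda>s. B (z s) (z s)) has_real_derivative 2 * B (z s) (z' s)) (at s within {T..b})"
      by (intro quadratic_form_derivative B sym z s)
    have 2: "(e has_real_derivative 2 * \<beta> * e s) (at s within {T..b})"
      unfolding e_def by (auto intro!: derivative_eq_intros)
    show "(W has_real_derivative W' s) (at s within {T..b})"
      using DERIV_add[OF DERIV_mult'[OF 2 1] DERIV_const[of "q\<^sup>2"]] unfolding W_def W'_def by simp
    show "(K has_real_derivative exp (- \<beta> * s)) (at s within {T..b})"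
      unfolding K_def using \<beta> by (auto intro!: derivative_eq_intros)
    define n where "n = exp (\<beta> * s) * norm (z s)"
    have ee: "e s = exp (\<beta> * s) * exp (\<beta> * s)" by (simp add: e_def mult_exp_exp)
    have "W' s = 2 * e s * (B (z s) (z' s) + \<beta> * B (z s) (z s))" by (simp add: W'_def algebra_simps)
    also have "\<dots> \<le> 2 * e s * (q * norm (z s) * exp (- 2 * \<beta> * s))"
      using le[OF s] by (intro mult_left_mono) (auto simp: e_def)
    also have "\<dots> = exp (- \<beta> * s) * (2 * n * q)"
    proof -
      have 1: "e s * exp (- 2 * \<beta> * s) = 1" and 2: "exp (- \<beta> * s) * n = norm (z s)"
        by (simp_all add: e_def n_def mult_exp_exp flip: mult.assoc)
      have "2 * e s * (q * norm (z s) * exp (- 2 * \<beta> * s)) = 2 * q * norm (z s) * (e s * exp (- 2 * \<beta> * s))"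
        by (simp only: mult_ac)
      also have "\<dots> = 2 * q * (exp (- \<beta> * s) * n)" unfolding 1 2 by simp
      finally show ?thesis by (simp only: mult_ac)
    qed
    also have "\<dots> \<le> exp (- \<beta> * s) * W s"
    proof (rule mult_left_mono)
      have "2 * n * q \<le> n\<^sup>2 + q\<^sup>2" by (rule sum_squares_bound)
      also have "n\<^sup>2 = e s * (norm (z s))\<^sup>2" by (simp add: n_def ee power2_eq_square mult_ac)
      also have "\<dots> \<le> e s * B (z s) (z s)" by (intro mult_left_mono pos) (simp add: e_def)
      finally show "2 * n * q \<le> W s" by (simp add: W_def)
    qed simp
    finally show "W' s \<le> exp (- \<beta> * s) * W s" .
  qed
  also have "\<dots> \<le> W T * exp (1 / \<beta>)"
  proof (intro mult_left_mono)
    have "0 \<le> B (z T) (z T)" using pos[of "z T"] zero_le_power2[of "norm (z T)"] by linarith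
    then show "0 \<le> W T" by (simp add: W_def e_def)
    have "exp (- \<beta> * T) \<le> 1" using \<beta> T by simp
    then have "exp (- \<beta> * T) / \<beta> \<le> 1 / \<beta>" using \<beta> by (intro divide_right_mono) auto
    moreover have "0 \<le> exp (- \<beta> * t) / \<beta>" using \<beta> by simp
    ultimately show "exp (K t - K T) \<le> exp (1 / \<beta>)" unfolding K_def by simp
  qed
  finally have "e t * B (z t) (z t) + q\<^sup>2 \<le> W T * exp (1 / \<beta>)" by (simp add: W_def)
  moreover have "e t * (norm (z t))\<^sup>2 \<le> e t * B (z t) (z t)" by (intro mult_left_mono pos) (simp add: e_def)
  ultimately have "e t * (norm (z t))\<^sup>2 \<le> W T * exp (1 / \<beta>)" using zero_le_power2[of q] by linarith
  then have "exp (- 2 * \<beta> * t) * (e t * (norm (z t))\<^sup>2) \<le> exp (- 2 * \<beta> * t) * (W T * exp (1 / \<beta>))"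
    by (rule mult_left_mono) simp
  moreover have "exp (- 2 * \<beta> * t) * (e t * (norm (z t))\<^sup>2) = (norm (z t))\<^sup>2"
    by (simp add: e_def exp_minus)
  moreover have "exp (- 2 * \<beta> * t) * (W T * exp (1 / \<beta>))
      = exp (- 2 * \<beta> * t) * exp (1 / \<beta>) * (exp (2 * \<beta> * T) * B (z T) (z T) + q\<^sup>2)"
    unfolding W_def e_def by (simp only: mult_ac)
  ultimately show ?thesis by (simp only:)
qed

text \<open>Growth up to the time T and decay from then on. That one constant serves all z and q makes the
  estimates for the flow uniform in the initial points.\<close>
lemma eventually_forced_decay:
  fixes B :: "'a::euclidean_space \<Rightarrow> 'a \<Rightarrow> real"
  assumes B: "bounded_bilinear B" and sym: "\<And>x y. B x y = B y x"
    and pos: "\<And>x. (norm x)\<^sup>2 \<le> B x x" and \<beta>: "0 < \<beta>" and T: "0 \<le> T" and L: "0 \<le> L"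
  obtains C where "0 \<le> C" "\<And>z z' q t. (\<And>s. 0 \<le> s \<Longrightarrow> (z has_vector_derivative z' s) (at s within {0..})) \<Longrightarrow>
     (\<And>s. s \<in> {0..T} \<Longrightarrow> norm (z' s) \<le> L * norm (z s) + q) \<Longrightarrow>
     (\<And>s. T \<le> s \<Longrightarrow> B (z s) (z' s) \<le> - \<beta> * B (z s) (z s) + q * norm (z s) * exp (- 2 * \<beta> * s)) \<Longrightarrow>
     0 \<le> q \<Longrightarrow> 0 \<le> t \<Longrightarrow> norm (z t) \<le> C * exp (- \<beta> * t) * (norm (z 0) + q)"
proof -
  obtain M where M: "0 < M" "\<And>x y. norm (B x y) \<le> norm x * norm y * M"
    using bounded_bilinear.pos_bounded[OF B] by blast
  \<comment> \<open>G is the growth up to time T, and exp(2 \<beta> T) makes up for the decay that is missing until then.\<close>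
  define G where "G = exp ((2 * L + 1) * T)"
  have G: "1 \<le> G" using L T by (simp add: G_def)
  define D where "D = exp (1 / \<beta>) * (exp (2 * \<beta> * T) * ((M + 1) * G) + 1)"
  have D: "0 \<le> D" using M(1) G by (simp add: D_def)
  show thesis
  proof (rule that[of "sqrt D"])
    show "0 \<le> sqrt D" using D by simp
    fix z z' :: "real \<Rightarrow> 'a" and q t :: real
    assume z: "\<And>s. 0 \<le> s \<Longrightarrow> (z has_vector_derivative z' s) (at s within {0..})"
      and early: "\<And>s. s \<in> {0..T} \<Longrightarrow> norm (z' s) \<le> L * norm (z s) + q"
      and late: "\<And>s. T \<le> s \<Longrightarrow> B (z s) (z' s) \<le> - \<beta> * B (z s) (z s) + q * norm (z s) * exp (- 2 * \<beta> * s)"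
      and q: "0 \<le> q" and t: "0 \<le> t"
    define N where "N = (norm (z 0))\<^sup>2 + q\<^sup>2"
    have N: "0 \<le> N" by (simp add: N_def)
    have early': "(norm (z s))\<^sup>2 \<le> N * G" if s: "s \<in> {0..T}" for s
    proof -
      have "(norm (z s))\<^sup>2 \<le> N * exp ((2 * L + 1) * s)"
        unfolding N_def
      proof (rule forced_growth[OF _ early L s])
        show "(z has_vector_derivative z' s) (at s within {0..T})" if "s \<in> {0..T}" for s
          by (rule has_vector_derivative_within_subset[OF z]) (use that in auto)
      qed auto
      also have "\<dots> \<le> N * G" unfolding G_def using s L N by (intro mult_left_mono) auto
      finally show ?thesis .
    qed
    have "(norm (z t))\<^sup>2 \<le> exp (- 2 * \<beta> * t) * (D * N)"
    proof (cases "t \<le> T")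
      case True
      have "(norm (z t))\<^sup>2 \<le> N * G" using early' True t by simp
      also have "\<dots> = exp (- 2 * \<beta> * t) * (exp (2 * \<beta> * t) * (G * N))"
        by (simp add: exp_minus)
      also have "\<dots> \<le> exp (- 2 * \<beta> * t) * (D * N)"
      proof (intro mult_left_mono)
        have "exp (2 * \<beta> * t) * G \<le> exp (2 * \<beta> * T) * ((M + 1) * G)"
          using True \<beta> G M(1) by (intro mult_mono) auto
        also have "\<dots> \<le> exp (1 / \<beta>) * (exp (2 * \<beta> * T) * ((M + 1) * G) + 1)"
        proof -
          have "0 \<le> exp (2 * \<beta> * T) * ((M + 1) * G)" using M(1) G by simp
          then have "1 * (exp (2 * \<beta> * T) * ((M + 1) * G)) \<le> exp (1 / \<beta>) * (exp (2 * \<beta> * T) * ((M + 1) * G) + 1)"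
            using \<beta> by (intro mult_mono) auto
          then show ?thesis by simp
        qed
        finally have "exp (2 * \<beta> * t) * G * N \<le> D * N" unfolding D_def using N by (rule mult_right_mono)
        then show "exp (2 * \<beta> * t) * (G * N) \<le> D * N" by (simp only: mult.assoc)
      qed simp
      finally show ?thesis .
    next
      case False
      have "(norm (z t))\<^sup>2 \<le> exp (- 2 * \<beta> * t) * exp (1 / \<beta>) * (exp (2 * \<beta> * T) * B (z T) (z T) + q\<^sup>2)"
      proof (rule forced_decay[OF B sym pos \<beta> T])
        show "t \<in> {T..t}" using False by simp
        show "(z has_vector_derivative z' s) (at s within {T..t})" if "s \<in> {T..t}" for s
          by (rule has_vector_derivative_within_subset[OF z]) (use that T in auto)
        show "B (z s) (z' s) \<le> - \<beta> * B (z s) (z s) + q * norm (z s) * exp (- 2 * \<beta> * s)"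
          if "s \<in> {T..t}" for s using late that by simp
      qed
      also have "\<dots> \<le> exp (- 2 * \<beta> * t) * exp (1 / \<beta>) * (exp (2 * \<beta> * T) * ((M + 1) * G * N) + N)"
      proof (intro mult_left_mono add_mono)
        have "B (z T) (z T) \<le> (norm (z T))\<^sup>2 * M"
          using M(2)[of "z T" "z T"] by (simp add: power2_eq_square)
        also have "\<dots> \<le> (N * G) * M" using early'[of T] T M(1) by (intro mult_right_mono) auto
        also have "\<dots> \<le> (M + 1) * G * N" using N G by (simp add: algebra_simps)
        finally show "B (z T) (z T) \<le> (M + 1) * G * N" .
        show "q\<^sup>2 \<le> N" by (simp add: N_def)
      qed auto
      also have "\<dots> = exp (- 2 * \<beta> * t) * (D * N)" by (simp add: D_def distrib_left distrib_right mult.assoc)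
      finally show ?thesis .
    qed
    also have "\<dots> \<le> exp (- 2 * \<beta> * t) * (D * (norm (z 0) + q)\<^sup>2)"
      using q D by (intro mult_left_mono) (auto simp: N_def power2_sum)
    also have "\<dots> = (sqrt D * exp (- \<beta> * t) * (norm (z 0) + q))\<^sup>2"
    proof -
      have "exp (- 2 * \<beta> * t) = (exp (- \<beta> * t))\<^sup>2" by (simp flip: exp_double)
      then show ?thesis using D by (simp add: power_mult_distrib)
    qed
    finally show "norm (z t) \<le> sqrt D * exp (- \<beta> * t) * (norm (z 0) + q)"
      by (rule power2_le_imp_le) (use q D in auto)
  qed
qed

section \<open>Uniform estimates for the flow near an attracted point\<close>

lemma domain_of_attraction_flow:
  assumes f: "lipschitz_on_bounded f" and x: "x \<in> domain_of_attraction f"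
  shows "solves_from f x (\<lambda>t. flow f t x) {0..}" "((\<lambda>t. flow f t x) \<longlongrightarrow> 0) at_top"
proof -
  obtain u where u: "solves_from f x u {0..}" "(u \<longlongrightarrow> 0) at_top"
    using x by (auto simp: domain_of_attraction_def)
  have eq: "flow f t x = u t" if "0 \<le> t" for t using flow_eq_solution[OF f u(1) that] .
  show "solves_from f x (\<lambda>t. flow f t x) {0..}"
    unfolding solves_from_def
  proof (intro conjI ballI)
    show "flow f 0 x = x" using eq[of 0] solves_from_initial[OF u(1)] by simp
    fix t :: real assume t: "t \<in> {0..}"
    show "((\<lambda>t. flow f t x) has_vector_derivative f (flow f t x)) (at t within {0..})"
      by (rule has_vector_derivative_transform[where f = u])
        (use t eq solves_from_derivative[OF u(1) t] in auto)
  qed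
  show "((\<lambda>t. flow f t x) \<longlongrightarrow> 0) at_top"
    by (rule Lim_transform_eventually[OF u(2)])
      (use eq in \<open>auto intro: eventually_mono[OF eventually_ge_at_top[of 0]]\<close>)
qed

text \<open>Close to the origin the Lipschitz constant of F is so small that F uses up no more than the difference of
  the rates \<beta>' and \<beta>.\<close>
lemma dissipative_near_origin:
  fixes A :: "real^'n^'n" and F :: "real^'n \<Rightarrow> real^'n"
  assumes smooth: "smooth_on UNIV F" and van: "vanishes_to_order F p" and p: "1 < p"
    and B: "bounded_bilinear B" and pos: "\<And>x. (norm x)\<^sup>2 \<le> B x x"
    and A: "\<And>x. B x (A *v x) \<le> - \<beta>' * B x x" and \<beta>: "\<beta> < \<beta>'"
    and f: "\<And>x. f x = A *v x + F x"
  obtains \<rho> c where "0 < \<rho>" "0 \<le> c" "\<And>u u1 u2 u3. norm u \<le> \<rho> \<Longrightarrow> norm u1 \<le> \<rho> \<Longrightarrow> norm u2 \<le> \<rho> \<Longrightarrow>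
     norm u3 \<le> \<rho> \<Longrightarrow> B (u3 - u1 - u2 + u) (f u3 - f u1 - f u2 + f u) \<le>
       - \<beta> * B (u3 - u1 - u2 + u) (u3 - u1 - u2 + u)
       + c * (norm (u1 - u) * norm (u2 - u)) * norm (u3 - u1 - u2 + u)"
proof -
  obtain M where M: "0 < M" "\<And>x y. norm (B x y) \<le> norm x * norm y * M"
    using bounded_bilinear.pos_bounded[OF B] by blast
  obtain C where C: "0 \<le> C" "\<And>\<sigma> u u1 u2 u3. 0 < \<sigma> \<Longrightarrow> \<sigma> \<le> 1 \<Longrightarrow>
     3 * norm u \<le> \<sigma> \<Longrightarrow> 3 * norm u1 \<le> \<sigma> \<Longrightarrow> 3 * norm u2 \<le> \<sigma> \<Longrightarrow> 3 * norm u3 \<le> \<sigma> \<Longrightarrow>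
     norm (F u3 - F u1 - F u2 + F u) \<le> C * \<sigma> powr (p - 1) * norm (u3 - u1 - u2 + u)
       + C * \<sigma> powr (p - 2) * norm (u1 - u) * norm (u2 - u)"
    using vanishes_to_order_four_points[OF smooth van zero_less_one] by blast
  \<comment> \<open>The radius \<sigma> is chosen such that M C \<sigma>^(p-1) \<le> \<beta>' - \<beta>; adding 1 avoids a division by zero.\<close>
  define \<kappa> where "\<kappa> = (\<beta>' - \<beta>) / (M * C + 1)"
  have MC: "0 \<le> M * C" using M C by simp
  then have \<kappa>: "0 < \<kappa>" using \<beta> by (simp add: \<kappa>_def)
  define \<sigma> where "\<sigma> = min 1 (\<kappa> powr (1 / (p - 1)))"
  have \<sigma>: "0 < \<sigma>" "\<sigma> \<le> 1" using \<kappa> by (auto simp: \<sigma>_def)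
  have small: "M * (C * \<sigma> powr (p - 1)) \<le> \<beta>' - \<beta>"
  proof -
    have "\<sigma> powr (p - 1) \<le> (\<kappa> powr (1 / (p - 1))) powr (p - 1)"
      using p \<sigma> by (intro powr_mono2) (auto simp: \<sigma>_def)
    also have "\<dots> = \<kappa>" using p \<kappa> by (simp add: powr_powr)
    finally have "(M * C) * \<sigma> powr (p - 1) \<le> (M * C) * \<kappa>" using MC by (rule mult_left_mono)
    also have "\<dots> \<le> (M * C + 1) * \<kappa>" using \<kappa> by (intro mult_right_mono) auto
    also have "\<dots> = \<beta>' - \<beta>" using MC by (simp add: \<kappa>_def)
    finally show ?thesis by (simp only: mult.assoc)
  qed
  define c where "c = M * (C * \<sigma> powr (p - 2))"
  show thesis
  proof (rule that[of "\<sigma> / 3" c])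
    show "0 < \<sigma> / 3" using \<sigma> by simp
    show "0 \<le> c" using M C by (simp add: c_def)
    fix u u1 u2 u3 :: "real^'n"
    assume u: "norm u \<le> \<sigma> / 3" "norm u1 \<le> \<sigma> / 3" "norm u2 \<le> \<sigma> / 3" "norm u3 \<le> \<sigma> / 3"
    define r where "r = u3 - u1 - u2 + u"
    define d where "d = F u3 - F u1 - F u2 + F u"
    have fr: "f u3 - f u1 - f u2 + f u = A *v r + d"
      by (simp add: f r_def d_def matrix_vector_right_distrib matrix_vector_mult_diff_distrib)
    have "norm d \<le> C * \<sigma> powr (p - 1) * norm r + C * \<sigma> powr (p - 2) * norm (u1 - u) * norm (u2 - u)"
      unfolding d_def r_def using u by (intro C(2) \<sigma>) auto
    then have "norm r * M * norm d
        \<le> norm r * M * (C * \<sigma> powr (p - 1) * norm r + C * \<sigma> powr (p - 2) * norm (u1 - u) * norm (u2 - u))"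
      using M by (intro mult_left_mono) auto
    also have "\<dots> = M * (C * \<sigma> powr (p - 1)) * (norm r)\<^sup>2 + c * (norm (u1 - u) * norm (u2 - u)) * norm r"
      by (simp only: c_def distrib_left power2_eq_square mult_ac)
    also have "M * (C * \<sigma> powr (p - 1)) * (norm r)\<^sup>2 \<le> (\<beta>' - \<beta>) * B r r"
      using small pos[of r] \<beta> by (intro mult_mono) auto
    finally have "norm r * M * norm d \<le> (\<beta>' - \<beta>) * B r r + c * (norm (u1 - u) * norm (u2 - u)) * norm r"
      by simp
    moreover have "B r d \<le> norm r * M * norm d" using M(2)[of r d] by (simp add: mult_ac)
    moreover have "B r (A *v r + d) = B r (A *v r) + B r d"
      by (rule bounded_bilinear.add_right[OF B])
    ultimately have "B r (A *v r + d) \<le> - \<beta> * B r r + c * (norm (u1 - u) * norm (u2 - u)) * norm r"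
      using A[of r] by (simp add: left_diff_distrib)
    then show "B (u3 - u1 - u2 + u) (f u3 - f u1 - f u2 + f u) \<le>
       - \<beta> * B (u3 - u1 - u2 + u) (u3 - u1 - u2 + u)
       + c * (norm (u1 - u) * norm (u2 - u)) * norm (u3 - u1 - u2 + u)"
      unfolding fr r_def[symmetric] .
  qed
qed

text \<open>The substitute for dissipativity during the initial phase, while the solutions are still away from the
  origin.\<close>
lemma four_point_bound_on_bounded:
  fixes A :: "real^'n^'n" and F :: "real^'n \<Rightarrow> real^'n"
  assumes smooth: "smooth_on UNIV F" and van: "vanishes_to_order F p" 
    and f: "\<And>x. f x = A *v x + F x" and R: "0 < R"
  obtains L c where "0 \<le> L" "0 \<le> c" "\<And>u u1 u2 u3. norm u \<le> R \<Longrightarrow> norm u1 \<le> R \<Longrightarrow> norm u2 \<le> R \<Longrightarrow>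
     norm u3 \<le> R \<Longrightarrow> norm (f u3 - f u1 - f u2 + f u) \<le>
       L * norm (u3 - u1 - u2 + u) + c * (norm (u1 - u) * norm (u2 - u))"
proof -
  have R3: "0 < 3 * R" using R by simp
  obtain C where C: "0 \<le> C" "\<And>\<sigma> u u1 u2 u3. 0 < \<sigma> \<Longrightarrow> \<sigma> \<le> 3 * R \<Longrightarrow>
     3 * norm u \<le> \<sigma> \<Longrightarrow> 3 * norm u1 \<le> \<sigma> \<Longrightarrow> 3 * norm u2 \<le> \<sigma> \<Longrightarrow> 3 * norm u3 \<le> \<sigma> \<Longrightarrow>
     norm (F u3 - F u1 - F u2 + F u) \<le> C * \<sigma> powr (p - 1) * norm (u3 - u1 - u2 + u)
       + C * \<sigma> powr (p - 2) * norm (u1 - u) * norm (u2 - u)"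
    using vanishes_to_order_four_points[OF smooth van R3] by blast
  define a where "a = onorm ((*v) A)"
  have bl: "bounded_linear ((*v) A)" by (rule matrix_vector_mul_bounded_linear)
  have a0: "0 \<le> a" unfolding a_def by (rule onorm_pos_le[OF bl])
  show thesis
  proof (rule that[of "a + C * (3 * R) powr (p - 1)" "C * (3 * R) powr (p - 2)"])
    show "0 \<le> a + C * (3 * R) powr (p - 1)" "0 \<le> C * (3 * R) powr (p - 2)" using a0 C(1) by auto
    fix u u1 u2 u3 :: "real^'n"
    assume u: "norm u \<le> R" "norm u1 \<le> R" "norm u2 \<le> R" "norm u3 \<le> R"
    define r where "r = u3 - u1 - u2 + u"
    define d where "d = F u3 - F u1 - F u2 + F u"
    have "f u3 - f u1 - f u2 + f u = A *v r + d"
      by (simp add: f r_def d_def matrix_vector_right_distrib matrix_vector_mult_diff_distrib)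
    then have "norm (f u3 - f u1 - f u2 + f u) \<le> norm (A *v r) + norm d" by (simp add: norm_triangle_ineq)
    also have "norm (A *v r) \<le> a * norm r" unfolding a_def by (rule onorm[OF bl])
    also have "norm d \<le> C * (3 * R) powr (p - 1) * norm r + C * (3 * R) powr (p - 2) * norm (u1 - u) * norm (u2 - u)"
      unfolding d_def r_def using u R by (intro C(2)) auto
    finally show "norm (f u3 - f u1 - f u2 + f u) \<le>
       (a + C * (3 * R) powr (p - 1)) * norm (u3 - u1 - u2 + u)
       + C * (3 * R) powr (p - 2) * (norm (u1 - u) * norm (u2 - u))"
      unfolding r_def[symmetric] by (simp only: distrib_right mult.assoc add.assoc)
  qed
qed

text \<open>A reference solution reaches the \<delta>-ball of Lyapunov stability at some time T. Nearby solutions exist up to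
  time T and are then in that ball too, from where they continue without leaving the ball of radius \<rho>.\<close>
lemma solutions_trapped_nearby:
  fixes f :: "real^'n \<Rightarrow> real^'n"
  assumes f: "lipschitz_on_bounded f" and stable: "lyapunov_stable f"
    and x0: "x0 \<in> domain_of_attraction f" and \<rho>: "0 < \<rho>"
  obtains r T R where "0 < r" "0 \<le> T" "0 < R" "\<And>y. y \<in> ball x0 r \<Longrightarrow>
     \<exists>u. solves_from f y u {0..} \<and> (\<forall>t\<ge>0. norm (u t) \<le> R) \<and> (\<forall>t\<ge>T. norm (u t) \<le> \<rho>)"
proof -
  obtain \<delta> where \<delta>: "0 < \<delta>" "\<And>x. norm x < \<delta> \<Longrightarrow> \<exists>u. solves_from f x u {0..} \<and> (\<forall>t\<ge>0. norm (u t) < \<rho>)"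
    using stable \<rho> unfolding lyapunov_stable_def by meson
  obtain u0 where u0: "solves_from f x0 u0 {0..}" "(u0 \<longlongrightarrow> 0) at_top"
    using x0 by (auto simp: domain_of_attraction_def)
  have "eventually (\<lambda>t. norm (u0 t) < \<delta> / 2) at_top"
    using tendsto_norm[OF u0(2)] \<delta>(1) by (intro order_tendstoD(2)[where y = 0]) auto
  then have "eventually (\<lambda>t. norm (u0 t) < \<delta> / 2 \<and> 0 \<le> t) at_top"
    using eventually_ge_at_top[of 0] by (rule eventually_conj)
  then obtain T where T: "norm (u0 T) < \<delta> / 2" "0 \<le> T"
    unfolding eventually_at_top_linorder by blast
  have u0T: "solves_from f x0 u0 {0..T}" by (rule solves_from_subset[OF u0(1)]) auto
  obtain R0 where R0: "0 \<le> R0" "\<And>t. t \<in> {0..T} \<Longrightarrow> norm (u0 t) \<le> R0"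
    using solves_from_bounded[OF u0T] by blast
  obtain r where r: "0 < r" "\<And>y. y \<in> ball x0 r \<Longrightarrow>
     \<exists>u. solves_from f y u {0..T} \<and> (\<forall>t\<in>{0..T}. norm (u t - u0 t) < \<delta> / 2)"
    using nearby_solution_exists[OF f u0T T(2), of "\<delta> / 2"] \<delta>(1) by auto
  define R where "R = max (R0 + \<delta>) \<rho>"
  show thesis
  proof (rule that[OF r(1) T(2), of R])
    show "0 < R" using \<rho> by (simp add: R_def)
    fix y assume y: "y \<in> ball x0 r"
    obtain u where u: "solves_from f y u {0..T}" "\<And>t. t \<in> {0..T} \<Longrightarrow> norm (u t - u0 t) < \<delta> / 2"
      using r(2)[OF y] by blast
    have "norm (u T) < \<delta>"
      using u(2)[of T] T norm_triangle_ineq2[of "u T" "u0 T"] by simp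
    then obtain v where v: "solves_from f (u T) v {0..}" "\<And>t. 0 \<le> t \<Longrightarrow> norm (v t) < \<rho>"
      using \<delta>(2) by blast
    define w where "w t = (if t \<in> {0..T} then u t else v (t - T))" for t
    have w: "solves_from f y w {0..}"
      unfolding w_def using solves_from_concatenate[OF T(2) u(1) v(1)] .
    have early: "norm (w t) \<le> R0 + \<delta>" if "t \<in> {0..T}" for t
      using that u(2)[OF that] R0(2)[OF that] norm_triangle_ineq2[of "u t" "u0 t"] \<delta>(1)
      by (simp add: w_def)
    have late: "norm (w t) \<le> \<rho>" if t: "T \<le> t" for t
    proof (cases "t = T")
      case True
      then have "w t = v 0" using solves_from_initial[OF v(1)] T(2) by (simp add: w_def)
      then show ?thesis using v(2)[of 0] by simp
    next
      case False
      then have "w t = v (t - T)" using t by (simp add: w_def)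
      then show ?thesis using v(2)[of "t - T"] t by simp
    qed
    have "norm (w t) \<le> R" if "0 \<le> t" for t
      using early[of t] late[of t] that unfolding R_def by (cases "t \<le> T") auto
    then show "\<exists>u. solves_from f y u {0..} \<and> (\<forall>t\<ge>0. norm (u t) \<le> R) \<and> (\<forall>t\<ge>T. norm (u t) \<le> \<rho>)"
      using w late by blast
  qed
qed

text \<open>All three estimates come from one statement about four solutions, with some of the solutions zero or
  equal: the size (three zero solutions), the Lipschitz dependence (three equal solutions), and the second
  differences, whose forcing term is controlled by the Lipschitz estimate.\<close>
lemma flow_estimates_near_attracted_point:
  fixes A :: "real^'n^'n" and F :: "real^'n \<Rightarrow> real^'n"
  assumes smooth: "smooth_on UNIV F" and van: "vanishes_to_order F p" and p: "1 < p" and F0: "F 0 = 0"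
    and f: "\<And>x. f x = A *v x + F x" and lip: "lipschitz_on_bounded f"
    and ev: "\<And>z. eigenvalue_of A z \<Longrightarrow> Re z \<le> - \<alpha>" and \<beta>: "0 < \<beta>" "\<beta> < \<alpha>"
    and stable: "lyapunov_stable f" and x0: "x0 \<in> domain_of_attraction f"
  obtains r C where "0 < r" "0 \<le> C" "ball x0 r \<subseteq> domain_of_attraction f"
    "\<And>y t. y \<in> ball x0 r \<Longrightarrow> 0 \<le> t \<Longrightarrow> norm (flow f t y) \<le> C * exp (- \<beta> * t) * norm y"
    "\<And>y y' t. y \<in> ball x0 r \<Longrightarrow> y' \<in> ball x0 r \<Longrightarrow> 0 \<le> t \<Longrightarrow>
       norm (flow f t y - flow f t y') \<le> C * exp (- \<beta> * t) * norm (y - y')"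
    "\<And>y a b t. y \<in> ball x0 r \<Longrightarrow> y + a \<in> ball x0 r \<Longrightarrow> y + b \<in> ball x0 r \<Longrightarrow> y + a + b \<in> ball x0 r \<Longrightarrow>
       0 \<le> t \<Longrightarrow> norm (flow f t (y + a + b) - flow f t (y + a) - flow f t (y + b) + flow f t y)
         \<le> C * exp (- \<beta> * t) * (norm a * norm b)"
proof -
  define \<beta>' where "\<beta>' = (\<alpha> + \<beta>) / 2"
  have \<beta>': "\<beta>' < \<alpha>" "\<beta> < \<beta>'" using \<beta> by (auto simp: \<beta>'_def)
  obtain B where B: "bounded_bilinear B" "\<And>x y. B x y = B y x" "\<And>x. (norm x)\<^sup>2 \<le> B x x"
    "\<And>x. B x (A *v x) \<le> - \<beta>' * B x x" using lyapunov_form_exists[OF ev \<beta>'(1)] by blast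
  obtain \<rho> c where \<rho>: "0 < \<rho>" "0 \<le> c" "\<And>u u1 u2 u3. norm u \<le> \<rho> \<Longrightarrow> norm u1 \<le> \<rho> \<Longrightarrow> norm u2 \<le> \<rho> \<Longrightarrow>
     norm u3 \<le> \<rho> \<Longrightarrow> B (u3 - u1 - u2 + u) (f u3 - f u1 - f u2 + f u) \<le>
       - \<beta> * B (u3 - u1 - u2 + u) (u3 - u1 - u2 + u)
       + c * (norm (u1 - u) * norm (u2 - u)) * norm (u3 - u1 - u2 + u)"
    using dissipative_near_origin[OF smooth van p B(1,3,4) \<beta>'(2) f] by blast
  obtain r T R where r: "0 < r" and T: "0 \<le> T" and R: "0 < R" and sol: "\<And>y. y \<in> ball x0 r \<Longrightarrow>
     \<exists>u. solves_from f y u {0..} \<and> (\<forall>t\<ge>0. norm (u t) \<le> R) \<and> (\<forall>t\<ge>T. norm (u t) \<le> \<rho>)"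
    using solutions_trapped_nearby[OF lip stable x0 \<rho>(1)] by blast
  obtain L c' where L: "0 \<le> L" "0 \<le> c'" "\<And>u u1 u2 u3. norm u \<le> R \<Longrightarrow> norm u1 \<le> R \<Longrightarrow> norm u2 \<le> R \<Longrightarrow>
     norm u3 \<le> R \<Longrightarrow> norm (f u3 - f u1 - f u2 + f u) \<le>
       L * norm (u3 - u1 - u2 + u) + c' * (norm (u1 - u) * norm (u2 - u))"
    using four_point_bound_on_bounded[OF smooth van f R] by blast
  obtain C where C: "0 \<le> C" "\<And>(z :: real \<Rightarrow> real^'n) z' q t.
     (\<And>s. 0 \<le> s \<Longrightarrow> (z has_vector_derivative z' s) (at s within {0..})) \<Longrightarrow>
     (\<And>s. s \<in> {0..T} \<Longrightarrow> norm (z' s) \<le> L * norm (z s) + q) \<Longrightarrow>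
     (\<And>s. T \<le> s \<Longrightarrow> B (z s) (z' s) \<le> - \<beta> * B (z s) (z s) + q * norm (z s) * exp (- 2 * \<beta> * s)) \<Longrightarrow>
     0 \<le> q \<Longrightarrow> 0 \<le> t \<Longrightarrow> norm (z t) \<le> C * exp (- \<beta> * t) * (norm (z 0) + q)"
    using eventually_forced_decay[OF B(1-3) \<beta>(1) T L(1)] by blast
  \<comment> \<open>In the four-solution estimate, k bounds the product of the two first differences, at the doubled
      rate; k = 0 is the case without forcing.\<close>
  define admissible where "admissible u \<longleftrightarrow> (\<forall>t\<ge>0. (u has_vector_derivative f (u t)) (at t within {0..})) \<and>
     (\<forall>t\<ge>0. norm (u t) \<le> R) \<and> (\<forall>t\<ge>T. norm (u t) \<le> \<rho>)" for u :: "real \<Rightarrow> real^'n"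
  have four: "norm (u3 t - u1 t - u2 t + u t)
      \<le> C * exp (- \<beta> * t) * (norm (u3 0 - u1 0 - u2 0 + u 0) + (c + c') * k)"
    if u: "admissible u" "admissible u1" "admissible u2" "admissible u3" and t: "0 \<le> t" and k: "0 \<le> k"
      and prod: "\<And>s. 0 \<le> s \<Longrightarrow> norm (u1 s - u s) * norm (u2 s - u s) \<le> k * exp (- 2 * \<beta> * s)"
    for u u1 u2 u3 t k
  proof (rule C(2)[where z' = "\<lambda>s. f (u3 s) - f (u1 s) - f (u2 s) + f (u s)"
        and z = "\<lambda>s. u3 s - u1 s - u2 s + u s"])
    show "((\<lambda>s. u3 s - u1 s - u2 s + u s) has_vector_derivative
        f (u3 s) - f (u1 s) - f (u2 s) + f (u s)) (at s within {0..})" if "0 \<le> s" for s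
      using u that unfolding admissible_def
      by (intro has_vector_derivative_add has_vector_derivative_diff) auto
    show "norm (f (u3 s) - f (u1 s) - f (u2 s) + f (u s))
        \<le> L * norm (u3 s - u1 s - u2 s + u s) + (c + c') * k" if s: "s \<in> {0..T}" for s
    proof -
      have "norm (u1 s - u s) * norm (u2 s - u s) \<le> k * exp (- 2 * \<beta> * s)" using prod s by simp
      also have "\<dots> \<le> k * 1" using k s \<beta> by (intro mult_left_mono) auto
      finally have "c' * (norm (u1 s - u s) * norm (u2 s - u s)) \<le> c' * k"
        using L(2) by (simp add: mult_left_mono)
      also have "\<dots> \<le> (c + c') * k" using \<rho>(2) k by (intro mult_right_mono) auto
      finally show ?thesis
        using L(3)[of "u s" "u1 s" "u2 s" "u3 s"] u s unfolding admissible_def by fastforce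
    qed
    show "B (u3 s - u1 s - u2 s + u s) (f (u3 s) - f (u1 s) - f (u2 s) + f (u s))
        \<le> - \<beta> * B (u3 s - u1 s - u2 s + u s) (u3 s - u1 s - u2 s + u s)
          + (c + c') * k * norm (u3 s - u1 s - u2 s + u s) * exp (- 2 * \<beta> * s)" if s: "T \<le> s" for s
    proof -
      let ?n = "norm (u3 s - u1 s - u2 s + u s)"
      have "norm (u1 s - u s) * norm (u2 s - u s) \<le> k * exp (- 2 * \<beta> * s)" using prod s T by simp
      then have "c * (norm (u1 s - u s) * norm (u2 s - u s)) \<le> (c + c') * (k * exp (- 2 * \<beta> * s))"
        using \<rho>(2) L(2) k by (intro mult_mono[of c "c + c'"]) auto
      then have "c * (norm (u1 s - u s) * norm (u2 s - u s)) * ?n \<le> (c + c') * (k * exp (- 2 * \<beta> * s)) * ?n"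
        by (rule mult_right_mono) simp
      also have "\<dots> = (c + c') * k * ?n * exp (- 2 * \<beta> * s)" by (simp only: mult_ac)
      finally show ?thesis
        using \<rho>(3)[of "u s" "u1 s" "u2 s" "u3 s"] u s unfolding admissible_def by fastforce
    qed
    show "0 \<le> (c + c') * k" using \<rho>(2) L(2) k by simp
    show "0 \<le> t" by (rule t)
  qed
  obtain U where U: "\<And>y. y \<in> ball x0 r \<Longrightarrow> solves_from f y (U y) {0..}"
    "\<And>y t. y \<in> ball x0 r \<Longrightarrow> 0 \<le> t \<Longrightarrow> norm (U y t) \<le> R"
    "\<And>y t. y \<in> ball x0 r \<Longrightarrow> T \<le> t \<Longrightarrow> norm (U y t) \<le> \<rho>"
    using sol by metis
  have adm: "admissible (U y)" if "y \<in> ball x0 r" for y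
    unfolding admissible_def using U that solves_from_derivative[OF U(1)[OF that]] by auto
  have adm0: "admissible (\<lambda>_. 0)"
    unfolding admissible_def using R \<rho>(1) F0 by (auto simp: f)
  have U0: "U y 0 = y" if "y \<in> ball x0 r" for y using solves_from_initial[OF U(1)[OF that]] .
  have flow: "flow f t y = U y t" if "y \<in> ball x0 r" "0 \<le> t" for y t
    using flow_eq_solution[OF lip U(1)] that by blast
  have size: "norm (U y t) \<le> C * exp (- \<beta> * t) * norm y" if y: "y \<in> ball x0 r" and t: "0 \<le> t" for y t
    using four[OF adm0 adm0 adm0 adm[OF y] t, of 0] by (simp add: U0[OF y])
  have diff: "norm (U y t - U y' t) \<le> C * exp (- \<beta> * t) * norm (y - y')"
    if y: "y \<in> ball x0 r" and y': "y' \<in> ball x0 r" and t: "0 \<le> t" for y y' t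
    using four[OF adm[OF y'] adm[OF y'] adm[OF y'] adm[OF y] t, of 0] by (simp add: U0[OF y] U0[OF y'])
  define D where "D = C + C * ((c + c') * C\<^sup>2)"
  have D: "C \<le> D" "C * ((c + c') * C\<^sup>2) \<le> D" using C(1) \<rho>(2) L(2) by (auto simp: D_def)
  have weaken: "C * exp (- \<beta> * t) * n \<le> D * exp (- \<beta> * t) * n" if "0 \<le> n" for t n
    using D(1) that by (intro mult_right_mono) auto
  show thesis
  proof (rule that[OF r, of D])
    show "0 \<le> D" using D C(1) by linarith
    show "norm (flow f t y) \<le> D * exp (- \<beta> * t) * norm y" if "y \<in> ball x0 r" "0 \<le> t" for y t
      unfolding flow[OF that] using size[OF that] weaken[OF norm_ge_zero] by (rule order_trans)
    show "norm (flow f t y - flow f t y') \<le> D * exp (- \<beta> * t) * norm (y - y')"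
      if "y \<in> ball x0 r" "y' \<in> ball x0 r" "0 \<le> t" for y y' t
      unfolding flow[OF that(1,3)] flow[OF that(2,3)]
      using diff[OF that] weaken[OF norm_ge_zero] by (rule order_trans)
    show "norm (flow f t (y + a + b) - flow f t (y + a) - flow f t (y + b) + flow f t y)
         \<le> D * exp (- \<beta> * t) * (norm a * norm b)"
      if y: "y \<in> ball x0 r" "y + a \<in> ball x0 r" "y + b \<in> ball x0 r" "y + a + b \<in> ball x0 r"
        and t: "0 \<le> t" for y a b t
    proof -
      define k where "k = C\<^sup>2 * (norm a * norm b)"
      have "norm (U (y + a + b) t - U (y + a) t - U (y + b) t + U y t)
        \<le> C * exp (- \<beta> * t) * (norm (U (y + a + b) 0 - U (y + a) 0 - U (y + b) 0 + U y 0) + (c + c') * k)"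
      proof (rule four[OF adm[OF y(1)] adm[OF y(2)] adm[OF y(3)] adm[OF y(4)] t])
        show "0 \<le> k" by (simp add: k_def)
        fix s :: real assume s: "0 \<le> s"
        have "norm (U (y + a) s - U y s) * norm (U (y + b) s - U y s)
            \<le> (C * exp (- \<beta> * s) * norm a) * (C * exp (- \<beta> * s) * norm b)"
          using diff[OF y(2) y(1) s] diff[OF y(3) y(1) s] C(1) by (intro mult_mono) auto
        also have "\<dots> = k * (exp (- \<beta> * s) * exp (- \<beta> * s))"
          by (simp only: k_def power2_eq_square mult_ac)
        also have "\<dots> = k * exp (- 2 * \<beta> * s)" by (simp add: mult_exp_exp)
        finally show "norm (U (y + a) s - U y s) * norm (U (y + b) s - U y s) \<le> k * exp (- 2 * \<beta> * s)" .
      qed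
      also have "\<dots> = C * ((c + c') * C\<^sup>2) * (exp (- \<beta> * t) * (norm a * norm b))"
        unfolding U0[OF y(1)] U0[OF y(2)] U0[OF y(3)] U0[OF y(4)] by (simp add: k_def)
      also have "\<dots> \<le> D * (exp (- \<beta> * t) * (norm a * norm b))"
        using D(2) by (intro mult_right_mono) auto
      finally show ?thesis
        unfolding flow[OF y(1) t] flow[OF y(2) t] flow[OF y(3) t] flow[OF y(4) t] by (simp only: mult.assoc)
    qed
    show "ball x0 r \<subseteq> domain_of_attraction f"
    proof
      fix y assume y: "y \<in> ball x0 r"
      have "((\<lambda>t. C * exp (- \<beta> * t) * norm y) \<longlongrightarrow> 0) at_top"
        using \<beta>(1) by real_asymp
      moreover have "eventually (\<lambda>t. norm (U y t) \<le> C * exp (- \<beta> * t) * norm y) at_top"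
        using eventually_ge_at_top[of 0] by eventually_elim (rule size[OF y])
      ultimately have "(U y \<longlongrightarrow> 0) at_top" by (rule Lim_null_comparison[rotated])
      then show "y \<in> domain_of_attraction f"
        using U(1)[OF y] unfolding domain_of_attraction_def by blast
    qed
  qed
qed

section \<open>Decay of the nonlinear part along trajectories\<close>

lemma exp_decay_integral_bound:
  fixes g :: "real \<Rightarrow> 'b::euclidean_space"
  assumes cont: "continuous_on {a..} g" and bd: "\<And>t. a \<le> t \<Longrightarrow> norm (g t) \<le> K * exp (- c * t)"
    and c: "0 < c"
  shows "g integrable_on {a..}" "norm (integral {a..} g) \<le> K * exp (- c * a) / c"
proof -
  have hi: "((\<lambda>t. K * exp (- c * t)) has_integral K * (exp (- c * a) / c)) {a..}"
    using has_integral_exp_minus_to_infinity[OF c] by (rule has_integral_mult_right)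
  show int: "g integrable_on {a..}"
  proof (rule measurable_bounded_by_integrable_imp_integrable)
    show "g \<in> borel_measurable (lebesgue_on {a..})"
      by (rule continuous_imp_measurable_on_sets_lebesgue[OF cont]) simp
    show "(\<lambda>t. K * exp (- c * t)) integrable_on {a..}" using hi by blast
  qed (use bd in auto)
  have "norm (integral {a..} g) \<le> integral {a..} (\<lambda>t. K * exp (- c * t))"
    by (rule integral_norm_bound_integral[OF int]) (use hi bd in auto)
  also have "\<dots> = K * exp (- c * a) / c" using integral_unique[OF hi] by simp
  finally show "norm (integral {a..} g) \<le> K * exp (- c * a) / c" .
qed

lemma linear_form_linear: "linear (linear_form w)"
  by (rule linearI)
    (simp_all add: linear_form_def sum.distrib sum_distrib_left algebra_simps scaleR_conv_of_real[where 'a = complex])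

lemma linear_form_left_eigenvector:
  assumes "left_eigenvector_of A \<mu> w"
  shows "linear_form w (A *v x) = \<mu> * linear_form w x"
proof -
  have w: "(\<Sum>i\<in>UNIV. w $ i * complex_of_real (A $ i $ j)) = \<mu> * w $ j" for j
  proof -
    have "(w v* map_matrix complex_of_real A) $ j = (\<mu> *s w) $ j"
      using assms unfolding left_eigenvector_of_def by simp
    then show ?thesis by (simp add: vector_matrix_mult_def map_matrix_def)
  qed
  have "linear_form w (A *v x) = (\<Sum>i\<in>UNIV. \<Sum>j\<in>UNIV. w $ i * complex_of_real (A $ i $ j) * complex_of_real (x $ j))"
    by (simp add: linear_form_def matrix_vector_mult_def sum_distrib_left mult.assoc)
  also have "\<dots> = (\<Sum>j\<in>UNIV. (\<Sum>i\<in>UNIV. w $ i * complex_of_real (A $ i $ j)) * complex_of_real (x $ j))"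
    by (subst sum.swap) (simp add: sum_distrib_right)
  also have "\<dots> = \<mu> * linear_form w x"
    by (simp add: w linear_form_def sum_distrib_left mult.assoc)
  finally show ?thesis .
qed

lemma exp_powr: "exp x powr y = exp (x * y)" for x y :: real
  by (simp add: powr_def mult.commute)

text \<open>At time t all points involved lie in a ball of radius \<sigma>(t), a multiple of exp(-\<beta> t). Inserting this
  radius and the estimates for the flow into the bounds for F gives the rate p \<beta> in each case:
  (p - 1) + 1 for the Lipschitz part and (p - 2) + 2 for the second differences.\<close>
lemma nonlinearity_along_flow_estimates:
  fixes A :: "real^'n^'n" and F :: "real^'n \<Rightarrow> real^'n"
  assumes smooth: "smooth_on UNIV F" and van: "vanishes_to_order F p" and p: "1 < p" and F0: "F 0 = 0"
    and f: "\<And>x. f x = A *v x + F x" and lip: "lipschitz_on_bounded f"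
    and ev: "\<And>z. eigenvalue_of A z \<Longrightarrow> Re z \<le> - \<alpha>" and \<beta>: "0 < \<beta>" "\<beta> < \<alpha>"
    and stable: "lyapunov_stable f" and x0: "x0 \<in> domain_of_attraction f"
  obtains r K where "0 < r" "0 \<le> K" "ball x0 r \<subseteq> domain_of_attraction f"
    "\<And>y t. y \<in> ball x0 r \<Longrightarrow> 0 \<le> t \<Longrightarrow> norm (F (flow f t y)) \<le> K * norm y powr p * exp (- p * \<beta> * t)"
    "\<And>y y' t. y \<in> ball x0 r \<Longrightarrow> y' \<in> ball x0 r \<Longrightarrow> 0 \<le> t \<Longrightarrow>
       norm (F (flow f t y) - F (flow f t y')) \<le> K * norm (y - y') * exp (- p * \<beta> * t)"
    "\<And>y a b t. y \<in> ball x0 r \<Longrightarrow> y + a \<in> ball x0 r \<Longrightarrow> y + b \<in> ball x0 r \<Longrightarrow> y + a + b \<in> ball x0 r \<Longrightarrow>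
       0 \<le> t \<Longrightarrow> norm (F (flow f t (y + a + b)) - F (flow f t (y + a)) - F (flow f t (y + b)) + F (flow f t y))
         \<le> K * (norm a * norm b) * exp (- p * \<beta> * t)"
proof -
  obtain r C where r: "0 < r" and C: "0 \<le> C" and dom: "ball x0 r \<subseteq> domain_of_attraction f"
    and size: "\<And>y t. y \<in> ball x0 r \<Longrightarrow> 0 \<le> t \<Longrightarrow> norm (flow f t y) \<le> C * exp (- \<beta> * t) * norm y"
    and diff: "\<And>y y' t. y \<in> ball x0 r \<Longrightarrow> y' \<in> ball x0 r \<Longrightarrow> 0 \<le> t \<Longrightarrow>
       norm (flow f t y - flow f t y') \<le> C * exp (- \<beta> * t) * norm (y - y')"
    and sec: "\<And>y a b t. y \<in> ball x0 r \<Longrightarrow> y + a \<in> ball x0 r \<Longrightarrow> y + b \<in> ball x0 r \<Longrightarrow> y + a + b \<in> ball x0 r \<Longrightarrow>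
       0 \<le> t \<Longrightarrow> norm (flow f t (y + a + b) - flow f t (y + a) - flow f t (y + b) + flow f t y)
         \<le> C * exp (- \<beta> * t) * (norm a * norm b)"
    using flow_estimates_near_attracted_point[OF smooth van p F0 f lip ev \<beta> stable x0] by blast
  define m where "m = norm x0 + r"
  have m: "0 < m" using r by (simp add: m_def add_nonneg_pos)
  have ym: "norm y \<le> m" if "y \<in> ball x0 r" for y
    using that norm_triangle_ineq2[of y x0] by (simp add: m_def dist_norm norm_minus_commute)
  \<comment> \<open>A bound for three times the norms of the points at all times; C + 1 instead of C makes it positive.\<close>
  define S where "S = 3 * ((C + 1) * m)"
  have S: "0 < S" using C m by (simp add: S_def)
  obtain C0 where C0: "0 \<le> C0" "\<And>\<sigma> x. 0 < \<sigma> \<Longrightarrow> \<sigma> \<le> S \<Longrightarrow> norm x \<le> \<sigma> \<Longrightarrow> norm (F x) \<le> C0 * \<sigma> powr p"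
    using vanishes_to_orderD[OF van S] by blast
  obtain C4 where C4: "0 \<le> C4" "\<And>\<sigma> u u1 u2 u3. 0 < \<sigma> \<Longrightarrow> \<sigma> \<le> S \<Longrightarrow>
     3 * norm u \<le> \<sigma> \<Longrightarrow> 3 * norm u1 \<le> \<sigma> \<Longrightarrow> 3 * norm u2 \<le> \<sigma> \<Longrightarrow> 3 * norm u3 \<le> \<sigma> \<Longrightarrow>
     norm (F u3 - F u1 - F u2 + F u) \<le> C4 * \<sigma> powr (p - 1) * norm (u3 - u1 - u2 + u)
       + C4 * \<sigma> powr (p - 2) * norm (u1 - u) * norm (u2 - u)"
    using vanishes_to_order_four_points[OF smooth van S] by blast
  define e where "e t = exp (- \<beta> * t)" for t
  have e: "0 < e t" for t by (simp add: e_def)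
  have e1: "e t \<le> 1" if "0 \<le> t" for t using that \<beta> by (simp add: e_def)
  have ep: "e t powr q = exp (- q * \<beta> * t)" for t q by (simp add: e_def exp_powr mult_ac)
  have ep1: "e t powr (p - 1) * e t = exp (- p * \<beta> * t)" for t
    using e[of t] powr_add[of "e t" "p - 1" 1] ep[of t p] by simp
  have ep2: "e t powr (p - 2) * (e t * e t) = exp (- p * \<beta> * t)" for t
    using e[of t] powr_add[of "e t" "p - 2" 2] ep[of t p] by (simp add: power2_eq_square)
  define \<sigma> where "\<sigma> t = S * e t" for t
  have \<sigma>: "0 < \<sigma> t" for t using S e by (simp add: \<sigma>_def)
  have \<sigma>S: "\<sigma> t \<le> S" if "0 \<le> t" for t using e1[OF that] S by (simp add: \<sigma>_def)
  have flow\<sigma>: "3 * norm (flow f t y) \<le> \<sigma> t" if y: "y \<in> ball x0 r" and t: "0 \<le> t" for y t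
  proof -
    have "norm (flow f t y) \<le> C * e t * norm y" using size[OF y t] by (simp add: e_def)
    also have "\<dots> \<le> (C + 1) * e t * m" using C e[of t] ym[OF y] by (intro mult_mono) auto
    finally have "3 * norm (flow f t y) \<le> 3 * ((C + 1) * e t * m)" by simp
    then show ?thesis unfolding \<sigma>_def S_def by (simp only: mult_ac)
  qed
  define K0 where "K0 = C0 * (C + 1) powr p"
  define K1 where "K1 = C4 * S powr (p - 1) * C"
  define K2 where "K2 = C4 * S powr (p - 2) * C\<^sup>2"
  have K: "0 \<le> K0" "0 \<le> K1" "0 \<le> K2" using C0 C4 C by (auto simp: K0_def K1_def K2_def)
  show thesis
  proof (rule that[OF r, of "K0 + K1 + K2"])
    show "0 \<le> K0 + K1 + K2" using K by simp
    show "ball x0 r \<subseteq> domain_of_attraction f" by (rule dom)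
    show "norm (F (flow f t y)) \<le> (K0 + K1 + K2) * norm y powr p * exp (- p * \<beta> * t)"
      if y: "y \<in> ball x0 r" and t: "0 \<le> t" for y t
    proof (cases "y = 0")
      case True
      then have "flow f t y = 0" using size[OF y t] by simp
      then show ?thesis using True F0 K by simp
    next
      case False
      define s where "s = (C + 1) * norm y * e t"
      have s0: "0 < s" using False C e by (simp add: s_def)
      have "(C + 1) * norm y * e t \<le> (C + 1) * m * 1"
        using ym[OF y] e1[OF t] e[of t] C m by (intro mult_mono) auto
      also have "\<dots> \<le> S" using C m by (simp add: S_def)
      finally have sS: "s \<le> S" by (simp add: s_def)
      have "norm (flow f t y) \<le> C * e t * norm y" using size[OF y t] by (simp add: e_def)
      also have "\<dots> \<le> s" using e[of t] by (simp add: s_def algebra_simps)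
      finally have "norm (F (flow f t y)) \<le> C0 * s powr p" using C0(2)[OF s0 sS] by blast
      also have "s powr p = (C + 1) powr p * norm y powr p * exp (- p * \<beta> * t)"
        using C e[of t] by (simp add: s_def powr_mult ep)
      also have "C0 * \<dots> = K0 * (norm y powr p * exp (- p * \<beta> * t))" by (simp only: K0_def mult.assoc)
      also have "\<dots> \<le> (K0 + K1 + K2) * (norm y powr p * exp (- p * \<beta> * t))"
        using K by (intro mult_right_mono) auto
      finally show ?thesis by (simp only: mult.assoc)
    qed
    show "norm (F (flow f t y) - F (flow f t y')) \<le> (K0 + K1 + K2) * norm (y - y') * exp (- p * \<beta> * t)"
      if y: "y \<in> ball x0 r" and y': "y' \<in> ball x0 r" and t: "0 \<le> t" for y y' t
    proof -
      have "norm (F (flow f t y) - F (flow f t y')) \<le> C4 * \<sigma> t powr (p - 1) * norm (flow f t y - flow f t y')"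
        using C4(2)[OF \<sigma> \<sigma>S[OF t] flow\<sigma>[OF y' t] flow\<sigma>[OF y' t] flow\<sigma>[OF y' t] flow\<sigma>[OF y t]] by simp
      also have "\<dots> \<le> C4 * \<sigma> t powr (p - 1) * (C * e t * norm (y - y'))"
        using diff[OF y y' t] C4(1) by (intro mult_left_mono) (auto simp: e_def)
      also have "\<sigma> t powr (p - 1) = S powr (p - 1) * e t powr (p - 1)"
        unfolding \<sigma>_def using S e[of t] by (simp add: powr_mult)
      also have "C4 * (S powr (p - 1) * e t powr (p - 1)) * (C * e t * norm (y - y'))
          = K1 * (norm (y - y') * (e t powr (p - 1) * e t))" by (simp only: K1_def mult_ac)
      also have "\<dots> \<le> (K0 + K1 + K2) * (norm (y - y') * (e t powr (p - 1) * e t))"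
        using K e[of t] by (intro mult_right_mono) auto
      finally show ?thesis unfolding ep1 by (simp only: mult.assoc)
    qed
    show "norm (F (flow f t (y + a + b)) - F (flow f t (y + a)) - F (flow f t (y + b)) + F (flow f t y))
         \<le> (K0 + K1 + K2) * (norm a * norm b) * exp (- p * \<beta> * t)"
      if y: "y \<in> ball x0 r" "y + a \<in> ball x0 r" "y + b \<in> ball x0 r" "y + a + b \<in> ball x0 r"
        and t: "0 \<le> t" for y a b t
    proof -
      define u u1 u2 u3 where "u = flow f t y" and "u1 = flow f t (y + a)"
        and "u2 = flow f t (y + b)" and "u3 = flow f t (y + a + b)"
      note u = u_def u1_def u2_def u3_def
      have d1: "norm (u1 - u) \<le> C * e t * norm a" using diff[OF y(2,1) t] by (simp add: u e_def)
      have d2: "norm (u2 - u) \<le> C * e t * norm b" using diff[OF y(3,1) t] by (simp add: u e_def)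
      have d3: "norm (u3 - u1 - u2 + u) \<le> C * e t * (norm a * norm b)"
        using sec[OF y t] by (simp add: u e_def)
      have "norm (F u3 - F u1 - F u2 + F u) \<le> C4 * \<sigma> t powr (p - 1) * norm (u3 - u1 - u2 + u)
       + C4 * \<sigma> t powr (p - 2) * norm (u1 - u) * norm (u2 - u)"
        unfolding u by (rule C4(2)[OF \<sigma> \<sigma>S[OF t]]; intro flow\<sigma> y t)
      also have "\<dots> \<le> C4 * \<sigma> t powr (p - 1) * (C * e t * (norm a * norm b))
       + C4 * \<sigma> t powr (p - 2) * (C * e t * norm a) * (C * e t * norm b)"
        using d1 d2 d3 C4(1) C e[of t] by (intro add_mono mult_mono) auto
      also have "\<sigma> t powr (p - 1) = S powr (p - 1) * e t powr (p - 1)"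
        unfolding \<sigma>_def using S e[of t] by (simp add: powr_mult)
      also have "\<sigma> t powr (p - 2) = S powr (p - 2) * e t powr (p - 2)"
        unfolding \<sigma>_def using S e[of t] by (simp add: powr_mult)
      also have "C4 * (S powr (p - 1) * e t powr (p - 1)) * (C * e t * (norm a * norm b))
          + C4 * (S powr (p - 2) * e t powr (p - 2)) * (C * e t * norm a) * (C * e t * norm b)
        = K1 * (norm a * norm b * (e t powr (p - 1) * e t))
          + K2 * (norm a * norm b * (e t powr (p - 2) * (e t * e t)))"
        by (simp only: K1_def K2_def power2_eq_square mult_ac)
      also have "\<dots> = (K1 + K2) * (norm a * norm b * exp (- p * \<beta> * t))"
        unfolding ep1 ep2 by (simp only: distrib_right)
      also have "\<dots> \<le> (K0 + K1 + K2) * (norm a * norm b * exp (- p * \<beta> * t))"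
        using K by (intro mult_right_mono) auto
      finally show ?thesis unfolding u by (simp only: mult.assoc)
    qed
  qed
qed

section \<open>The eigenfunction\<close>

lemma zero_in_domain_of_attraction: "f 0 = 0 \<Longrightarrow> 0 \<in> domain_of_attraction f"
  unfolding domain_of_attraction_def solves_from_def by (auto intro!: exI[of _ "\<lambda>_. 0"])

lemma flow_in_domain_of_attraction:
  assumes f: "lipschitz_on_bounded f" and x: "x \<in> domain_of_attraction f" and s: "0 \<le> s"
  shows "flow f s x \<in> domain_of_attraction f" "0 \<le> t \<Longrightarrow> flow f t (flow f s x) = flow f (s + t) x"
proof -
  let ?u = "\<lambda>t. flow f t x"
  have shift: "solves_from f (?u s) (\<lambda>t. ?u (s + t)) {0..}"
    using solves_from_shift[OF domain_of_attraction_flow(1)[OF f x] s] .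
  have "filterlim (\<lambda>t. s + t) at_top at_top"
    by (rule filterlim_tendsto_add_at_top[OF tendsto_const filterlim_ident])
  then have "((\<lambda>t. ?u (s + t)) \<longlongrightarrow> 0) at_top"
    by (rule filterlim_compose[OF domain_of_attraction_flow(2)[OF f x]])
  then show "flow f s x \<in> domain_of_attraction f"
    using shift unfolding domain_of_attraction_def by blast
  show "flow f t (flow f s x) = flow f (s + t) x" if "0 \<le> t"
    using flow_eq_solution[OF f shift that] .
qed

text \<open>The weight exp(-\<mu> t) turns the rate p \<beta> of the nonlinear part into the rate c = Re \<mu> + p \<beta> of the
  integrand. Each bound for F along the flow becomes, up to a constant, the same bound for the integral.\<close>
lemma decaying_integral_eigenfunction:
  fixes A :: "real^'n^'n" and f F :: "real^'n \<Rightarrow> real^'n" and \<mu> :: complex and w :: "complex^'n"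
  defines "G \<equiv> \<lambda>x t. exp (- \<mu> * complex_of_real t) * linear_form w (F (flow f t x))"
  assumes smooth: "smooth_on UNIV F" and van: "vanishes_to_order F p" and p: "2 \<le> p" and F0: "F 0 = 0"
    and f: "\<And>x. f x = A *v x + F x" and lip: "lipschitz_on_bounded f"
    and ev: "\<And>z. eigenvalue_of A z \<Longrightarrow> Re z \<le> - \<alpha>" and \<beta>: "0 < \<beta>" "\<beta> < \<alpha>"
    and gap: "0 < Re \<mu> + p * \<beta>"
    and stable: "lyapunov_stable f" and w: "left_eigenvector_of A \<mu> w"
  shows "\<And>x. x \<in> domain_of_attraction f \<Longrightarrow> G x integrable_on {0..}"
    "Ck_on 1 (domain_of_attraction f) (\<lambda>x. linear_form w x + integral {0..} (G x))"
    "\<And>x. x \<in> domain_of_attraction f \<Longrightarrow>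
       frechet_derivative (\<lambda>x. linear_form w x + integral {0..} (G x)) (at x) (f x)
         = \<mu> * (linear_form w x + integral {0..} (G x))"
    "purely_nonlinear (\<lambda>x. integral {0..} (G x))"
proof -
  let ?D = "domain_of_attraction f"
  define c where "c = Re \<mu> + p * \<beta>"
  have c: "0 < c" using gap by (simp add: c_def)
  have p1: "1 < p" using p by simp
  have bl: "bounded_linear (linear_form w)"
    using linear_form_linear linear_conv_bounded_linear by blast
  obtain W where W: "0 \<le> W" "\<And>x. norm (linear_form w x) \<le> W * norm x"
    using bounded_linear.nonneg_bounded[OF bl] by (auto simp: mult.commute)
  note lin = linear_add[OF linear_form_linear[of w]] linear_diff[OF linear_form_linear[of w]]
  define E where "E t = exp (- \<mu> * complex_of_real t)" for t
  have weight: "norm (E t * linear_form w v) \<le> W * k * exp (- c * t)"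
    if "norm v \<le> k * exp (- p * \<beta> * t)" for t v k
  proof -
    have "norm (E t * linear_form w v) = exp (- Re \<mu> * t) * norm (linear_form w v)"
      by (simp add: E_def norm_mult norm_exp_eq_Re)
    also have "\<dots> \<le> exp (- Re \<mu> * t) * (W * (k * exp (- p * \<beta> * t)))"
      using W that order_trans[OF W(2) mult_left_mono[OF that W(1)]] by (intro mult_left_mono) auto
    also have "\<dots> = W * k * (exp (- Re \<mu> * t) * exp (- p * \<beta> * t))" by (simp only: mult_ac)
    also have "exp (- Re \<mu> * t) * exp (- p * \<beta> * t) = exp (- c * t)"
      by (simp add: mult_exp_exp c_def algebra_simps)
    finally show ?thesis .
  qed
  have GE: "G x t = E t * linear_form w (F (flow f t x))" for x t by (simp only: G_def E_def)
  have contE: "continuous_on T E" for T unfolding E_def by (intro continuous_intros)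
  have contG: "continuous_on {0..} (G x)" if x: "x \<in> ?D" for x
  proof -
    have "continuous_on {0..} (\<lambda>t. flow f t x)"
      by (rule solves_from_continuous_on[OF domain_of_attraction_flow(1)[OF lip x]])
    then have "continuous_on {0..} (\<lambda>t. linear_form w (F (flow f t x)))"
      by (intro bounded_linear.continuous_on[OF bl]
          continuous_on_compose2[OF smooth_on_continuous_on[OF smooth]]) auto
    then show ?thesis unfolding GE[abs_def] by (intro continuous_on_mult contE)
  qed
  note est = nonlinearity_along_flow_estimates[OF smooth van p1 F0 f lip ev \<beta> stable]
  have size: "\<exists>r>0. \<exists>K\<ge>0. ball x0 r \<subseteq> ?D \<and> (\<forall>y\<in>ball x0 r. \<forall>t\<ge>0.
      norm (F (flow f t y)) \<le> K * norm y powr p * exp (- p * \<beta> * t))" if x0: "x0 \<in> ?D" for x0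
  proof (rule est[OF _ x0])
    fix r K
    assume "0 < r" "0 \<le> K" "ball x0 r \<subseteq> ?D" "\<And>y t. y \<in> ball x0 r \<Longrightarrow> 0 \<le> t \<Longrightarrow>
      norm (F (flow f t y)) \<le> K * norm y powr p * exp (- p * \<beta> * t)"
    then show ?thesis by (intro exI[of _ r] exI[of _ K] conjI ballI allI impI)
  qed
  have Gbound: "\<exists>K. \<forall>t\<ge>0. norm (G x t) \<le> K * exp (- c * t)" if x: "x \<in> ?D" for x
  proof -
    obtain r K where "0 < r" "\<forall>y\<in>ball x r. \<forall>t\<ge>0.
        norm (F (flow f t y)) \<le> K * norm y powr p * exp (- p * \<beta> * t)"
      using size[OF x] by blast
    then have "\<forall>t\<ge>0. norm (G x t) \<le> W * (K * norm x powr p) * exp (- c * t)"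
      unfolding GE by (intro allI impI weight) auto
    then show ?thesis by blast
  qed
  show int: "G x integrable_on {0..}" if x: "x \<in> ?D" for x
    using Gbound[OF x] exp_decay_integral_bound(1)[OF contG[OF x] _ c] by blast
  define h where "h x = integral {0..} (G x)" for x
  have h_size: "norm (h y) \<le> W * (K * norm y powr p) / c"
    if y: "y \<in> ?D" and bd: "\<And>t. 0 \<le> t \<Longrightarrow> norm (F (flow f t y)) \<le> K * norm y powr p * exp (- p * \<beta> * t)" for y K
  proof -
    have "norm (G y t) \<le> W * (K * norm y powr p) * exp (- c * t)" if "0 \<le> t" for t
      using weight[OF bd[OF that]] by (simp only: GE)
    from exp_decay_integral_bound(2)[OF contG[OF y] this c] show ?thesis by (simp add: h_def)
  qed
  have h_lip: "norm (h y - h y') \<le> W * (K * norm (y - y')) / c"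
    if y: "y \<in> ?D" "y' \<in> ?D" and bd: "\<And>t. 0 \<le> t \<Longrightarrow>
       norm (F (flow f t y) - F (flow f t y')) \<le> K * norm (y - y') * exp (- p * \<beta> * t)" for y y' K
  proof -
    have "norm (G y t - G y' t) \<le> W * (K * norm (y - y')) * exp (- c * t)" if "0 \<le> t" for t
      using weight[OF bd[OF that]] by (simp add: GE lin right_diff_distrib)
    from exp_decay_integral_bound(2)[OF continuous_on_diff[OF contG[OF y(1)] contG[OF y(2)]] this c]
    show ?thesis unfolding h_def by (simp add: integral_diff int y)
  qed
  have h_sec: "norm (h y3 - h y1 - h y2 + h y) \<le> W * k / c"
    if y: "y \<in> ?D" "y1 \<in> ?D" "y2 \<in> ?D" "y3 \<in> ?D" and bd: "\<And>t. 0 \<le> t \<Longrightarrow>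
       norm (F (flow f t y3) - F (flow f t y1) - F (flow f t y2) + F (flow f t y)) \<le> k * exp (- p * \<beta> * t)"
    for y y1 y2 y3 k
  proof -
    have "norm (G y3 t - G y1 t - G y2 t + G y t) \<le> W * k * exp (- c * t)" if "0 \<le> t" for t
      using weight[OF bd[OF that]] 
      by (simp add: GE lin right_diff_distrib distrib_left)
    from exp_decay_integral_bound(2)[OF continuous_on_add[OF continuous_on_diff[OF continuous_on_diff[OF
            contG[OF y(4)] contG[OF y(2)]] contG[OF y(3)]] contG[OF y(1)]] this c]
    have "norm (integral {0..} (\<lambda>t. G y3 t - G y1 t - G y2 t + G y t)) \<le> W * k / c" by simp
    also have "integral {0..} (\<lambda>t. G y3 t - G y1 t - G y2 t + G y t) = h y3 - h y1 - h y2 + h y"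
      unfolding h_def by (simp add: integral_diff integral_add integrable_diff int y)
    finally show ?thesis .
  qed
  define \<phi> where "\<phi> x = linear_form w x + h x" for x
  have \<phi>_C1: "Ck_on 1 ?D \<phi>"
  proof (rule bounded_second_differences_imp_C1)
    fix x0 assume x0: "x0 \<in> ?D"
    obtain r K where r: "0 < r" and K: "0 \<le> K" and dom: "ball x0 r \<subseteq> ?D"
      and "\<And>y t. y \<in> ball x0 r \<Longrightarrow> 0 \<le> t \<Longrightarrow>
        norm (F (flow f t y)) \<le> K * norm y powr p * exp (- p * \<beta> * t)"
      and l: "\<And>y y' t. y \<in> ball x0 r \<Longrightarrow> y' \<in> ball x0 r \<Longrightarrow> 0 \<le> t \<Longrightarrow>
       norm (F (flow f t y) - F (flow f t y')) \<le> K * norm (y - y') * exp (- p * \<beta> * t)"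
      and s: "\<And>y a b t. y \<in> ball x0 r \<Longrightarrow> y + a \<in> ball x0 r \<Longrightarrow> y + b \<in> ball x0 r \<Longrightarrow> y + a + b \<in> ball x0 r \<Longrightarrow>
       0 \<le> t \<Longrightarrow> norm (F (flow f t (y + a + b)) - F (flow f t (y + a)) - F (flow f t (y + b)) + F (flow f t y))
         \<le> K * (norm a * norm b) * exp (- p * \<beta> * t)"
      using est[OF _ x0] by blast
    define C where "C = W + W * K / c"
    have C: "W \<le> C" "W * K / c \<le> C" "0 \<le> C" using W(1) K c by (auto simp: C_def)
    show "\<exists>r>0. \<exists>C\<ge>0. (\<forall>y\<in>ball x0 r. \<forall>z\<in>ball x0 r. norm (\<phi> y - \<phi> z) \<le> C * norm (y - z)) \<and>
      (\<forall>y a b. y \<in> ball x0 r \<longrightarrow> y + a \<in> ball x0 r \<longrightarrow> y + b \<in> ball x0 r \<longrightarrow> y + a + b \<in> ball x0 r \<longrightarrow>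
         norm (\<phi> (y + a + b) - \<phi> (y + a) - \<phi> (y + b) + \<phi> y) \<le> C * norm a * norm b)"
    proof (rule exI[of _ r], intro conjI r, rule exI[of _ C], intro conjI ballI allI impI C)
      fix y z assume yz: "y \<in> ball x0 r" "z \<in> ball x0 r"
      have "\<phi> y - \<phi> z = linear_form w (y - z) + (h y - h z)" by (simp add: \<phi>_def lin)
      then have "norm (\<phi> y - \<phi> z) \<le> norm (linear_form w (y - z)) + norm (h y - h z)"
        by (simp add: norm_triangle_ineq)
      also have "\<dots> \<le> W * norm (y - z) + W * (K * norm (y - z)) / c"
        using yz dom l by (intro add_mono W h_lip) auto
      also have "\<dots> = C * norm (y - z)" by (simp add: C_def distrib_right)
      finally show "norm (\<phi> y - \<phi> z) \<le> C * norm (y - z)" .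
    next
      fix y a b assume y: "y \<in> ball x0 r" "y + a \<in> ball x0 r" "y + b \<in> ball x0 r" "y + a + b \<in> ball x0 r"
      have "\<phi> (y + a + b) - \<phi> (y + a) - \<phi> (y + b) + \<phi> y = h (y + a + b) - h (y + a) - h (y + b) + h y"
        by (simp add: \<phi>_def lin)
      also have "norm \<dots> \<le> W * (K * (norm a * norm b)) / c"
        using y dom s[OF y] by (intro h_sec) auto
      also have "\<dots> = W * K / c * (norm a * norm b)" by simp
      also have "\<dots> \<le> C * (norm a * norm b)" using C(2) by (rule mult_right_mono) simp
      finally show "norm (\<phi> (y + a + b) - \<phi> (y + a) - \<phi> (y + b) + \<phi> y) \<le> C * norm a * norm b"
        by (simp only: mult.assoc)
    qed
  qed
  then show "Ck_on 1 ?D (\<lambda>x. linear_form w x + integral {0..} (G x))" by (simp only: \<phi>_def[abs_def] h_def)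
  \<comment> \<open>The integrand is the derivative of exp(-\<mu> t) w(s_t(x)), because w is a left eigenvector.\<close>
  have \<phi>_limit: "((\<lambda>t. E t * linear_form w (flow f t x)) \<longlongrightarrow> \<phi> x) at_top" if x: "x \<in> ?D" for x
  proof -
    define g where "g t = E t * linear_form w (flow f t x)" for t
    obtain K where K: "\<And>t. 0 \<le> t \<Longrightarrow> norm (G x t) \<le> K * exp (- c * t)" using Gbound[OF x] by blast
    have u: "((\<lambda>t. flow f t x) has_vector_derivative f (flow f t x)) (at t within {0..})" if "0 \<le> t" for t
      using solves_from_derivative[OF domain_of_attraction_flow(1)[OF lip x]] that by simp
    have dg: "(g has_vector_derivative G x t) (at t within {0..})" if t: "0 \<le> t" for t
    proof -
      have 1: "((\<lambda>t. linear_form w (flow f t x)) has_vector_derivative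
          linear_form w (f (flow f t x))) (at t within {0..})"
        by (rule bounded_linear.has_vector_derivative[OF bl u[OF t]])
      have 2: "(E has_vector_derivative - \<mu> * E t) (at t within {0..})"
      proof -
        have "((\<lambda>z. exp (- \<mu> * z)) has_field_derivative - \<mu> * exp (- \<mu> * complex_of_real t)) (at (complex_of_real t))"
          by (auto intro!: derivative_eq_intros)
        then have "((\<lambda>t. exp (- \<mu> * complex_of_real t)) has_vector_derivative - \<mu> * exp (- \<mu> * complex_of_real t)) (at t)"
          by (rule has_vector_derivative_real_field)
        then show ?thesis unfolding E_def by (rule has_vector_derivative_at_within)
      qed
      have "(g has_vector_derivative E t * linear_form w (f (flow f t x)) + - \<mu> * E t * linear_form w (flow f t x))
          (at t within {0..})"
        unfolding g_def by (rule has_vector_derivative_mult[OF 2 1])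
      moreover have "E t * linear_form w (f (flow f t x)) + - \<mu> * E t * linear_form w (flow f t x) = G x t"
        by (simp add: f lin linear_form_left_eigenvector[OF w] G_def E_def algebra_simps)
      ultimately show ?thesis by simp
    qed
    have g_eq: "g T = \<phi> x - integral {T..} (G x)" if T: "0 \<le> T" for T
    proof -
      have "(G x has_integral g T - g 0) {0..T}"
        using T by (intro fundamental_theorem_of_calculus)
          (auto intro: has_vector_derivative_within_subset[OF dg])
      moreover have iT: "G x integrable_on {T..}"
        by (rule exp_decay_integral_bound(1)[OF continuous_on_subset[OF contG[OF x]] K c]) (use T in auto)
      moreover have "{0..} = {0..T} \<union> {T..}" "{0..T} \<inter> {T..} = {T}" using T by auto
      ultimately have "h x = (g T - g 0) + integral {T..} (G x)"
        unfolding h_def by (simp add: integral_unique has_integral_integrable)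
      moreover have "g 0 = linear_form w x"
        using solves_from_initial[OF domain_of_attraction_flow(1)[OF lip x]] by (simp add: g_def E_def)
      ultimately show ?thesis by (simp add: \<phi>_def)
    qed
    have "((\<lambda>T. integral {T..} (G x)) \<longlongrightarrow> 0) at_top"
    proof (rule Lim_null_comparison)
      show "((\<lambda>T. K * exp (- c * T) / c) \<longlongrightarrow> 0) at_top" using c by real_asymp
      show "eventually (\<lambda>T. norm (integral {T..} (G x)) \<le> K * exp (- c * T) / c) at_top"
        using eventually_ge_at_top[of 0]
      proof eventually_elim
        case (elim T)
        show ?case
          by (rule exp_decay_integral_bound(2)[OF continuous_on_subset[OF contG[OF x]] K c]) (use elim in auto)
      qed
    qed
    then have "((\<lambda>T. \<phi> x - integral {T..} (G x)) \<longlongrightarrow> \<phi> x - 0) at_top" by (intro tendsto_intros)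
    moreover have "eventually (\<lambda>T. \<phi> x - integral {T..} (G x) = g T) at_top"
      using eventually_ge_at_top[of 0] by eventually_elim (simp add: g_eq)
    ultimately have "(g \<longlongrightarrow> \<phi> x - 0) at_top" by (rule Lim_transform_eventually)
    then have "(g \<longlongrightarrow> \<phi> x) at_top" by simp
    then show ?thesis by (simp only: g_def[abs_def])
  qed
  have \<phi>_flow: "\<phi> (flow f s x) = exp (\<mu> * complex_of_real s) * \<phi> x" if x: "x \<in> ?D" and s: "0 \<le> s" for x s
  proof (rule tendsto_unique[OF trivial_limit_at_top_linorder])
    show "((\<lambda>t. E t * linear_form w (flow f t (flow f s x))) \<longlongrightarrow> \<phi> (flow f s x)) at_top"
      by (rule \<phi>_limit[OF flow_in_domain_of_attraction(1)[OF lip x s]])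
    have "filterlim (\<lambda>t. s + t) at_top at_top"
      by (rule filterlim_tendsto_add_at_top[OF tendsto_const filterlim_ident])
    then have "((\<lambda>t. E (s + t) * linear_form w (flow f (s + t) x)) \<longlongrightarrow> \<phi> x) at_top"
      by (rule filterlim_compose[OF \<phi>_limit[OF x]])
    then have "((\<lambda>t. exp (\<mu> * complex_of_real s) * (E (s + t) * linear_form w (flow f (s + t) x)))
        \<longlongrightarrow> exp (\<mu> * complex_of_real s) * \<phi> x) at_top" by (intro tendsto_intros)
    then show "((\<lambda>t. E t * linear_form w (flow f t (flow f s x)))
        \<longlongrightarrow> exp (\<mu> * complex_of_real s) * \<phi> x) at_top"
    proof (rule Lim_transform_eventually)
      show "eventually (\<lambda>t. exp (\<mu> * complex_of_real s) * (E (s + t) * linear_form w (flow f (s + t) x))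
          = E t * linear_form w (flow f t (flow f s x))) at_top"
        using eventually_ge_at_top[of 0]
      proof eventually_elim
        case (elim t)
        have "exp (\<mu> * complex_of_real s) * E (s + t) = E t"
          by (simp add: E_def mult_exp_exp algebra_simps)
        then show ?case
          using flow_in_domain_of_attraction(2)[OF lip x s elim] by (simp flip: mult.assoc)
      qed
    qed
  qed
  show "frechet_derivative (\<lambda>x. linear_form w x + integral {0..} (G x)) (at x) (f x)
         = \<mu> * (linear_form w x + integral {0..} (G x))" if x: "x \<in> ?D" for x
  proof -
    have u0: "flow f 0 x = x" using solves_from_initial[OF domain_of_attraction_flow(1)[OF lip x]] .
    have "\<phi> differentiable (at x)" using \<phi>_C1 x by simp
    then have d\<phi>: "(\<phi> has_derivative frechet_derivative \<phi> (at x)) (at (flow f 0 x))"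
      by (simp add: frechet_derivative_works u0)
    have "((\<lambda>t. flow f t x) has_vector_derivative f x) (at 0 within {0..})"
      using solves_from_derivative[OF domain_of_attraction_flow(1)[OF lip x], of 0] by (simp add: u0)
    then have du: "((\<lambda>t. flow f t x) has_derivative (\<lambda>s. s *\<^sub>R f x)) (at 0 within {0..})"
      by (simp add: has_vector_derivative_def)
    have "((\<lambda>t. \<phi> (flow f t x)) has_derivative (\<lambda>s. frechet_derivative \<phi> (at x) (s *\<^sub>R f x))) (at 0 within {0..})"
      by (rule has_derivative_compose[where f = "\<lambda>t. flow f t x" and f' = "\<lambda>s. s *\<^sub>R f x", OF du d\<phi>])
    then have 1: "((\<lambda>t. \<phi> (flow f t x)) has_vector_derivative frechet_derivative \<phi> (at x) (f x)) (at 0 within {0..})"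
      by (simp add: has_vector_derivative_def linear_scale[OF has_derivative_linear[OF d\<phi>]])
    have "((\<lambda>z. exp (\<mu> * z) * \<phi> x) has_field_derivative \<mu> * \<phi> x) (at (complex_of_real 0))"
      by (auto intro!: derivative_eq_intros)
    then have "((\<lambda>t. exp (\<mu> * complex_of_real t) * \<phi> x) has_vector_derivative \<mu> * \<phi> x) (at 0)"
      by (rule has_vector_derivative_real_field[where f = "\<lambda>z. exp (\<mu> * z) * \<phi> x"])
    then have "((\<lambda>t. exp (\<mu> * complex_of_real t) * \<phi> x) has_vector_derivative \<mu> * \<phi> x) (at 0 within {0..})"
      by (rule has_vector_derivative_at_within)
    then have 2: "((\<lambda>t. \<phi> (flow f t x)) has_vector_derivative \<mu> * \<phi> x) (at 0 within {0..})"
      by (rule has_vector_derivative_transform[rotated 2]) (use \<phi>_flow[OF x] in auto)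
    have "{0..} - {0} = {0::real <..}" by auto
    then have "at (0::real) within {0..} \<noteq> bot" by (simp add: at_within_eq_bot_iff)
    from vector_derivative_unique_within[OF this 1 2]
    show ?thesis by (simp only: \<phi>_def[abs_def] h_def)
  qed
  show "purely_nonlinear (\<lambda>x. integral {0..} (G x))"
  proof -
    have "f 0 = 0" by (simp add: f F0)
    then have "0 \<in> ?D" by (rule zero_in_domain_of_attraction)
    obtain r K where r: "0 < r" and K: "0 \<le> K" and dom: "ball 0 r \<subseteq> ?D"
      and small: "\<forall>y\<in>ball 0 r. \<forall>t\<ge>0. norm (F (flow f t y)) \<le> K * norm y powr p * exp (- p * \<beta> * t)"
      using size[OF \<open>0 \<in> ?D\<close>] by blast
    have hy: "norm (h y) \<le> W * (K * norm y powr p) / c" if "y \<in> ball 0 r" for y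
      using that dom small by (intro h_size) auto
    have h0: "h 0 = 0" using hy[of 0] r by simp
    have "(h has_derivative (\<lambda>_. 0)) (at 0)"
    proof (rule quadratic_remainder_imp_has_derivative[OF r bounded_linear_zero])
      fix v :: "real^'n" assume v: "norm v < r"
      have "norm v powr p \<le> r powr (p - 2) * (norm v)\<^sup>2"
      proof (cases "v = 0")
        case False
        have "norm v powr p = norm v powr (p - 2) * norm v powr 2"
          using powr_add[of "norm v" "p - 2" 2] by simp
        also have "\<dots> \<le> r powr (p - 2) * norm v powr 2"
          using v p by (intro mult_right_mono powr_mono2) auto
        finally show ?thesis using False by simp
      qed (use p in simp)
      then have "W * (K * norm v powr p) / c \<le> W * (K * (r powr (p - 2) * (norm v)\<^sup>2)) / c"
        using W K c by (intro divide_right_mono mult_left_mono) auto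
      then have "norm (h v) \<le> W * (K * (r powr (p - 2) * (norm v)\<^sup>2)) / c"
        using hy[of v] v by (simp add: dist_norm)
      then show "norm (h (0 + v) - h 0 - 0) \<le> W * (K * r powr (p - 2)) / c * (norm v)\<^sup>2"
        by (simp add: h0)
    qed
    then show ?thesis unfolding purely_nonlinear_def using h0 by (simp only: h_def[abs_def])
  qed
qed

theorem theorem7:
  fixes f :: "real^'n \<Rightarrow> real^'n"
    and \<mu> \<mu>max :: complex and w :: "complex^'n" and l :: real
  assumes smooth: "smooth_on UNIV f"
    and hyperbolic: "hyperbolic_equilibrium f"
    and principal: "\<exists>L \<Phi>. principal_eigenfunction_vector f L \<Phi>"
    and stable: "asymptotically_stable f"
    and l: "l \<ge> 2"
    and order: "(\<lambda>x. norm (nonlinear_part f x)) \<in> O[at 0](\<lambda>x. norm x powr l)"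
    and mu: "eigenvalue_of (linearization f) \<mu>"
    and w: "left_eigenvector_of (linearization f) \<mu> w"
    and mu_max: "eigenvalue_of (linearization f) \<mu>max"
      "\<forall>\<nu>. eigenvalue_of (linearization f) \<nu> \<longrightarrow> Re \<nu> \<le> Re \<mu>max"
    and gap: "- Re \<mu> + l * Re \<mu>max < 0"
  shows "(\<forall>x \<in> domain_of_attraction f.
            (\<lambda>t. exp (- \<mu> * complex_of_real t) * linear_form w (nonlinear_part f (flow f t x)))
              integrable_on {0..}) \<and>
         principal_eigenfunction_on (domain_of_attraction f) f \<mu> w
           (\<lambda>x. linear_form w x +
              integral {0..}
                (\<lambda>t. exp (- \<mu> * complex_of_real t) * linear_form w (nonlinear_part f (flow f t x))))"
proof -
  define A where "A = linearization f"
  define F where "F = nonlinear_part f"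
  define \<alpha> where "\<alpha> = - Re \<mu>max"
  \<comment> \<open>The rate has to satisfy \<beta> > 0 and \<beta> > q, where q < \<alpha> by the gap condition; so a midpoint will do.\<close>
  define q where "q = - Re \<mu> / l"
  define m where "m = max 0 q"
  define \<beta> where "\<beta> = (\<alpha> + m) / 2"
  have f: "f x = A *v x + F x" for x by (simp add: A_def F_def nonlinear_part_def)
  have F0: "F 0 = 0" using hyperbolic by (simp add: F_def nonlinear_part_def hyperbolic_equilibrium_def)
  have smF: "smooth_on UNIV F"
    unfolding F_def nonlinear_part_def[abs_def]
    by (intro smooth_on_diff smooth smooth_on_bounded_linear matrix_vector_mul_bounded_linear)
  have van: "vanishes_to_order F l"
    using smooth_on_continuous_on[OF smF] F0 order l
    by (intro bigo_powr_imp_vanishes_to_order) (auto simp: F_def)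
  have ev: "Re z \<le> - \<alpha>" if "eigenvalue_of A z" for z
    using mu_max(2) that by (simp add: A_def \<alpha>_def)
  have "Re \<mu> \<le> - \<alpha>" using ev mu by (simp add: A_def)
  then have "(l - 1) * - \<alpha> < 0" using gap by (simp add: \<alpha>_def algebra_simps)
  then have \<alpha>: "0 < \<alpha>" using l by (simp add: zero_less_mult_iff)
  have "q < \<alpha>" using gap l by (simp add: q_def \<alpha>_def less_divide_eq mult.commute)
  then have "0 \<le> m" "m < \<alpha>" "q \<le> m" using \<alpha> by (auto simp: m_def)
  then have \<beta>: "0 < \<beta>" "\<beta> < \<alpha>" "q < \<beta>" using \<alpha> by (simp_all add: \<beta>_def)
  have "l * q < l * \<beta>" using \<beta>(3) l by simp
  then have gap': "0 < Re \<mu> + l * \<beta>" using l by (simp add: q_def)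
  have stab: "lyapunov_stable f" using stable by (simp add: asymptotically_stable_def)
  note main = decaying_integral_eigenfunction[OF smF van l F0 f
      smooth_on_imp_lipschitz_on_bounded[OF smooth] ev \<beta>(1,2) gap' stab w[folded A_def]]
  show ?thesis
    unfolding principal_eigenfunction_on_def F_def[symmetric]
    using main mu w by blast
qed

end
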